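(* Let $G$ be a $T_1$ topological locally compact fan loop for which there exists a compact subgroup $N_0=N_0(G)$ in $N(G)$ such that $t(a,b,c)\in N_0$ and $p(a,b,c)\in N_0$ for all $a,b,c\in G$. Let $f_0\in\Upsilon(G,N_0)$, let $g\in C^+_{0,0}(G)$ be nonzero, and let $J=J_g$ be the functional on $C^+_{0,0}(G)$ given by $J_g(f)=J_{f_0}(f)/J_{f_0}(g)$, where $J_{f_0}(f)=\lim_{\{\phi_U\}}J_{\phi_U,f_0}(f)$. Then: (1) $J(f)\ge 0$ for each $f\in C^+_{0,0}(G)$, and if $f$ is nonzero, then $J(f)>0$; (2) $J(\alpha_1f_1+\dots+\alpha_nf_n)=\alpha_1J(f_1)+\dots+\alpha_nJ(f_n)$ for all $f_1,\dots,f_n\in C^+_{0,0}(G)$ and $\alpha_1\ge 0,\dots,\alpha_n\ge 0$; (3) $J({}_bf)=J(f)$ for each $b\in G$ and $f\in C^+_{0,0}(G)$, where ${}_bf(x)=f(bx)$.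
   Context: A loop is a set $G$ with a binary multiplication such that for all $a,b\in G$ there is a unique $x$ with $ax=b$ (written $x=a\backslash b$) and a unique $y$ with $ya=b$ (written $y=b/a$), and there is $e\in G$ with $eg=ge=g$ for all $g$. The nucleus is $N(G)=\{a\in G:\ (ab)c=a(bc),\ (ba)c=b(ac),\ (bc)a=b(ca)\ \text{for all } b,c\in G\}$; it is a group. A fan loop is a loop such that for all $a,b,c\in G$ there are $t(a,b,c),p(a,b,c)\in N(G)$ with $(ab)c=t(a,b,c)\,(a(bc))$ and $(ab)c=(a(bc))\,p(a,b,c)$ (these elements are then unique). A topological fan loop is a fan loop with a topology for which multiplication, $(a,b)\mapsto a\backslash b$ and $(a,b)\mapsto b/a$ are jointly continuous. The fan $N_0(G)$ is the minimal closed subgroup of $G$ containing all $t(a,b,c)$ and $p(a,b,c)$. $C_{0,0}^+(G)$ is the set of continuous functions $f:G\to[0,\infty)$ with compact support. For $f,\phi\in C_{0,0}^+(G)$ with $\phi$ nonzero, $$(f:\phi)=\inf\Big\{\sum_{j=1}^m c_j:\ m\ge 1,\ b_1,\dots,b_m\in G,\ c_1,\dots,c_m\in(0,\infty),\ \forall x\in G\ f(x)\le\sum_{j=1}^m c_j\phi(b_jx)\Big\}.$$ For nonzero $\phi,f_0\in C_{0,0}^+(G)$, $J_{\phi,f_0}(f)=(f:\phi)/(f_0:\phi)$. $\Upsilon(G,N_0)$ is the set of all nonzero $h\in C^+_{0,0}(G)$ such that $h(\gamma a)=h(a)$ for all $a\in G$, $\gamma\in N_0$. The limit defining $J_{f_0}(f)$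 is taken over the functions $\phi_U$, where $U$ is an open neighborhood of $e$ and $\phi_U\in C^+_{0,0}(G)$ is nonzero with $\phi_U(x)=0$ for $x\in G- U$; the pairs $(U,\phi_U)$ are directed by reverse inclusion of $U$. (Under the hypotheses of the theorem, this limit exists, and $J_{f_0}(g)>0$ for nonzero $g$; $J_g$ does not depend on the choice of $f_0$.) *)

theory Defs
  imports "HOL-Analysis.Analysis"
begin

text \<open>The underlying set of a loop is a whole type, so arbitrary loops are
  covered by quantifying over the type variable.\<close>

locale loop =
  fixes mult :: "'a \<Rightarrow> 'a \<Rightarrow> 'a"  (infixl "\<cdot>" 70)
  assumes ex1_ldiv: "\<exists>!x. a \<cdot> x = b"
    and ex1_rdiv: "\<exists>!y. y \<cdot> a = b"
    and ex_unit: "\<exists>e. \<forall>g. e \<cdot> g = g \<and> g \<cdot> e = g"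
begin

definition unit :: 'a
  where "unit = (THE e. \<forall>g. e \<cdot> g = g \<and> g \<cdot> e = g)"

definition ldiv :: "'a \<Rightarrow> 'a \<Rightarrow> 'a"
  where "ldiv a b = (THE x. a \<cdot> x = b)"

text \<open>The argument order follows the notation \<open>b/a\<close>.\<close>

definition rdiv :: "'a \<Rightarrow> 'a \<Rightarrow> 'a"
  where "rdiv b a = (THE y. y \<cdot> a = b)"

definition nucleus :: "'a set"
  where "nucleus = {a. \<forall>b c. (a \<cdot> b) \<cdot> c = a \<cdot> (b \<cdot> c) \<and>
                             (b \<cdot> a) \<cdot> c = b \<cdot> (a \<cdot> c) \<and>
                             (b \<cdot> c) \<cdot> a = b \<cdot> (c \<cdot> a)}"

text \<open>A subloop whose multiplication is associative.\<close>

definition is_subgroup :: "'a set \<Rightarrow> bool"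
  where "is_subgroup H \<longleftrightarrow>
    unit \<in> H \<and>
    (\<forall>a\<in>H. \<forall>b\<in>H. a \<cdot> b \<in> H \<and> ldiv a b \<in> H \<and> rdiv b a \<in> H) \<and>
    (\<forall>a\<in>H. \<forall>b\<in>H. \<forall>c\<in>H. (a \<cdot> b) \<cdot> c = a \<cdot> (b \<cdot> c))"

text \<open>The covering number \<open>(f : \<phi>)\<close>.\<close>

definition covering_number :: "('a \<Rightarrow> real) \<Rightarrow> ('a \<Rightarrow> real) \<Rightarrow> real"
  where "covering_number f \<phi> =
    Inf {(\<Sum>j=1..m. c j) | (m::nat) (b :: nat \<Rightarrow> 'a) (c :: nat \<Rightarrow> real).
           1 \<le> m \<and> (\<forall>j\<in>{1..m}. 0 < c j) \<and>
           (\<forall>x. f x \<le> (\<Sum>j=1..m. c j * \<phi> (b j \<cdot> x)))}"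

definition J_quot :: "('a \<Rightarrow> real) \<Rightarrow> ('a \<Rightarrow> real) \<Rightarrow> ('a \<Rightarrow> real) \<Rightarrow> real"
  where "J_quot \<phi> f\<^sub>0 f = covering_number f \<phi> / covering_number f\<^sub>0 \<phi>"

definition left_translate :: "'a \<Rightarrow> ('a \<Rightarrow> real) \<Rightarrow> 'a \<Rightarrow> real"
  where "left_translate b f = (\<lambda>x. f (b \<cdot> x))"

end

locale fan_loop = loop +
  assumes ex_fan: "\<exists>t\<in>nucleus. \<exists>p\<in>nucleus.
    (a \<cdot> b) \<cdot> c = t \<cdot> (a \<cdot> (b \<cdot> c)) \<and> (a \<cdot> b) \<cdot> c = (a \<cdot> (b \<cdot> c)) \<cdot> p"
begin

definition t :: "'a \<Rightarrow> 'a \<Rightarrow> 'a \<Rightarrow> 'a"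
  where "t a b c = (THE s. s \<in> nucleus \<and> (a \<cdot> b) \<cdot> c = s \<cdot> (a \<cdot> (b \<cdot> c)))"

definition p :: "'a \<Rightarrow> 'a \<Rightarrow> 'a \<Rightarrow> 'a"
  where "p a b c = (THE s. s \<in> nucleus \<and> (a \<cdot> b) \<cdot> c = (a \<cdot> (b \<cdot> c)) \<cdot> s)"

end

definition C00_plus :: "('a::topological_space \<Rightarrow> real) set"
  where "C00_plus = {f. continuous_on UNIV f \<and> (\<forall>x. 0 \<le> f x) \<and> compact (closure {x. f x \<noteq> 0})}"

locale topological_fan_loop = fan_loop mult
  for mult :: "'a::topological_space \<Rightarrow> 'a \<Rightarrow> 'a"  (infixl "\<cdot>" 70) +
  assumes continuous_mult: "continuous_on UNIV (\<lambda>(a, b). a \<cdot> b)"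
    and continuous_ldiv: "continuous_on UNIV (\<lambda>(a, b). ldiv a b)"
    and continuous_rdiv: "continuous_on UNIV (\<lambda>(a, b). rdiv b a)"
begin

text \<open>In the \<open>T\<^sub>1\<close> case the nucleus is one of the sets \<open>H\<close>, so the intersection is
  over a nonempty family and is the least closed subgroup containing all
  \<open>t a b c\<close> and \<open>p a b c\<close>.\<close>

definition fan :: "'a set"
  where "fan = \<Inter>{H. closed H \<and> is_subgroup H \<and> (\<forall>a b c. t a b c \<in> H \<and> p a b c \<in> H)}"

definition Upsilon :: "'a set \<Rightarrow> ('a \<Rightarrow> real) set"
  where "Upsilon N\<^sub>0 = {h \<in> C00_plus. h \<noteq> (\<lambda>x. 0) \<and> (\<forall>a. \<forall>\<gamma>\<in>N\<^sub>0. h (\<gamma> \<cdot> a) = h a)}"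

text \<open>The section filter of the pairs \<open>(V, \<phi>\<^sub>V)\<close> directed by reverse inclusion of \<open>V\<close>,
  where \<open>V\<close> is an open neighbourhood of the unit and \<open>\<phi>\<^sub>V\<close> vanishes outside \<open>V\<close>.\<close>

definition small_support_filter :: "('a set \<times> ('a \<Rightarrow> real)) filter"
  where "small_support_filter =
    (INF U\<in>{U. open U \<and> unit \<in> U}.
       principal {(V, \<phi>). open V \<and> unit \<in> V \<and> V \<subseteq> U \<and>
                          \<phi> \<in> C00_plus \<and> \<phi> \<noteq> (\<lambda>x. 0) \<and> (\<forall>x. x \<notin> V \<longrightarrow> \<phi> x = 0)})"

definition J_lim :: "('a \<Rightarrow> real) \<Rightarrow> ('a \<Rightarrow> real) \<Rightarrow> real"
  where "J_lim f\<^sub>0 f = Lim small_support_filter (\<lambda>(U, \<phi>). J_quot \<phi> f\<^sub>0 f)"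

text \<open>The normalised functional \<open>J\<^sub>g\<close>; the auxiliary \<open>f\<^sub>0\<close> is kept as an argument.\<close>

definition J_normalized :: "('a \<Rightarrow> real) \<Rightarrow> ('a \<Rightarrow> real) \<Rightarrow> ('a \<Rightarrow> real) \<Rightarrow> real"
  where "J_normalized f\<^sub>0 g f = J_lim f\<^sub>0 f / J_lim f\<^sub>0 g"

end

end

theory Submission
  imports Defs
begin

text \<open>The idea is to exhibit \<open>J\<close> as a Haar integral. Write \<open>N\<close> for the fan. Minimality of \<open>N\<close> makes it
normal (\<open>fan_normal\<close>), and multiplication is associative up to left factors from \<open>N\<close>. So \<open>G\<close> is an
extension of the locally compact group \<open>G/N\<close> by the compact group \<open>N\<close>, and a left translation
carries the coset \<open>xN\<close> to \<open>(bx)N\<close> by \<open>x\<gamma> \<mapsto> (bx)\<gamma>\<close>. Averaging a function over the cosets of \<open>N\<close> and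
integrating the result over \<open>G/N\<close> therefore gives a positive linear functional \<open>haar\<close> on \<open>C00_plus\<close>
that is invariant under left translations.

Its two ingredients are built by different means. The mean on \<open>N\<close> comes from finite averages of
translates, which approximate constants uniformly (\<open>almost_constant_average\<close>). The functional on
\<open>N\<close>-invariant functions, which are the functions on \<open>G/N\<close>, comes from covering numbers
as in Weil's construction of Haar measure (\<open>invariant_functional_exists\<close>). The reason for
the detour through \<open>N\<close>-invariant functions is that \<open>b\<^sub>j(bx)\<close> and \<open>(b\<^sub>jb)x\<close> differ by an element of \<open>N\<close> that
varies with \<open>x\<close>: for \<open>N\<close>-invariant \<open>\<phi>\<close> the number \<open>(f : \<phi>)\<close> is invariant under translations of \<open>f\<close> and
submultiplicative, as in a group, but the functions \<open>\<phi>\<close> supported near the unit are not of this kind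
unless \<open>N\<close> is trivial.

It remains to show that \<open>(f : \<phi>) \<cdot> haar \<phi> \<longlongrightarrow> haar f\<close> for arbitrary \<open>\<phi>\<close> whose support shrinks to the unit
(\<open>tendsto_covering_number_haar\<close>); then \<open>J_lim f0 f = haar f / haar f0\<close>, and the three claims are
properties of \<open>haar\<close>. Integrating a covering gives \<open>haar f \<le> (f : \<phi>) \<cdot> haar \<phi>\<close>. In the other
direction, let \<open>y\<inverse>\<close> be the left inverse of \<open>y\<close> and \<open>\<phi>'(y) = \<phi>(y\<inverse>)\<close>. Since
\<open>haar (\<lambda>y. \<phi>(y\<inverse>x))\<close> is independent of \<open>x\<close> and \<open>\<phi>(y\<inverse>x)\<close> vanishes unless \<open>y\<close> is close to \<open>x\<close>, the number
\<open>f(x) \<cdot> haar \<phi>'\<close> is close to \<open>haar (\<lambda>y. f(y) \<phi>(y\<inverse>x))\<close>; replacing this integral by a finite sum covers \<open>f\<close>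
by translates of \<open>\<phi>\<close> at a total cost close to \<open>haar f / haar \<phi>'\<close> (\<open>covering_number_upper\<close>). Comparing
both bounds for one fixed function shows that \<open>haar \<phi>'\<close> is at most slightly larger than \<open>haar \<phi>\<close>, and
applying this to \<open>\<phi>'\<close>, together with \<open>haar \<phi>'' = haar \<phi>\<close>, shows that the two are asymptotically equal.\<close>

section \<open>Compactness\<close>


lemma compact_finite_subcover:
  assumes K: "compact K" and opn: "\<And>i. i \<in> I \<Longrightarrow> open (F i)" and cover: "\<And>x. x \<in> K \<Longrightarrow> \<exists>i\<in>I. x \<in> F i"
  shows "\<exists>J. finite J \<and> J \<subseteq> I \<and> (\<forall>x\<in>K. \<exists>i\<in>J. x \<in> F i)"
proof (rule compactE_image[OF K])
  show "K \<subseteq> (\<Union>i\<in>I. F i)"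
  proof
    fix x assume "x \<in> K"
    from cover[OF this] show "x \<in> (\<Union>i\<in>I. F i)" by simp
  qed
  show "open (F i)" if "i \<in> I" for i using opn that .
  fix J assume J: "J \<subseteq> I" "finite J" "K \<subseteq> (\<Union>i\<in>J. F i)"
  have "\<forall>x\<in>K. \<exists>i\<in>J. x \<in> F i" using J(3) by (simp add: subset_iff)
  with J show ?thesis by (intro exI[of _ J]) simp
qed

lemma uniform_on_compact_parameter:
  fixes h :: "'a::topological_space \<Rightarrow> 'b::topological_space \<Rightarrow> real"
  assumes h: "continuous_on (U \<times> K) (\<lambda>(x, y). h x y)" and K: "compact K"
    and x0: "x0 \<in> U" and \<epsilon>: "0 < \<epsilon>"
  shows "\<exists>X. open X \<and> x0 \<in> X \<and> (\<forall>x\<in>X \<inter> U. \<forall>y\<in>K. \<bar>h x y - h x0 y\<bar> \<le> \<epsilon>)"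
proof (rule continuous_on_prod_compactE[OF h K x0 \<epsilon>])
  fix X assume X: "x0 \<in> X" "open X" "\<forall>x\<in>X \<inter> U. \<forall>y\<in>K. dist (case (x, y) of (x, y) \<Rightarrow> h x y) (case (x0, y) of (x, y) \<Rightarrow> h x y) \<le> \<epsilon>"
  show ?thesis
  proof (intro exI conjI)
    show "\<forall>x\<in>X \<inter> U. \<forall>y\<in>K. \<bar>h x y - h x0 y\<bar> \<le> \<epsilon>" using X(3) by (simp add: dist_real_def)
  qed (use X in simp_all)
qed

section \<open>The invariant mean on a compact group\<close>

definition translate_average :: "('a \<Rightarrow> 'a \<Rightarrow> 'a) \<Rightarrow> 'a set \<Rightarrow> ('a \<Rightarrow> real) \<Rightarrow> 'a \<Rightarrow> real"
  where "translate_average m S f x = (\<Sum>a\<in>S. f (m a x)) / real (card S)"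

text \<open>With \<open>m\<close> the multiplication these are averages of left translates, with \<open>m\<close> the opposite
multiplication averages of right translates.\<close>

definition iterated_average :: "('a \<Rightarrow> 'a \<Rightarrow> 'a) \<Rightarrow> 'a set list \<Rightarrow> ('a \<Rightarrow> real) \<Rightarrow> 'a \<Rightarrow> real"
  where "iterated_average m Ss f = foldr (translate_average m) Ss f"

definition finite_subsets_list :: "'a set \<Rightarrow> 'a set list \<Rightarrow> bool"
  where "finite_subsets_list N Ss \<longleftrightarrow> (\<forall>S\<in>set Ss. finite S \<and> S \<noteq> {} \<and> S \<subseteq> N)"

lemma finite_subsets_list_simps [simp]:
  "finite_subsets_list N []"
  "finite_subsets_list N (S # Ss) \<longleftrightarrow> finite S \<and> S \<noteq> {} \<and> S \<subseteq> N \<and> finite_subsets_list N Ss"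
  "finite_subsets_list N (Ss @ Ts) \<longleftrightarrow> finite_subsets_list N Ss \<and> finite_subsets_list N Ts"
  by (auto simp: finite_subsets_list_def)

lemma iterated_average_simps [simp]:
  "iterated_average m [] f = f"
  "iterated_average m (S # Ss) f = translate_average m S (iterated_average m Ss f)"
  "iterated_average m (Ss @ Ts) f = iterated_average m Ss (iterated_average m Ts f)"
  by (auto simp: iterated_average_def)

lemma iterated_average_add:
  "iterated_average m Ss (\<lambda>x. f x + g x) = (\<lambda>x. iterated_average m Ss f x + iterated_average m Ss g x)"
  by (induction Ss) (auto simp: translate_average_def sum.distrib add_divide_distrib fun_eq_iff)

lemma iterated_average_scale:
  "iterated_average m Ss (\<lambda>x. \<alpha> * f x) = (\<lambda>x. \<alpha> * iterated_average m Ss f x)"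
  by (induction Ss) (auto simp: translate_average_def sum_distrib_left fun_eq_iff)

locale compact_group =
  fixes N :: "'a::topological_space set"
    and mul :: "'a \<Rightarrow> 'a \<Rightarrow> 'a"  (infixl "\<odot>" 70)
    and e :: 'a and inv :: "'a \<Rightarrow> 'a"
  assumes compact: "compact N"
    and mul_closed: "x \<in> N \<Longrightarrow> y \<in> N \<Longrightarrow> x \<odot> y \<in> N"
    and e_closed: "e \<in> N"
    and inv_closed: "x \<in> N \<Longrightarrow> inv x \<in> N"
    and assoc: "x \<in> N \<Longrightarrow> y \<in> N \<Longrightarrow> z \<in> N \<Longrightarrow> (x \<odot> y) \<odot> z = x \<odot> (y \<odot> z)"
    and left_one: "x \<in> N \<Longrightarrow> e \<odot> x = x"
    and right_one: "x \<in> N \<Longrightarrow> x \<odot> e = x"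
    and left_inv: "x \<in> N \<Longrightarrow> inv x \<odot> x = e"
    and right_inv: "x \<in> N \<Longrightarrow> x \<odot> inv x = e"
    and cont: "continuous_on (N \<times> N) (\<lambda>(x, y). x \<odot> y)"
begin

text \<open>Every statement about averages of left translates transfers to right translates through this lemma.\<close>

lemma opposite: "compact_group N (\<lambda>x y. y \<odot> x) e inv"
proof
  have "continuous_on (N \<times> N) (\<lambda>z. (\<lambda>(x, y). x \<odot> y) (snd z, fst z))"
    by (rule continuous_on_compose2[OF cont]) (auto intro!: continuous_intros)
  then show "continuous_on (N \<times> N) (\<lambda>(x, y). y \<odot> x)"
    by (simp add: case_prod_unfold)
qed (simp_all add: compact mul_closed e_closed inv_closed assoc left_one right_one left_inv right_inv)

lemma continuous_on_mul:
  assumes "continuous_on S f" "continuous_on S g" "f ` S \<subseteq> N" "g ` S \<subseteq> N"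
  shows "continuous_on S (\<lambda>x. f x \<odot> g x)"
proof -
  have "continuous_on S (\<lambda>x. (\<lambda>(x, y). x \<odot> y) (f x, g x))"
    by (rule continuous_on_compose2[OF cont]) (use assms in \<open>auto intro!: continuous_intros\<close>)
  then show ?thesis by simp
qed

lemma iterated_average_lower:
  assumes "finite_subsets_list N Ss" "\<forall>x\<in>N. l \<le> f x" "x \<in> N"
  shows "l \<le> iterated_average (\<odot>) Ss f x"
  using assms(1,3)
proof (induction Ss arbitrary: x)
  case Nil
  then show ?case using assms(2) by simp
next
  case (Cons S Ss)
  then have "(\<Sum>a\<in>S. l) \<le> (\<Sum>a\<in>S. iterated_average (\<odot>) Ss f (a \<odot> x))"
    by (intro sum_mono) (auto intro: mul_closed)
  with Cons show ?case
    by (simp add: translate_average_def pos_le_divide_eq card_gt_0_iff mult.commute)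
qed

lemma iterated_average_upper:
  assumes "finite_subsets_list N Ss" "\<forall>x\<in>N. f x \<le> u" "x \<in> N"
  shows "iterated_average (\<odot>) Ss f x \<le> u"
proof -
  have "- u \<le> iterated_average (\<odot>) Ss (\<lambda>x. -1 * f x) x"
    using assms by (intro iterated_average_lower) auto
  then show ?thesis unfolding iterated_average_scale by simp
qed

lemma iterated_average_close:
  assumes "finite_subsets_list N Ss" "\<forall>x\<in>N. \<bar>f x - c\<bar> \<le> \<epsilon>" "x \<in> N"
  shows "\<bar>iterated_average (\<odot>) Ss f x - c\<bar> \<le> \<epsilon>"
proof -
  have "c - \<epsilon> \<le> iterated_average (\<odot>) Ss f x"
    using assms by (intro iterated_average_lower) (auto simp: abs_le_iff algebra_simps)
  moreover have "iterated_average (\<odot>) Ss f x \<le> c + \<epsilon>"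
    using assms by (intro iterated_average_upper) (auto simp: abs_le_iff algebra_simps)
  ultimately show ?thesis by linarith
qed

lemma iterated_average_continuous:
  assumes "finite_subsets_list N Ss" "continuous_on N f"
  shows "continuous_on N (iterated_average (\<odot>) Ss f)"
  using assms(1)
proof (induction Ss)
  case (Cons S Ss)
  have "continuous_on N (\<lambda>x. iterated_average (\<odot>) Ss f (a \<odot> x))" if "a \<in> S" for a
  proof (rule continuous_on_compose2[of N])
    show "continuous_on N (\<lambda>x. a \<odot> x)"
      using Cons.prems that by (intro continuous_on_mul) (auto intro!: continuous_intros)
  qed (use Cons that in \<open>auto intro: mul_closed\<close>)
  with Cons.prems show ?case
    unfolding iterated_average_simps translate_average_def
    by (intro continuous_intros) auto
qed (use assms(2) in simp)

lemma iterated_average_right_translate: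
  assumes "finite_subsets_list N Ss" "x \<in> N" "b \<in> N"
  shows "iterated_average (\<odot>) Ss (\<lambda>x. f (x \<odot> b)) x = iterated_average (\<odot>) Ss f (x \<odot> b)"
  using assms(1,2)
proof (induction Ss arbitrary: x)
  case (Cons S Ss)
  then show ?case
    by (auto simp: translate_average_def assms(3) assoc subset_iff mul_closed
        intro!: arg_cong[where f="\<lambda>z. z / _"] sum.cong)
qed simp

text \<open>A left and a right translation commute by associativity, hence so do the two kinds of averages. This is
what forces their almost constant values to agree.\<close>

lemma averages_commute:
  assumes "finite_subsets_list N Ss" "finite_subsets_list N Rs" "x \<in> N"
  shows "iterated_average (\<odot>) Ss (iterated_average (\<lambda>a x. x \<odot> a) Rs f) x =
    iterated_average (\<lambda>a x. x \<odot> a) Rs (iterated_average (\<odot>) Ss f) x"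
  using assms(2,3)
proof (induction Rs arbitrary: x)
  case (Cons R Rs)
  let ?g = "iterated_average (\<lambda>a x. x \<odot> a) Rs f"
  have sum_out: "iterated_average (\<odot>) Ss (\<lambda>x. \<Sum>b\<in>R. ?g (x \<odot> b)) x
      = (\<Sum>b\<in>R. iterated_average (\<odot>) Ss (\<lambda>x. ?g (x \<odot> b)) x)" if "finite R" for R
    using that
  proof induction
    case empty
    then show ?case using iterated_average_scale[of "(\<odot>)" Ss 0 "\<lambda>x. 0"] by simp
  next
    case (insert b R)
    then show ?case by (simp add: iterated_average_add)
  qed
  have "iterated_average (\<odot>) Ss (translate_average (\<lambda>a x. x \<odot> a) R ?g) x
      = iterated_average (\<odot>) Ss (\<lambda>x. (1 / card R) * (\<Sum>b\<in>R. ?g (x \<odot> b))) x"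
    by (simp add: translate_average_def[abs_def])
  also have "\<dots> = (1 / card R) * (\<Sum>b\<in>R. iterated_average (\<odot>) Ss (\<lambda>x. ?g (x \<odot> b)) x)"
    unfolding iterated_average_scale using Cons.prems by (simp add: sum_out)
  also have "\<dots> = (1 / card R) * (\<Sum>b\<in>R. iterated_average (\<odot>) Ss ?g (x \<odot> b))"
    using Cons.prems assms(1)
    by (intro arg_cong[where f="\<lambda>z. _ * z"] sum.cong) (auto simp: iterated_average_right_translate subset_iff)
  also have "\<dots> = (1 / card R) * (\<Sum>b\<in>R. iterated_average (\<lambda>a x. x \<odot> a) Rs (iterated_average (\<odot>) Ss f) (x \<odot> b))"
    using Cons by (intro arg_cong[where f="\<lambda>z. _ * z"] sum.cong) (auto simp: subset_iff mul_closed)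
  finally show ?case unfolding iterated_average_simps translate_average_def[of _ _ _ x] by simp
qed simp

text \<open>Finitely many \<open>a\<close> suffice to move any point close to any other one. Closeness is measured by all left
translates of \<open>f\<close> at once, so that one finite set serves every average of left translates of \<open>f\<close>.
For given \<open>x\<close> and \<open>y\<close> the element \<open>y x\<inverse>\<close> works exactly, and by compactness of \<open>N\<close> it still works
near \<open>(x, y)\<close>.\<close>

lemma uniform_finite_transporters:
  fixes f :: "'a \<Rightarrow> real"
  assumes f: "continuous_on N f" and \<epsilon>: "0 < \<epsilon>"
  shows "\<exists>S. finite S \<and> S \<noteq> {} \<and> S \<subseteq> N \<and>
    (\<forall>x\<in>N. \<forall>y\<in>N. \<exists>a\<in>S. \<forall>c\<in>N. \<bar>f (c \<odot> (a \<odot> x)) - f (c \<odot> y)\<bar> \<le> \<epsilon>)"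
proof -
  have "\<exists>X. open X \<and> z \<in> X \<and> (\<forall>w\<in>X \<inter> N \<times> N. \<forall>c\<in>N.
      \<bar>f (c \<odot> ((snd z \<odot> inv (fst z)) \<odot> fst w)) - f (c \<odot> snd w)\<bar> \<le> \<epsilon>)" if z: "z \<in> N \<times> N" for z
  proof -
    let ?a = "snd z \<odot> inv (fst z)"
    let ?F = "\<lambda>w c. f (c \<odot> (?a \<odot> fst w)) - f (c \<odot> snd w)"
    have a: "?a \<in> N" using z by (auto intro!: mul_closed inv_closed)
    have "continuous_on ((N \<times> N) \<times> N) (\<lambda>(w, c). ?F w c)"
      unfolding case_prod_unfold
      by (intro continuous_on_diff continuous_on_compose2[OF f] continuous_on_mul continuous_intros)
         (use a in \<open>auto intro!: mul_closed\<close>)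
    from uniform_on_compact_parameter[OF this compact z \<epsilon>] obtain X where X: "z \<in> X" "open X"
        "\<forall>w\<in>X \<inter> N \<times> N. \<forall>c\<in>N. \<bar>?F w c - ?F z c\<bar> \<le> \<epsilon>"
      by (elim exE conjE)
    have "?a \<odot> fst z = snd z"
      using z by (auto simp: assoc inv_closed left_inv right_one)
    with X show ?thesis by (intro exI[of _ X]) simp
  qed
  then obtain X where X: "\<And>z. z \<in> N \<times> N \<Longrightarrow> open (X z) \<and> z \<in> X z \<and> (\<forall>w\<in>X z \<inter> N \<times> N. \<forall>c\<in>N.
      \<bar>f (c \<odot> ((snd z \<odot> inv (fst z)) \<odot> fst w)) - f (c \<odot> snd w)\<bar> \<le> \<epsilon>)"
    by metis
  have "\<exists>Z. finite Z \<and> Z \<subseteq> N \<times> N \<and> (\<forall>w\<in>N \<times> N. \<exists>z\<in>Z. w \<in> X z)"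
    by (rule compact_finite_subcover[OF compact_Times[OF compact compact]]) (use X in blast)+
  then obtain Z where Z: "finite Z" "Z \<subseteq> N \<times> N" "\<forall>w\<in>N \<times> N. \<exists>z\<in>Z. w \<in> X z"
    by (elim exE conjE)
  let ?S = "(\<lambda>z. snd z \<odot> inv (fst z)) ` Z"
  have "Z \<noteq> {}" using Z e_closed by auto
  moreover have "?S \<subseteq> N" using Z by (auto intro!: mul_closed inv_closed)
  moreover have "\<exists>a\<in>?S. \<forall>c\<in>N. \<bar>f (c \<odot> (a \<odot> x)) - f (c \<odot> y)\<bar> \<le> \<epsilon>" if "x \<in> N" "y \<in> N" for x y
  proof -
    have "(x, y) \<in> N \<times> N" using that by simp
    with Z(3) obtain z where z: "z \<in> Z" "(x, y) \<in> X z" by blast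
    then have "z \<in> N \<times> N" using Z by blast
    from X[OF this] that z show ?thesis by (intro bexI[of _ "snd z \<odot> inv (fst z)"]) force+
  qed
  ultimately show ?thesis using Z by (intro exI[of _ ?S]) auto
qed

text \<open>Averaging over the transporters of the previous lemma contracts the oscillation by a fixed factor: at
every point one of the \<open>n\<close> summands is close to a small value of the function, so its maximum drops by a
definite fraction of the oscillation while its minimum does not decrease. The factor \<open>q\<close> depends only
on \<open>n\<close>, because all iterates inherit the modulus of continuity of \<open>f\<close>; iterating makes the
oscillation arbitrarily small.\<close>

lemma almost_constant_average:
  assumes f: "continuous_on N f" and \<epsilon>: "0 < \<epsilon>"
  shows "\<exists>Ss c. finite_subsets_list N Ss \<and> (\<forall>x\<in>N. \<bar>iterated_average (\<odot>) Ss f x - c\<bar> \<le> \<epsilon>)"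
proof -
  define \<delta> where "\<delta> = \<epsilon> / 4"
  have \<delta>: "0 < \<delta>" using \<epsilon> by (simp add: \<delta>_def)
  obtain S where S: "finite S" "S \<noteq> {}" "S \<subseteq> N"
    and transport: "\<And>x y. x \<in> N \<Longrightarrow> y \<in> N \<Longrightarrow> \<exists>a\<in>S. \<forall>c\<in>N. \<bar>f (c \<odot> (a \<odot> x)) - f (c \<odot> y)\<bar> \<le> \<delta>"
    using uniform_finite_transporters[OF f \<delta>] by metis
  define n where "n = real (card S)"
  have n: "1 \<le> n" using S by (simp add: n_def Suc_le_eq card_gt_0_iff)
  \<comment> \<open>the modulus of continuity of \<open>f\<close>, which is inherited by averages of left translates\<close>
  define good where "good h \<longleftrightarrow> (\<forall>x\<in>N. \<forall>y\<in>N. (\<forall>c\<in>N. \<bar>f (c \<odot> x) - f (c \<odot> y)\<bar> \<le> \<delta>) \<longrightarrow> \<bar>h x - h y\<bar> \<le> \<delta>)"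
    for h :: "'a \<Rightarrow> real"
  have good_f: "good f"
    unfolding good_def using e_closed left_one by fastforce
  have good_avg: "good (translate_average (\<odot>) S h)" if h: "good h" for h
    unfolding good_def
  proof (intro ballI impI)
    fix x y assume xy: "x \<in> N" "y \<in> N" and near: "\<forall>c\<in>N. \<bar>f (c \<odot> x) - f (c \<odot> y)\<bar> \<le> \<delta>"
    have "\<bar>h (a \<odot> x) - h (a \<odot> y)\<bar> \<le> \<delta>" if "a \<in> S" for a
    proof -
      have a: "a \<in> N" using S that by blast
      have "\<forall>c\<in>N. \<bar>f (c \<odot> (a \<odot> x)) - f (c \<odot> (a \<odot> y))\<bar> \<le> \<delta>"
        using near a xy by (metis assoc mul_closed)
      then show ?thesis using h a xy unfolding good_def by (meson mul_closed)
    qed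
    then have "\<bar>\<Sum>a\<in>S. h (a \<odot> x) - h (a \<odot> y)\<bar> \<le> n * \<delta>"
      unfolding n_def by (intro order_trans[OF sum_abs] sum_bounded_above) auto
    then show "\<bar>translate_average (\<odot>) S h x - translate_average (\<odot>) S h y\<bar> \<le> \<delta>"
      unfolding translate_average_def n_def[symmetric] diff_divide_distrib[symmetric] sum_subtractf[symmetric]
      using n by (simp add: abs_divide divide_le_eq mult.commute)
  qed
  \<comment> \<open>one of \<open>n\<close> summands falls below the maximum by a quarter of the oscillation\<close>
  define q where "q = 1 - 1 / (4 * n)"
  have q: "1 / 2 \<le> q" "q < 1" "0 \<le> q" using n by (auto simp: q_def field_simps)
  have contract: "\<exists>l'. \<forall>x\<in>N. l' \<le> translate_average (\<odot>) S h x \<and> translate_average (\<odot>) S h x \<le> l' + q * d"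
    if h: "good h" and l: "\<forall>x\<in>N. l \<le> h x \<and> h x \<le> l + d" and d: "4 * \<delta> \<le> d" for h l d
  proof -
    have avg_lower: "l' \<le> translate_average (\<odot>) S h x" if "\<forall>x\<in>N. l' \<le> h x" "x \<in> N" for l' x
      using iterated_average_lower[of "[S]" l' h x] S that by simp
    have avg_upper: "translate_average (\<odot>) S h x \<le> u" if "\<forall>x\<in>N. h x \<le> u" "x \<in> N" for u x
      using iterated_average_upper[of "[S]" h u x] S that by simp
    show ?thesis
    proof (cases "\<forall>y\<in>N. l + d / 2 \<le> h y")
      case True
      have "d / 2 \<le> q * d" using q d \<delta> mult_right_mono[of "1/2" q d] by simp
      then have "\<forall>x\<in>N. h x \<le> (l + d / 2) + q * d" using l by fastforce
      with True show ?thesis using avg_lower avg_upper by blast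
    next
      case False
      then obtain y where y: "y \<in> N" "h y < l + d / 2" by force
      have "translate_average (\<odot>) S h x \<le> l + q * d" if x: "x \<in> N" for x
      proof -
        obtain a where a: "a \<in> S" "\<forall>c\<in>N. \<bar>f (c \<odot> (a \<odot> x)) - f (c \<odot> y)\<bar> \<le> \<delta>"
          using transport[OF x y(1)] by blast
        have "\<bar>h (a \<odot> x) - h y\<bar> \<le> \<delta>"
          using h a x y S unfolding good_def by (meson mul_closed subsetD)
        then have ha: "h (a \<odot> x) \<le> l + d - d / 4" using y d by linarith
        have "(\<Sum>b\<in>S. h (b \<odot> x)) = h (a \<odot> x) + (\<Sum>b\<in>S - {a}. h (b \<odot> x))"
          using S a by (simp add: sum.remove)
        also have "(\<Sum>b\<in>S - {a}. h (b \<odot> x)) \<le> real (card (S - {a})) * (l + d)"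
          using l S x by (intro sum_bounded_above) (auto intro: mul_closed)
        also have "real (card (S - {a})) = n - 1"
          using S a n by (simp add: n_def card_Diff_singleton of_nat_diff)
        finally have "(\<Sum>b\<in>S. h (b \<odot> x)) \<le> n * (l + d) - d / 4"
          using ha by (simp add: algebra_simps)
        also have "\<dots> = n * (l + q * d)" using n by (simp add: q_def field_simps)
        finally show ?thesis using n unfolding translate_average_def n_def[symmetric]
          by (simp add: divide_le_eq mult.commute)
      qed
      with l avg_lower show ?thesis by blast
    qed
  qed
  obtain l0 d0 where l0: "\<forall>x\<in>N. l0 \<le> f x \<and> f x \<le> l0 + d0"
  proof -
    have "bounded (f ` N)" using compact_continuous_image[OF f compact] by (rule compact_imp_bounded)
    then obtain B where "\<forall>x\<in>N. \<bar>f x\<bar> \<le> B" by (auto simp: bounded_iff)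
    then have "\<forall>x\<in>N. - B \<le> f x \<and> f x \<le> - B + 2 * B" by (auto simp: abs_le_iff)
    with that show thesis by blast
  qed
  have "\<exists>l. \<forall>x\<in>N. l \<le> iterated_average (\<odot>) (replicate k S) f x \<and>
      iterated_average (\<odot>) (replicate k S) f x \<le> l + max (4 * \<delta>) (q ^ k * d0)" for k
  proof (induction k)
    case 0
    then show ?case using l0 by (intro exI[of _ l0]) (auto intro: order_trans)
  next
    case (Suc k)
    let ?h = "iterated_average (\<odot>) (replicate k S) f"
    let ?d = "max (4 * \<delta>) (q ^ k * d0)"
    have "good ?h" by (induction k) (auto simp: good_f good_avg)
    moreover obtain l where "\<forall>x\<in>N. l \<le> ?h x \<and> ?h x \<le> l + ?d" using Suc by blast
    ultimately obtain l'
      where l': "\<forall>x\<in>N. l' \<le> translate_average (\<odot>) S ?h x \<and> translate_average (\<odot>) S ?h x \<le> l' + q * ?d"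
      using contract[of ?h l ?d] by (meson max.cobounded1)
    have "q * ?d = max (q * (4 * \<delta>)) (q ^ Suc k * d0)"
      using q by (simp add: max_mult_distrib_left)
    also have "\<dots> \<le> max (4 * \<delta>) (q ^ Suc k * d0)"
      using q \<delta> by (intro max.mono) (auto simp: mult_le_cancel_right1)
    finally show ?case using l' by (intro exI[of _ l']) (auto intro: order_trans)
  qed
  moreover obtain k where "q ^ k * d0 \<le> 4 * \<delta>"
  proof -
    have "(\<lambda>k. q ^ k * d0) \<longlonglongrightarrow> 0" using q by (intro tendsto_mult_left_zero LIMSEQ_power_zero) auto
    then have "eventually (\<lambda>k. q ^ k * d0 < 4 * \<delta>) sequentially" using \<delta> by (intro order_tendstoD) auto
    with that show thesis by (auto simp: eventually_sequentially intro: less_imp_le)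
  qed
  ultimately obtain l where "\<forall>x\<in>N. l \<le> iterated_average (\<odot>) (replicate k S) f x \<and>
      iterated_average (\<odot>) (replicate k S) f x \<le> l + 4 * \<delta>"
    by (metis max_absorb1)
  then have "\<forall>x\<in>N. \<bar>iterated_average (\<odot>) (replicate k S) f x - l\<bar> \<le> \<epsilon>"
    by (auto simp: \<delta>_def)
  moreover have "finite_subsets_list N (replicate k S)"
    using S by (auto simp: finite_subsets_list_def)
  ultimately show ?thesis by blast
qed

text \<open>The mean is characterized by right averages, which makes its invariance under left translations
immediate. The right averages of \<open>f\<close> that are nearly constant all have nearly the same value, since
each of them agrees with any nearly constant left average.\<close>

definition mean :: "('a \<Rightarrow> real) \<Rightarrow> real"
  where "mean f = (SOME M. \<forall>Rs c \<epsilon>. finite_subsets_list N Rs \<longrightarrow>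
    (\<forall>x\<in>N. \<bar>iterated_average (\<lambda>a x. x \<odot> a) Rs f x - c\<bar> \<le> \<epsilon>) \<longrightarrow> \<bar>M - c\<bar> \<le> \<epsilon>)"

lemma mean_approx:
  assumes f: "continuous_on N f" and Rs: "finite_subsets_list N Rs"
    and near: "\<forall>x\<in>N. \<bar>iterated_average (\<lambda>a x. x \<odot> a) Rs f x - c\<bar> \<le> \<epsilon>"
  shows "\<bar>mean f - c\<bar> \<le> \<epsilon>"
proof -
  interpret op: compact_group N "\<lambda>x y. y \<odot> x" e inv by (rule opposite)
  \<comment> \<open>any right approximation is consistent with any left approximation\<close>
  define A where "A = {(c, \<epsilon>). \<exists>Rs. finite_subsets_list N Rs \<and>
    (\<forall>x\<in>N. \<bar>iterated_average (\<lambda>a x. x \<odot> a) Rs f x - c\<bar> \<le> \<epsilon>)}"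
  have le: "c - \<epsilon> \<le> d + \<delta> \<and> d - \<delta> \<le> c + \<epsilon>"
    if "(c, \<epsilon>) \<in> A" and Ss: "finite_subsets_list N Ss"
      and L: "\<forall>x\<in>N. \<bar>iterated_average (\<odot>) Ss f x - d\<bar> \<le> \<delta>" for c \<epsilon> d \<delta> Ss
  proof -
    obtain Rs where Rs: "finite_subsets_list N Rs"
      "\<forall>x\<in>N. \<bar>iterated_average (\<lambda>a x. x \<odot> a) Rs f x - c\<bar> \<le> \<epsilon>"
      using \<open>(c, \<epsilon>) \<in> A\<close> by (auto simp: A_def)
    have "\<bar>iterated_average (\<odot>) Ss (iterated_average (\<lambda>a x. x \<odot> a) Rs f) e - c\<bar> \<le> \<epsilon>"
      using Rs Ss e_closed by (intro iterated_average_close) auto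
    moreover have "\<bar>iterated_average (\<lambda>a x. x \<odot> a) Rs (iterated_average (\<odot>) Ss f) e - d\<bar> \<le> \<delta>"
      using Rs L e_closed by (intro op.iterated_average_close) auto
    ultimately show ?thesis using averages_commute[OF Ss Rs(1) e_closed, of f] by linarith
  qed
  have bdd: "bdd_above ((\<lambda>(c, \<epsilon>). c - \<epsilon>) ` A)"
  proof -
    obtain Ss d where "finite_subsets_list N Ss" "\<forall>x\<in>N. \<bar>iterated_average (\<odot>) Ss f x - d\<bar> \<le> 1"
      using almost_constant_average[OF f, of 1] by auto
    from le[OF _ this] show ?thesis by (intro bdd_aboveI2[where M="d + 1"]) auto
  qed
  define M where "M = (SUP (c, \<epsilon>)\<in>A. c - \<epsilon>)"
  have "\<bar>M - c\<bar> \<le> \<epsilon>" if A: "(c, \<epsilon>) \<in> A" for c \<epsilon>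
  proof -
    have "c - \<epsilon> \<le> M" unfolding M_def using cSUP_upper[OF A bdd] by simp
    moreover have "M \<le> c + \<epsilon>"
    proof (rule field_le_epsilon)
      fix \<delta> :: real assume \<delta>: "0 < \<delta>"
      obtain Ss d where Ss: "finite_subsets_list N Ss" "\<forall>x\<in>N. \<bar>iterated_average (\<odot>) Ss f x - d\<bar> \<le> \<delta> / 2"
        using almost_constant_average[OF f, of "\<delta> / 2"] \<delta> by auto
      have "M \<le> d + \<delta> / 2" unfolding M_def using A le[OF _ Ss] by (intro cSUP_least) auto
      with le[OF A Ss] show "M \<le> c + \<epsilon> + \<delta>" by linarith
    qed
    ultimately show ?thesis by linarith
  qed
  then have "\<exists>M. \<forall>Rs c \<epsilon>. finite_subsets_list N Rs \<longrightarrow>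
    (\<forall>x\<in>N. \<bar>iterated_average (\<lambda>a x. x \<odot> a) Rs f x - c\<bar> \<le> \<epsilon>) \<longrightarrow> \<bar>M - c\<bar> \<le> \<epsilon>"
    unfolding A_def by blast
  from someI_ex[OF this] show ?thesis using Rs near unfolding mean_def by blast
qed

lemma mean_close_const:
  assumes "continuous_on N f" "\<forall>x\<in>N. \<bar>f x - c\<bar> \<le> \<epsilon>"
  shows "\<bar>mean f - c\<bar> \<le> \<epsilon>"
  using mean_approx[of f "[]" c \<epsilon>] assms by simp

lemma mean_const: "(\<And>x. x \<in> N \<Longrightarrow> f x = c) \<Longrightarrow> mean f = c"
proof -
  assume "\<And>x. x \<in> N \<Longrightarrow> f x = c"
  then have "continuous_on N f" "\<forall>x\<in>N. \<bar>f x - c\<bar> \<le> 0"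
    by (auto intro: continuous_on_eq[OF continuous_on_const, of _ c])
  from mean_close_const[OF this] show ?thesis by simp
qed

lemma mean_add:
  assumes f: "continuous_on N f" and g: "continuous_on N g"
  shows "mean (\<lambda>x. f x + g x) = mean f + mean g"
proof -
  interpret op: compact_group N "\<lambda>x y. y \<odot> x" e inv by (rule opposite)
  have "\<bar>mean (\<lambda>x. f x + g x) - (mean f + mean g)\<bar> \<le> 0 + \<epsilon>" if "0 < \<epsilon>" for \<epsilon> :: real
  proof -
    let ?\<delta> = "\<epsilon> / 4"
    have \<delta>: "0 < ?\<delta>" using that by simp
    let ?R = "iterated_average (\<lambda>a x. x \<odot> a)"
    obtain R1 c where R1: "finite_subsets_list N R1" "\<forall>x\<in>N. \<bar>?R R1 f x - c\<bar> \<le> ?\<delta>"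
      using op.almost_constant_average[OF f \<delta>] by auto
    have "continuous_on N (?R R1 g)" using op.iterated_average_continuous[OF R1(1) g] .
    from op.almost_constant_average[OF this \<delta>] obtain R2 d
      where R2: "finite_subsets_list N R2" "\<forall>x\<in>N. \<bar>?R (R2 @ R1) g x - d\<bar> \<le> ?\<delta>" by auto
    have R12: "finite_subsets_list N (R2 @ R1)" using R1 R2 by simp
    have fc: "\<forall>x\<in>N. \<bar>?R (R2 @ R1) f x - c\<bar> \<le> ?\<delta>"
      using op.iterated_average_close[OF R2(1) R1(2)] by simp
    have "\<forall>x\<in>N. \<bar>?R (R2 @ R1) (\<lambda>x. f x + g x) x - (c + d)\<bar> \<le> 2 * ?\<delta>"
      unfolding iterated_average_add
    proof
      fix x assume "x \<in> N"
      then show "\<bar>?R (R2 @ R1) f x + ?R (R2 @ R1) g x - (c + d)\<bar> \<le> 2 * ?\<delta>"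
        using bspec[OF fc, of x] bspec[OF R2(2), of x] by linarith
    qed
    then have "\<bar>mean (\<lambda>x. f x + g x) - (c + d)\<bar> \<le> 2 * ?\<delta>"
      by (intro mean_approx[OF _ R12] continuous_intros f g)
    then show ?thesis
      using mean_approx[OF f R12 fc] mean_approx[OF g R12 R2(2)] by linarith
  qed
  from field_le_epsilon[OF this] show ?thesis by simp
qed

lemma mean_scale:
  assumes f: "continuous_on N f"
  shows "mean (\<lambda>x. \<alpha> * f x) = \<alpha> * mean f"
proof -
  interpret op: compact_group N "\<lambda>x y. y \<odot> x" e inv by (rule opposite)
  have "\<bar>mean (\<lambda>x. \<alpha> * f x) - \<alpha> * mean f\<bar> \<le> 0 + \<epsilon>" if "0 < \<epsilon>" for \<epsilon> :: real
  proof -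
    define \<delta> where "\<delta> = \<epsilon> / (2 * (\<bar>\<alpha>\<bar> + 1))"
    have \<delta>: "0 < \<delta>" using that by (simp add: \<delta>_def)
    let ?R = "iterated_average (\<lambda>a x. x \<odot> a)"
    obtain Rs c where Rs: "finite_subsets_list N Rs" "\<forall>x\<in>N. \<bar>?R Rs f x - c\<bar> \<le> \<delta>"
      using op.almost_constant_average[OF f \<delta>] by auto
    have "\<forall>x\<in>N. \<bar>?R Rs (\<lambda>x. \<alpha> * f x) x - \<alpha> * c\<bar> \<le> \<bar>\<alpha>\<bar> * \<delta>"
      unfolding iterated_average_scale right_diff_distrib[symmetric] abs_mult
      using Rs by (auto intro!: mult_left_mono)
    then have 1: "\<bar>mean (\<lambda>x. \<alpha> * f x) - \<alpha> * c\<bar> \<le> \<bar>\<alpha>\<bar> * \<delta>"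
      by (intro mean_approx[of _ Rs] continuous_intros f Rs)
    have "\<bar>mean f - c\<bar> \<le> \<delta>" using mean_approx Rs f by auto
    then have 2: "\<bar>\<alpha> * mean f - \<alpha> * c\<bar> \<le> \<bar>\<alpha>\<bar> * \<delta>"
      unfolding right_diff_distrib[symmetric] abs_mult by (intro mult_left_mono) auto
    have "2 * (\<bar>\<alpha>\<bar> * \<delta>) \<le> \<epsilon>"
    proof -
      have "2 * (\<bar>\<alpha>\<bar> * \<delta>) \<le> 2 * ((\<bar>\<alpha>\<bar> + 1) * \<delta>)" using \<delta> by simp
      also have "\<dots> = \<epsilon>"
        using abs_ge_zero[of \<alpha>] by (simp add: \<delta>_def nonzero_divide_eq_eq add_nonneg_eq_0_iff algebra_simps)
      finally show ?thesis .
    qed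
    with 1 2 show ?thesis by linarith
  qed
  from field_le_epsilon[OF this] show ?thesis by simp
qed

lemma mean_nonneg:
  assumes f: "continuous_on N f" and "\<And>x. x \<in> N \<Longrightarrow> 0 \<le> f x"
  shows "0 \<le> mean f"
proof -
  interpret op: compact_group N "\<lambda>x y. y \<odot> x" e inv by (rule opposite)
  have "0 \<le> mean f + \<epsilon>" if "0 < \<epsilon>" for \<epsilon> :: real
  proof -
    have \<delta>: "0 < \<epsilon> / 2" using that by simp
    obtain Rs c where Rs: "finite_subsets_list N Rs"
        "\<forall>x\<in>N. \<bar>iterated_average (\<lambda>a x. x \<odot> a) Rs f x - c\<bar> \<le> \<epsilon> / 2"
      using op.almost_constant_average[OF f \<delta>] by auto
    have "0 \<le> iterated_average (\<lambda>a x. x \<odot> a) Rs f e"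
      using assms Rs e_closed by (intro op.iterated_average_lower) auto
    then show ?thesis using mean_approx[OF f Rs] bspec[OF Rs(2) e_closed] by linarith
  qed
  then show ?thesis by (rule field_le_epsilon)
qed

lemma mean_mono:
  assumes f: "continuous_on N f" and g: "continuous_on N g"
    and le: "\<And>x. x \<in> N \<Longrightarrow> f x \<le> g x"
  shows "mean f \<le> mean g"
proof -
  have "0 \<le> mean (\<lambda>x. g x + -1 * f x)"
    using assms by (intro mean_nonneg) (auto intro!: continuous_intros)
  also have "\<dots> = mean g + mean (\<lambda>x. -1 * f x)"
    using f g by (intro mean_add continuous_intros)
  also have "\<dots> = mean g - mean f"
    using mean_scale[OF f, of "-1"] by simp
  finally show ?thesis by simp
qed

lemma mean_cong:
  assumes f: "continuous_on N f" and eq: "\<And>x. x \<in> N \<Longrightarrow> f x = g x"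
  shows "mean f = mean g"
proof -
  have g: "continuous_on N g" using f eq by (rule continuous_on_eq)
  show ?thesis by (intro antisym mean_mono f g) (simp_all add: eq)
qed

lemma mean_left_translate:
  assumes f: "continuous_on N f" and b: "b \<in> N"
  shows "mean (\<lambda>x. f (b \<odot> x)) = mean f"
proof -
  interpret op: compact_group N "\<lambda>x y. y \<odot> x" e inv by (rule opposite)
  have fb: "continuous_on N (\<lambda>x. f (b \<odot> x))"
    using b by (intro continuous_on_compose2[OF f] continuous_on_mul continuous_intros)
      (auto intro: mul_closed)
  have "\<bar>mean (\<lambda>x. f (b \<odot> x)) - mean f\<bar> \<le> 0 + \<epsilon>" if "0 < \<epsilon>" for \<epsilon> :: real
  proof -
    have \<delta>: "0 < \<epsilon> / 2" using that by simp
    obtain Rs c where Rs: "finite_subsets_list N Rs"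
        "\<forall>x\<in>N. \<bar>iterated_average (\<lambda>a x. x \<odot> a) Rs f x - c\<bar> \<le> \<epsilon> / 2"
      using op.almost_constant_average[OF f \<delta>] by auto
    have "\<forall>x\<in>N. \<bar>iterated_average (\<lambda>a x. x \<odot> a) Rs (\<lambda>x. f (b \<odot> x)) x - c\<bar> \<le> \<epsilon> / 2"
      using op.iterated_average_right_translate[OF Rs(1) _ b, of _ f] Rs(2) b by (simp add: mul_closed)
    from mean_approx[OF fb Rs(1) this] mean_approx[OF f Rs] show ?thesis by linarith
  qed
  from field_le_epsilon[OF this] show ?thesis by simp
qed

end

section \<open>Algebra and topology of loops\<close>

context loop
begin

lemma mult_ldiv [simp]: "a \<cdot> ldiv a b = b"
  unfolding ldiv_def by (rule theI') (rule ex1_ldiv)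

lemma mult_rdiv [simp]: "rdiv b a \<cdot> a = b"
  unfolding rdiv_def by (rule theI') (rule ex1_rdiv)

lemma left_cancel [simp]: "a \<cdot> x = a \<cdot> y \<longleftrightarrow> x = y"
  using ex1_ldiv by metis

lemma right_cancel [simp]: "x \<cdot> a = y \<cdot> a \<longleftrightarrow> x = y"
  using ex1_rdiv by metis

lemma ldiv_mult [simp]: "ldiv a (a \<cdot> b) = b"
  using left_cancel mult_ldiv by blast

lemma rdiv_mult [simp]: "rdiv (b \<cdot> a) a = b"
  using right_cancel mult_rdiv by blast

lemma unit_mult [simp]: "unit \<cdot> x = x" and mult_unit [simp]: "x \<cdot> unit = x"
proof -
  have "\<exists>!e. \<forall>g. e \<cdot> g = g \<and> g \<cdot> e = g"
    using ex_unit by metis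
  from theI'[OF this] show "unit \<cdot> x = x" "x \<cdot> unit = x" by (auto simp: unit_def)
qed

lemma nucleusD:
  assumes "n \<in> nucleus"
  shows "(n \<cdot> b) \<cdot> c = n \<cdot> (b \<cdot> c)" "(b \<cdot> n) \<cdot> c = b \<cdot> (n \<cdot> c)" "(b \<cdot> c) \<cdot> n = b \<cdot> (c \<cdot> n)"
  using assms by (auto simp: nucleus_def)

definition linv :: "'a \<Rightarrow> 'a" where "linv y = rdiv unit y"

definition rinv :: "'a \<Rightarrow> 'a" where "rinv b = ldiv b unit"

lemma linv_mult [simp]: "linv y \<cdot> y = unit"
  by (simp add: linv_def)

lemma mult_rinv [simp]: "b \<cdot> rinv b = unit"
  by (simp add: rinv_def)

lemma linv_rinv [simp]: "linv (rinv b) = b"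
  by (metis linv_mult mult_rinv right_cancel)

lemma rinv_linv [simp]: "rinv (linv y) = y"
  by (metis linv_mult mult_rinv left_cancel)

end

lemma (in topological_fan_loop) continuous_on_operations:
  assumes "continuous_on S f" "continuous_on S g"
  shows "continuous_on S (\<lambda>x. f x \<cdot> g x)" "continuous_on S (\<lambda>x. ldiv (f x) (g x))"
    "continuous_on S (\<lambda>x. rdiv (f x) (g x))"
proof -
  have p: "continuous_on S (\<lambda>x. (f x, g x))" "continuous_on S (\<lambda>x. (g x, f x))"
    using assms by (auto intro!: continuous_intros)
  show "continuous_on S (\<lambda>x. f x \<cdot> g x)"
    using continuous_on_compose2[OF continuous_mult p(1)] by simp
  show "continuous_on S (\<lambda>x. ldiv (f x) (g x))"
    using continuous_on_compose2[OF continuous_ldiv p(1)] by simp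
  show "continuous_on S (\<lambda>x. rdiv (f x) (g x))"
    using continuous_on_compose2[OF continuous_rdiv p(2)] by simp
qed

lemma (in topological_fan_loop) continuous_on_inverses:
  assumes "continuous_on S f"
  shows "continuous_on S (\<lambda>x. linv (f x))" "continuous_on S (\<lambda>x. rinv (f x))"
  using continuous_on_operations(2)[OF assms continuous_on_const]
    continuous_on_operations(3)[OF continuous_on_const assms]
  by (simp_all add: linv_def rinv_def)

lemmas (in topological_fan_loop) loop_continuous_intros =
  continuous_on_operations continuous_on_inverses continuous_on_fst continuous_on_snd
  continuous_on_id continuous_on_const continuous_on_diff continuous_on_add continuous_on_mult
  continuous_on_rabs

lemma compact_rectangle_neighbourhood:
  assumes "compact K" "compact L" "open W" "K \<times> L \<subseteq> W"
  shows "\<exists>U V. open U \<and> open V \<and> K \<subseteq> U \<and> L \<subseteq> V \<and> U \<times> V \<subseteq> W"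
proof (rule Wallace_theorem_prod_topology[of euclidean K euclidean L W])
  fix U V assume "openin euclidean U" "openin euclidean V" "K \<subseteq> U" "L \<subseteq> V" "U \<times> V \<subseteq> W"
  then show ?thesis by (intro exI[of _ U] exI[of _ V]) simp
qed (use assms in simp_all)

locale lc_topological_fan_loop = topological_fan_loop mult
  for mult :: "'a::t1_space \<Rightarrow> 'a \<Rightarrow> 'a"  (infixl "\<cdot>" 70) +
  assumes locally_compact: "locally_compact_space (euclidean :: 'a topology)"
begin

text \<open>Left division detects equality: \<open>x = y\<close> iff \<open>ldiv x y = unit\<close>, and the complement of \<open>{unit}\<close> is open.\<close>

lemma hausdorff: "Hausdorff_space (euclidean :: 'a topology)"
  unfolding Hausdorff_space_def
proof (intro allI impI, elim conjE)
  fix x y :: 'a assume "x \<noteq> y"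
  then have ne: "ldiv x y \<noteq> unit" by (metis mult_ldiv mult_unit)
  have "open ((\<lambda>z. ldiv (fst z) (snd z)) -` (- {unit}))"
    by (intro open_vimage loop_continuous_intros) auto
  with ne obtain A B where AB: "open A" "open B" "x \<in> A" "y \<in> B"
      "A \<times> B \<subseteq> (\<lambda>z. ldiv (fst z) (snd z)) -` (- {unit})"
    by (elim open_prod_elim[where x="(x, y)"]) auto
  have "z \<notin> B" if "z \<in> A" for z
  proof
    assume "z \<in> B"
    with that AB have "ldiv z z \<noteq> unit" by auto
    then show False by (metis mult_ldiv mult_unit left_cancel)
  qed
  with AB show "\<exists>U V. openin euclidean U \<and> openin euclidean V \<and> x \<in> U \<and> y \<in> V \<and> disjnt U V"
    by (intro exI[of _ A] exI[of _ B]) (auto simp: disjnt_iff)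
qed

lemma compact_closed: "compact (K :: 'a set) \<Longrightarrow> closed K"
  using compactin_imp_closedin[OF hausdorff, of K] by simp

lemma C00_plusI:
  fixes f :: "'a \<Rightarrow> real"
  assumes "continuous_on UNIV f" "\<And>x. 0 \<le> f x" "compact K" "\<And>x. f x \<noteq> 0 \<Longrightarrow> x \<in> K"
  shows "f \<in> C00_plus"
proof -
  have "closure {x. f x \<noteq> 0} \<subseteq> K"
    using assms compact_closed by (intro closure_minimal) auto
  then have "compact (K \<inter> closure {x. f x \<noteq> 0})" "K \<inter> closure {x. f x \<noteq> 0} = closure {x. f x \<noteq> 0}"
    using assms by auto
  with assms show ?thesis by (simp add: C00_plus_def)
qed

lemma C00_plus_support:
  assumes "f \<in> C00_plus"
  shows "\<exists>K. compact K \<and> (\<forall>x. f x \<noteq> 0 \<longrightarrow> x \<in> K)"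
  using assms closure_subset[of "{x. f x \<noteq> 0}"] unfolding C00_plus_def
  by (intro exI[of _ "closure {x. f x \<noteq> 0}"]) auto

lemma C00_plus_nonneg: "f \<in> C00_plus \<Longrightarrow> 0 \<le> f x"
  by (simp add: C00_plus_def)

lemma C00_plus_cont: "f \<in> C00_plus \<Longrightarrow> continuous_on UNIV f"
  by (simp add: C00_plus_def)

lemma C00_plus_comp:
  assumes "f \<in> C00_plus" "continuous_on S h"
  shows "continuous_on S (\<lambda>x. f (h x))"
  using continuous_on_compose2[OF C00_plus_cont[OF assms(1)] assms(2)] by simp

lemma C00_plus_bounded:
  fixes f :: "'a \<Rightarrow> real"
  assumes "f \<in> C00_plus"
  shows "\<exists>B>0. \<forall>x. f x \<le> B"
proof -
  obtain K where K: "compact K" "\<And>x. f x \<noteq> 0 \<Longrightarrow> x \<in> K" using C00_plus_support[OF assms] by blast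
  have "bounded (f ` K)"
    using C00_plus_cont[OF assms] K(1)
    by (meson compact_continuous_image compact_imp_bounded continuous_on_subset subset_UNIV)
  then obtain B where "\<forall>x\<in>K. \<bar>f x\<bar> \<le> B" by (auto simp: bounded_iff)
  then have "\<forall>x. f x \<le> \<bar>B\<bar> + 1" using K(2) by (smt (verit))
  then show ?thesis by (intro exI[of _ "\<bar>B\<bar> + 1"]) auto
qed

lemma C00_plus_zero: "(\<lambda>x::'a. 0) \<in> C00_plus"
  by (rule C00_plusI[of _ "{}"]) auto

lemma C00_plus_add:
  fixes f g :: "'a \<Rightarrow> real"
  assumes "f \<in> C00_plus" "g \<in> C00_plus"
  shows "(\<lambda>x. f x + g x) \<in> C00_plus"
proof -
  obtain K L where "compact K" "\<And>x. f x \<noteq> 0 \<Longrightarrow> x \<in> K" "compact L" "\<And>x. g x \<noteq> 0 \<Longrightarrow> x \<in> L"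
    using C00_plus_support assms by metis
  moreover from this have "x \<in> K \<union> L" if "f x + g x \<noteq> 0" for x
    using that by (cases "f x = 0") auto
  ultimately show ?thesis using assms
    by (intro C00_plusI[of _ "K \<union> L"] loop_continuous_intros)
       (auto simp: C00_plus_nonneg C00_plus_cont compact_Un)
qed

lemma C00_plus_mult:
  fixes f k :: "'a \<Rightarrow> real"
  assumes "f \<in> C00_plus" "continuous_on UNIV k" "\<And>x. 0 \<le> k x"
  shows "(\<lambda>x. f x * k x) \<in> C00_plus"
proof -
  obtain K where "compact K" "\<And>x. f x \<noteq> 0 \<Longrightarrow> x \<in> K"
    using C00_plus_support assms by metis
  with assms show ?thesis
    by (intro C00_plusI[of _ K] loop_continuous_intros) (auto simp: C00_plus_nonneg C00_plus_cont)
qed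

lemma C00_plus_scale:
  fixes f :: "'a \<Rightarrow> real"
  assumes "f \<in> C00_plus" "0 \<le> \<alpha>"
  shows "(\<lambda>x. \<alpha> * f x) \<in> C00_plus"
  using C00_plus_mult[OF assms(1), of "\<lambda>x. \<alpha>"] assms(2) by (simp add: mult.commute)

lemma C00_plus_sum:
  fixes f :: "'i \<Rightarrow> 'a \<Rightarrow> real"
  assumes "finite J" "\<And>j. j \<in> J \<Longrightarrow> f j \<in> C00_plus"
  shows "(\<lambda>x. \<Sum>j\<in>J. f j x) \<in> C00_plus"
  using assms by induction (auto simp: C00_plus_zero C00_plus_add)

text \<open>The support of the composite lies in the image of the support of \<open>f\<close> under the left inverse \<open>k\<close>.\<close>

lemma C00_plus_pullback:
  fixes f :: "'a \<Rightarrow> real" and h k :: "'a \<Rightarrow> 'a"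
  assumes f: "f \<in> C00_plus" and h: "continuous_on UNIV h" and k: "continuous_on UNIV k"
    and inv: "\<And>x. k (h x) = x"
  shows "(\<lambda>x. f (h x)) \<in> C00_plus"
proof -
  obtain K where K: "compact K" "\<And>x. f x \<noteq> 0 \<Longrightarrow> x \<in> K"
    using C00_plus_support f by metis
  have "compact (k ` K)" using k K(1) by (meson compact_continuous_image continuous_on_subset subset_UNIV)
  then show ?thesis using C00_plus_comp[OF f h] K(2)
    by (rule_tac C00_plusI[of _ "k ` K"]) (auto simp: C00_plus_nonneg[OF f] image_iff, metis inv)
qed

lemma C00_plus_left_translate:
  fixes f :: "'a \<Rightarrow> real"
  assumes "f \<in> C00_plus"
  shows "(\<lambda>x. f (b \<cdot> x)) \<in> C00_plus"
  by (rule C00_plus_pullback[OF assms, of _ "ldiv b"]) (auto intro!: loop_continuous_intros)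

lemma C00_plus_bump:
  fixes K U :: "'a set"
  assumes K: "compact K" and U: "open U" "K \<subseteq> U"
  shows "\<exists>\<psi>\<in>C00_plus. (\<forall>x\<in>K. \<psi> x = 1) \<and> (\<forall>x. x \<notin> U \<longrightarrow> \<psi> x = 0)"
proof -
  have "\<forall>x. \<exists>V C. open V \<and> compact C \<and> x \<in> V \<and> V \<subseteq> (C :: 'a set)"
    using locally_compact by (auto simp: locally_compact_space_def)
  then obtain V C where VC: "\<And>x::'a. open (V x)" "\<And>x. compact (C x)" "\<And>x. x \<in> V x" "\<And>x::'a. V x \<subseteq> C x"
    by metis
  have "\<exists>F. finite F \<and> F \<subseteq> UNIV \<and> (\<forall>x\<in>K. \<exists>y\<in>F. x \<in> V y)"
    using VC(1,3) by (intro compact_finite_subcover[OF K]) auto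
  then obtain F where F: "finite F" "\<forall>x\<in>K. \<exists>y\<in>F. x \<in> V y" by blast
  have CF: "compact (\<Union>x\<in>F. C x)" using F VC by auto
  let ?T = "- (U \<inter> (\<Union>x\<in>F. V x))"
  have T: "closedin euclidean ?T" "disjnt K ?T"
    using U VC(1) F by (auto simp: disjnt_iff closed_def[symmetric] intro!: closed_Un closed_INT)
  have "completely_regular_space (euclidean :: 'a topology)"
    using locally_compact hausdorff
    by (simp add: locally_compact_regular_imp_completely_regular_space)
  then obtain \<psi> where \<psi>: "continuous_map euclidean (top_of_set {0..1}) \<psi>" "\<psi> ` ?T \<subseteq> {0::real}" "\<psi> ` K \<subseteq> {1}"
    using Urysohn_completely_regular_compact_closed[of "0::real" 1 euclidean K ?T] K T by auto
  have cont: "continuous_on UNIV \<psi>" and rng: "\<And>x. \<psi> x \<in> {0..1}"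
    using \<psi>(1) by (auto simp: continuous_map_in_subtopology image_subset_iff)
  have z: "\<psi> x = 0" if "x \<in> ?T" for x using that \<psi>(2) by blast
  have "\<psi> \<in> C00_plus"
  proof (rule C00_plusI[OF cont _ CF])
    show "0 \<le> \<psi> x" for x using rng[of x] by auto
    show "x \<in> (\<Union>x\<in>F. C x)" if "\<psi> x \<noteq> 0" for x
      using z[of x] that VC(4) by blast
  qed
  then show ?thesis using \<psi>(3) z by (intro bexI[of _ \<psi>]) auto
qed

text \<open>Uniform continuity in terms of the quotient \<open>linv y \<cdot> x\<close>, for a function that is constant along a compact
set \<open>C\<close> of quotients. It is applied with \<open>C = {unit}\<close> and, for \<open>N\<close>-invariant functions, with
\<open>C = N\<close>. Only pairs with \<open>x\<close> or \<open>y\<close> in the compact support matter, and each of \<open>x\<close> and \<open>y\<close> is a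
continuous function of the other one and of the quotient.\<close>

lemma uniformly_continuous_loop:
  fixes f :: "'a \<Rightarrow> real" and C :: "'a set"
  assumes f: "f \<in> C00_plus" and C: "compact C"
    and const: "\<And>x y. linv y \<cdot> x \<in> C \<Longrightarrow> f x = f y" and \<epsilon>: "0 < \<epsilon>"
  shows "\<exists>W. open W \<and> C \<subseteq> W \<and> (\<forall>x y. linv y \<cdot> x \<in> W \<longrightarrow> \<bar>f x - f y\<bar> < \<epsilon>)"
proof -
  obtain K where K: "compact K" "\<And>x. f x \<noteq> 0 \<Longrightarrow> x \<in> K" using C00_plus_support[OF f] by blast
  let ?P = "{z. \<bar>f (ldiv (linv (fst z)) (snd z)) - f (fst z)\<bar> < \<epsilon>}"
  let ?Q = "{z. \<bar>f (fst z) - f (rinv (rdiv (snd z) (fst z)))\<bar> < \<epsilon>}"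
  have "open ?P" "open ?Q"
    by (intro open_Collect_less loop_continuous_intros C00_plus_comp[OF f])+
  moreover have "K \<times> C \<subseteq> ?P"
  proof clarsimp
    fix y u assume "u \<in> C"
    then show "\<bar>f (ldiv (linv y) u) - f y\<bar> < \<epsilon>" using const[of y "ldiv (linv y) u"] \<epsilon> by simp
  qed
  moreover have "K \<times> C \<subseteq> ?Q"
  proof clarsimp
    fix x u assume "u \<in> C"
    then show "\<bar>f x - f (rinv (rdiv u x))\<bar> < \<epsilon>" using const[of "rinv (rdiv u x)" x] \<epsilon> by simp
  qed
  ultimately have
    "\<exists>U V. open U \<and> open V \<and> K \<subseteq> U \<and> C \<subseteq> V \<and> U \<times> V \<subseteq> ?P"
    "\<exists>U V. open U \<and> open V \<and> K \<subseteq> U \<and> C \<subseteq> V \<and> U \<times> V \<subseteq> ?Q"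
    by (simp_all only: compact_rectangle_neighbourhood[OF K(1) C])
  then obtain U1 V1 U2 V2 where UV: "open V1" "K \<subseteq> U1" "C \<subseteq> V1" "U1 \<times> V1 \<subseteq> ?P"
      "open V2" "K \<subseteq> U2" "C \<subseteq> V2" "U2 \<times> V2 \<subseteq> ?Q"
    by (elim exE conjE) (rule that)
  have "\<bar>f x - f y\<bar> < \<epsilon>" if u: "linv y \<cdot> x \<in> V1 \<inter> V2" for x y
  proof (cases "f y = 0 \<and> f x = 0")
    case True
    then show ?thesis using \<epsilon> by simp
  next
    case False
    then consider "y \<in> K" | "x \<in> K" using K by blast
    then show ?thesis
    proof cases
      case 1
      then have "(y, linv y \<cdot> x) \<in> ?P" using UV u by blast
      then show ?thesis by simp
    next
      case 2
      then have "(x, linv y \<cdot> x) \<in> ?Q" using UV u by blast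
      then show ?thesis by simp
    qed
  qed
  with UV show ?thesis by (intro exI[of _ "V1 \<inter> V2"]) auto
qed

section \<open>Covering numbers\<close>

definition covering_costs :: "('a \<Rightarrow> real) \<Rightarrow> ('a \<Rightarrow> real) \<Rightarrow> real set"
  where "covering_costs f \<phi> = {(\<Sum>j=1..m. c j) | (m::nat) (b :: nat \<Rightarrow> 'a) (c :: nat \<Rightarrow> real).
           1 \<le> m \<and> (\<forall>j\<in>{1..m}. 0 < c j) \<and> (\<forall>x. f x \<le> (\<Sum>j=1..m. c j * \<phi> (b j \<cdot> x)))}"

lemma covering_number_eq_Inf: "covering_number f \<phi> = Inf (covering_costs f \<phi>)"
  by (simp add: covering_number_def covering_costs_def)

lemma covering_costs_nonneg: "v \<in> covering_costs f \<phi> \<Longrightarrow> 0 \<le> v"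
  by (force simp: covering_costs_def intro!: sum_nonneg intro: less_imp_le)

lemma covering_costsI:
  fixes m :: nat
  assumes "1 \<le> m" "\<And>j. j \<in> {1..m} \<Longrightarrow> 0 < c j" "\<And>x. f x \<le> (\<Sum>j=1..m. c j * \<phi> (b j \<cdot> x))"
  shows "(\<Sum>j=1..m. c j) \<in> covering_costs f \<phi>"
  using assms unfolding covering_costs_def by blast

text \<open>Index sets other than \<open>{1..m}\<close> and vanishing coefficients are admissible as well, because adding a small
positive amount to every coefficient changes the cost by little.\<close>

lemma covering_number_le:
  fixes a :: "'i \<Rightarrow> real"
  assumes J: "finite J" and a: "\<And>j. j \<in> J \<Longrightarrow> 0 \<le> a j" and \<phi>: "\<And>x. 0 \<le> \<phi> x"
    and cover: "\<And>x. f x \<le> (\<Sum>j\<in>J. a j * \<phi> (b j \<cdot> x))"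
  shows "covering_number f \<phi> \<le> (\<Sum>j\<in>J. a j)"
proof (rule field_le_epsilon)
  fix \<epsilon> :: real assume \<epsilon>: "0 < \<epsilon>"
  obtain h where h: "bij_betw h {1..card J} J" using ex_bij_betw_nat_finite_1[OF J] by blast
  \<comment> \<open>one extra index guarantees \<open>1 \<le> m\<close> when \<open>J\<close> is empty\<close>
  define m where "m = Suc (card J)"
  define \<eta> where "\<eta> = \<epsilon> / real m"
  have \<eta>: "0 < \<eta>" using \<epsilon> by (simp add: \<eta>_def m_def)
  define c where "c j = (if j = m then 0 else a (h j)) + \<eta>" for j
  define d where "d j = (if j = m then unit else b (h j))" for j
  have hJ: "h j \<in> J" if "j \<in> {1..m}" "j \<noteq> m" for j
    using that h by (auto simp: m_def bij_betw_def)
  have c: "0 < c j" "(if j = m then 0 else a (h j)) \<le> c j" if "j \<in> {1..m}" for j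
    using a[OF hJ[OF that]] \<eta> by (auto simp: c_def)
  have split: "(\<Sum>j=1..m. g j) = (\<Sum>j=1..card J. g j) + g m" for g :: "nat \<Rightarrow> real"
    by (simp add: m_def)
  have reindex: "(\<Sum>j=1..m. if j = m then 0 else g (h j)) = (\<Sum>j\<in>J. g j)" for g :: "'i \<Rightarrow> real"
  proof -
    have "(\<Sum>j=1..m. if j = m then 0 else g (h j)) = (\<Sum>j=1..card J. g (h j))"
      unfolding split by (auto simp: m_def intro!: sum.cong)
    also have "\<dots> = (\<Sum>j\<in>J. g j)" by (rule sum.reindex_bij_betw[OF h])
    finally show ?thesis .
  qed
  have "f x \<le> (\<Sum>j=1..m. c j * \<phi> (d j \<cdot> x))" for x
  proof -
    have "f x \<le> (\<Sum>j=1..m. if j = m then 0 else a (h j) * \<phi> (b (h j) \<cdot> x))"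
      using cover[of x] reindex[of "\<lambda>j. a j * \<phi> (b j \<cdot> x)"] by simp
    also have "\<dots> \<le> (\<Sum>j=1..m. c j * \<phi> (d j \<cdot> x))"
    proof (rule sum_mono)
      fix j assume j: "j \<in> {1..m}"
      show "(if j = m then 0 else a (h j) * \<phi> (b (h j) \<cdot> x)) \<le> c j * \<phi> (d j \<cdot> x)"
        using c[OF j] \<phi> by (auto simp: d_def intro!: mult_right_mono)
    qed
    finally show ?thesis .
  qed
  then have "covering_number f \<phi> \<le> (\<Sum>j=1..m. c j)"
    unfolding covering_number_eq_Inf using c(1) covering_costs_nonneg
    by (intro cInf_lower covering_costsI[where b=d] bdd_belowI[of _ 0]) (simp_all add: m_def)
  also have "\<dots> = (\<Sum>j\<in>J. a j) + \<epsilon>"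
    unfolding c_def sum.distrib using reindex[of a] by (simp add: \<eta>_def m_def)
  finally show "covering_number f \<phi> \<le> (\<Sum>j\<in>J. a j) + \<epsilon>" .
qed

lemma compact_covering:
  fixes K :: "'a set"
  assumes \<phi>: "\<phi> \<in> C00_plus" "\<phi> \<noteq> (\<lambda>x. 0)" and K: "compact K"
  shows "\<exists>B c. finite B \<and> 0 < c \<and> (\<forall>x\<in>K. 1 \<le> (\<Sum>b\<in>B. c * \<phi> (b \<cdot> x)))"
proof -
  obtain z where "\<phi> z \<noteq> 0" using \<phi> by auto
  then have z: "0 < \<phi> z" using C00_plus_nonneg[OF \<phi>(1), of z] by simp
  have op: "open {x. \<phi> z / 2 < \<phi> (b \<cdot> x)}" for b
    by (intro open_Collect_less loop_continuous_intros C00_plus_comp[OF \<phi>(1)])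
  have "\<exists>B. finite B \<and> B \<subseteq> UNIV \<and> (\<forall>x\<in>K. \<exists>b\<in>B. x \<in> {x. \<phi> z / 2 < \<phi> (b \<cdot> x)})"
  proof (rule compact_finite_subcover[OF K op])
    show "\<exists>b\<in>UNIV. x \<in> {x. \<phi> z / 2 < \<phi> (b \<cdot> x)}" for x
      using z by (intro bexI[of _ "rdiv z x"]) auto
  qed
  then obtain B where B: "finite B" "\<forall>x\<in>K. \<exists>b\<in>B. \<phi> z / 2 < \<phi> (b \<cdot> x)"
    by auto
  have "1 \<le> (\<Sum>b\<in>B. 2 / \<phi> z * \<phi> (b \<cdot> x))" if "x \<in> K" for x
  proof -
    obtain b where b: "b \<in> B" "\<phi> z / 2 < \<phi> (b \<cdot> x)" using B \<open>x \<in> K\<close> by blast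
    have "1 \<le> 2 / \<phi> z * \<phi> (b \<cdot> x)" using b z by (simp add: field_simps)
    also have "\<dots> \<le> (\<Sum>b\<in>B. 2 / \<phi> z * \<phi> (b \<cdot> x))"
      using B b z by (intro member_le_sum) (auto intro!: mult_nonneg_nonneg simp: C00_plus_nonneg[OF \<phi>(1)])
    finally show ?thesis .
  qed
  with B z show ?thesis by (intro exI[of _ B] exI[of _ "2 / \<phi> z"]) auto
qed

lemma covering_costs_nonempty:
  fixes f \<phi> :: "'a \<Rightarrow> real"
  assumes f: "f \<in> C00_plus" and \<phi>: "\<phi> \<in> C00_plus" "\<phi> \<noteq> (\<lambda>x. 0)"
  shows "covering_costs f \<phi> \<noteq> {}"
proof -
  obtain K where K: "compact K" "\<And>x. f x \<noteq> 0 \<Longrightarrow> x \<in> K" using C00_plus_support[OF f] by blast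
  obtain D where D: "0 < D" "\<And>x. f x \<le> D" using C00_plus_bounded[OF f] by auto
  obtain B s where B: "finite B" "0 < s" "\<And>x. x \<in> K \<Longrightarrow> 1 \<le> (\<Sum>b\<in>B. s * \<phi> (b \<cdot> x))"
    using compact_covering[OF \<phi> K(1)] by metis
  obtain h where h: "bij_betw h {1..card (insert unit B)} (insert unit B)"
    using ex_bij_betw_nat_finite_1[of "insert unit B"] B by blast
  have "f x \<le> (\<Sum>j=1..card (insert unit B). D * s * \<phi> (h j \<cdot> x))" for x
  proof -
    have nn: "0 \<le> D * s * \<phi> (b \<cdot> x)" for b
      using D B C00_plus_nonneg[OF \<phi>(1)] by (intro mult_nonneg_nonneg) auto
    have "f x \<le> (\<Sum>b\<in>B. D * s * \<phi> (b \<cdot> x))"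
    proof (cases "x \<in> K")
      case True
      have "f x \<le> D * 1" using D by simp
      also have "\<dots> \<le> D * (\<Sum>b\<in>B. s * \<phi> (b \<cdot> x))" using D B(3)[OF True] by (intro mult_left_mono) auto
      finally show ?thesis by (simp add: sum_distrib_left mult.assoc)
    next
      case False
      then show ?thesis using K nn by (metis sum_nonneg)
    qed
    also have "\<dots> \<le> (\<Sum>b\<in>insert unit B. D * s * \<phi> (b \<cdot> x))"
      using B nn by (intro sum_mono2) auto
    also have "\<dots> = (\<Sum>j=1..card (insert unit B). D * s * \<phi> (h j \<cdot> x))"
      using sum.reindex_bij_betw[OF h, of "\<lambda>b. D * s * \<phi> (b \<cdot> x)"] by simp
    finally show ?thesis .
  qed
  moreover have "1 \<le> card (insert unit B)" using B by (simp add: Suc_le_eq card_gt_0_iff)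
  ultimately have "(\<Sum>j=1..card (insert unit B). D * s) \<in> covering_costs f \<phi>"
    using D B by (intro covering_costsI[where b=h]) auto
  then show ?thesis by blast
qed

lemma covering_number_approx:
  fixes f \<phi> :: "'a \<Rightarrow> real"
  assumes "f \<in> C00_plus" "\<phi> \<in> C00_plus" "\<phi> \<noteq> (\<lambda>x. 0)" "0 < \<epsilon>"
  shows "\<exists>(m::nat) b c. (\<forall>j\<in>{1..m}. 0 < c j) \<and> (\<forall>x. f x \<le> (\<Sum>j=1..m. c j * \<phi> (b j \<cdot> x))) \<and>
    (\<Sum>j=1..m. c j) < covering_number f \<phi> + \<epsilon>"
proof -
  have "Inf (covering_costs f \<phi>) < covering_number f \<phi> + \<epsilon>"
    using assms by (simp add: covering_number_eq_Inf)
  then obtain v where v: "v \<in> covering_costs f \<phi>" "v < covering_number f \<phi> + \<epsilon>"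
    using cInf_lessD[OF covering_costs_nonempty[OF assms(1-3)]] by blast
  from v(1) obtain m :: nat and b c where "\<forall>j\<in>{1..m}. 0 < c j"
      "\<forall>x. f x \<le> (\<Sum>j=1..m. c j * \<phi> (b j \<cdot> x))" "v = (\<Sum>j=1..m. c j)"
    unfolding covering_costs_def by blast
  with v(2) show ?thesis by blast
qed

lemma covering_number_nonneg:
  assumes "f \<in> C00_plus" "\<phi> \<in> C00_plus" "\<phi> \<noteq> (\<lambda>x. 0)"
  shows "0 \<le> covering_number f \<phi>"
  unfolding covering_number_eq_Inf
  by (intro cInf_greatest covering_costs_nonempty assms covering_costs_nonneg)


lemma covering_number_add:
  fixes f g \<phi> :: "'a \<Rightarrow> real"
  assumes f: "f \<in> C00_plus" and g: "g \<in> C00_plus" and \<phi>: "\<phi> \<in> C00_plus" "\<phi> \<noteq> (\<lambda>x. 0)"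
  shows "covering_number (\<lambda>x. f x + g x) \<phi> \<le> covering_number f \<phi> + covering_number g \<phi>"
proof (rule field_le_epsilon)
  fix \<epsilon> :: real assume \<epsilon>: "0 < \<epsilon>"
  then have \<epsilon>2: "0 < \<epsilon> / 2" by simp
  obtain m :: nat and b c where 1: "\<forall>j\<in>{1..m}. 0 < c j" "\<forall>x. f x \<le> (\<Sum>j=1..m. c j * \<phi> (b j \<cdot> x))"
      "(\<Sum>j=1..m. c j) < covering_number f \<phi> + \<epsilon> / 2"
    using covering_number_approx[OF f \<phi> \<epsilon>2] by blast
  obtain n :: nat and b' c' where 2: "\<forall>j\<in>{1..n}. 0 < c' j" "\<forall>x. g x \<le> (\<Sum>j=1..n. c' j * \<phi> (b' j \<cdot> x))"
      "(\<Sum>j=1..n. c' j) < covering_number g \<phi> + \<epsilon> / 2"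
    using covering_number_approx[OF g \<phi> \<epsilon>2] by blast
  have "covering_number (\<lambda>x. f x + g x) \<phi> \<le> (\<Sum>j\<in>{1..m} <+> {1..n}. case_sum c c' j)"
  proof (rule covering_number_le[where b="case_sum b b'"])
    show "f x + g x \<le> (\<Sum>j\<in>{1..m} <+> {1..n}. case_sum c c' j * \<phi> (case_sum b b' j \<cdot> x))" for x
      using 1(2) 2(2) by (simp add: sum.Plus add_mono)
  qed (use 1 2 C00_plus_nonneg[OF \<phi>(1)] in \<open>auto intro: less_imp_le\<close>)
  then show "covering_number (\<lambda>x. f x + g x) \<phi> \<le> covering_number f \<phi> + covering_number g \<phi> + \<epsilon>"
    using 1(3) 2(3) by (simp add: sum.Plus)
qed

lemma covering_number_mono:
  fixes f g \<phi> :: "'a \<Rightarrow> real"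
  assumes g: "g \<in> C00_plus" and \<phi>: "\<phi> \<in> C00_plus" "\<phi> \<noteq> (\<lambda>x. 0)" and le: "\<And>x. f x \<le> g x"
  shows "covering_number f \<phi> \<le> covering_number g \<phi>"
proof (rule field_le_epsilon)
  fix \<epsilon> :: real assume \<epsilon>: "0 < \<epsilon>"
  obtain m :: nat and b c where 1: "\<forall>j\<in>{1..m}. 0 < c j" "\<forall>x. g x \<le> (\<Sum>j=1..m. c j * \<phi> (b j \<cdot> x))"
      "(\<Sum>j=1..m. c j) < covering_number g \<phi> + \<epsilon>"
    using covering_number_approx[OF g \<phi> \<epsilon>] by blast
  have "covering_number f \<phi> \<le> (\<Sum>j=1..m. c j)"
    using 1 C00_plus_nonneg[OF \<phi>(1)] order_trans[OF le]
    by (intro covering_number_le[where b=b]) (auto intro: less_imp_le)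
  with 1 show "covering_number f \<phi> \<le> covering_number g \<phi> + \<epsilon>" by linarith
qed

lemma covering_number_zero:
  fixes \<phi> :: "'a \<Rightarrow> real"
  assumes "\<phi> \<in> C00_plus" "\<phi> \<noteq> (\<lambda>x. 0)"
  shows "covering_number (\<lambda>x. 0) \<phi> = 0"
proof -
  have "covering_number (\<lambda>x. 0) \<phi> \<le> (\<Sum>j\<in>{}. 0)"
    by (rule covering_number_le[where b="\<lambda>_. unit"]) (use C00_plus_nonneg[OF assms(1)] in auto)
  with covering_number_nonneg[OF C00_plus_zero assms] show ?thesis by simp
qed

lemma covering_number_scale:
  fixes f \<phi> :: "'a \<Rightarrow> real"
  assumes f: "f \<in> C00_plus" and \<phi>: "\<phi> \<in> C00_plus" "\<phi> \<noteq> (\<lambda>x. 0)" and \<alpha>: "0 \<le> \<alpha>"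
  shows "covering_number (\<lambda>x. \<alpha> * f x) \<phi> = \<alpha> * covering_number f \<phi>"
proof -
  have le: "covering_number (\<lambda>x. \<beta> * h x) \<phi> \<le> \<beta> * covering_number h \<phi>"
    if h: "h \<in> C00_plus" and \<beta>: "0 < \<beta>" for \<beta> and h :: "'a \<Rightarrow> real"
  proof (rule field_le_epsilon)
    fix \<epsilon> :: real assume \<epsilon>: "0 < \<epsilon>"
    then have "0 < \<epsilon> / \<beta>" using \<beta> by simp
    from covering_number_approx[OF h \<phi> this] obtain m :: nat and b c where
      1: "\<forall>j\<in>{1..m}. 0 < c j" "\<forall>x. h x \<le> (\<Sum>j=1..m. c j * \<phi> (b j \<cdot> x))"
      "(\<Sum>j=1..m. c j) < covering_number h \<phi> + \<epsilon> / \<beta>"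
      by blast
    have "covering_number (\<lambda>x. \<beta> * h x) \<phi> \<le> (\<Sum>j=1..m. \<beta> * c j)"
    proof (rule covering_number_le[where b=b])
      show "\<beta> * h x \<le> (\<Sum>j=1..m. \<beta> * c j * \<phi> (b j \<cdot> x))" for x
        using mult_left_mono[OF spec[OF 1(2), of x], of \<beta>] \<beta> by (simp add: sum_distrib_left mult.assoc)
    qed (use 1 \<beta> C00_plus_nonneg[OF \<phi>(1)] in \<open>auto intro: less_imp_le\<close>)
    also have "\<dots> \<le> \<beta> * (covering_number h \<phi> + \<epsilon> / \<beta>)"
      unfolding sum_distrib_left[symmetric] using 1(3) \<beta> by (intro mult_left_mono) auto
    also have "\<dots> = \<beta> * covering_number h \<phi> + \<epsilon>" using \<beta> by (simp add: field_simps)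
    finally show "covering_number (\<lambda>x. \<beta> * h x) \<phi> \<le> \<beta> * covering_number h \<phi> + \<epsilon>" .
  qed
  show ?thesis
  proof (cases "\<alpha> = 0")
    case True
    then show ?thesis using covering_number_zero[OF \<phi>] by simp
  next
    case False
    with \<alpha> have pos: "0 < \<alpha>" by simp
    have "covering_number (\<lambda>x. (1 / \<alpha>) * (\<alpha> * f x)) \<phi> \<le> (1 / \<alpha>) * covering_number (\<lambda>x. \<alpha> * f x) \<phi>"
      using pos by (intro le C00_plus_scale f) auto
    then have "\<alpha> * covering_number f \<phi> \<le> covering_number (\<lambda>x. \<alpha> * f x) \<phi>"
      using pos by (simp add: field_simps)
    with le[OF f pos] show ?thesis by simp
  qed
qed

lemma covering_number_combination:
  fixes h :: "'i \<Rightarrow> 'a \<Rightarrow> real" and \<phi> :: "'a \<Rightarrow> real"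
  assumes J: "finite J" and h: "\<And>j. j \<in> J \<Longrightarrow> h j \<in> C00_plus" and a: "\<And>j. j \<in> J \<Longrightarrow> 0 \<le> a j"
    and \<phi>: "\<phi> \<in> C00_plus" "\<phi> \<noteq> (\<lambda>x. 0)" and le: "\<And>x. f x \<le> (\<Sum>j\<in>J. a j * h j x)"
  shows "covering_number f \<phi> \<le> (\<Sum>j\<in>J. a j * covering_number (h j) \<phi>)"
proof -
  have "covering_number (\<lambda>x. \<Sum>j\<in>J. a j * h j x) \<phi> \<le> (\<Sum>j\<in>J. a j * covering_number (h j) \<phi>)"
    using J h a
  proof induction
    case empty
    then show ?case using covering_number_zero[OF \<phi>] by simp
  next
    case (insert i J)
    have "covering_number (\<lambda>x. a i * h i x + (\<Sum>j\<in>J. a j * h j x)) \<phi>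
        \<le> covering_number (\<lambda>x. a i * h i x) \<phi> + covering_number (\<lambda>x. \<Sum>j\<in>J. a j * h j x) \<phi>"
      using insert by (intro covering_number_add C00_plus_scale C00_plus_sum \<phi>) auto
    also have "covering_number (\<lambda>x. a i * h i x) \<phi> = a i * covering_number (h i) \<phi>"
      using insert by (intro covering_number_scale \<phi>) auto
    finally show ?case using insert by simp
  qed
  moreover have "covering_number f \<phi> \<le> covering_number (\<lambda>x. \<Sum>j\<in>J. a j * h j x) \<phi>"
    using J h a by (intro covering_number_mono C00_plus_sum C00_plus_scale \<phi> le) auto
  ultimately show ?thesis by simp
qed

lemma covering_number_pos:
  fixes f \<phi> :: "'a \<Rightarrow> real"
  assumes f: "f \<in> C00_plus" "f \<noteq> (\<lambda>x. 0)" and \<phi>: "\<phi> \<in> C00_plus" "\<phi> \<noteq> (\<lambda>x. 0)"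
  shows "0 < covering_number f \<phi>"
proof -
  obtain z where "f z \<noteq> 0" using f by auto
  then have z: "0 < f z" using C00_plus_nonneg[OF f(1), of z] by simp
  obtain B where B: "0 < B" "\<And>x. \<phi> x \<le> B" using C00_plus_bounded[OF \<phi>(1)] by auto
  have "f z / B \<le> covering_number f \<phi>"
  proof (rule field_le_epsilon)
    fix \<epsilon> :: real assume "0 < \<epsilon>"
    from covering_number_approx[OF f(1) \<phi> this] obtain m :: nat and b c where
      1: "\<forall>j\<in>{1..m}. 0 < c j" "\<forall>x. f x \<le> (\<Sum>j=1..m. c j * \<phi> (b j \<cdot> x))"
      "(\<Sum>j=1..m. c j) < covering_number f \<phi> + \<epsilon>"
      by blast
    have "f z \<le> (\<Sum>j=1..m. c j * \<phi> (b j \<cdot> z))" using 1(2) by blast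
    also have "\<dots> \<le> (\<Sum>j=1..m. c j * B)"
      using 1(1) B(2) by (intro sum_mono mult_left_mono) (auto intro: less_imp_le)
    also have "\<dots> \<le> (covering_number f \<phi> + \<epsilon>) * B"
      unfolding sum_distrib_right[symmetric] using 1(3) B(1) by (intro mult_right_mono) auto
    finally show "f z / B \<le> covering_number f \<phi> + \<epsilon>" using B(1) by (simp add: divide_le_eq)
  qed
  moreover have "0 < f z / B" using z B by simp
  ultimately show ?thesis by linarith
qed

end

section \<open>Functions invariant under a compact normal subgroup of the nucleus\<close>

locale compact_by_group_loop = lc_topological_fan_loop mult
  for mult :: "'a::t1_space \<Rightarrow> 'a \<Rightarrow> 'a"  (infixl "\<cdot>" 70) +
  fixes N :: "'a set"
  assumes compact_N: "compact N"
    and subgroup_N: "is_subgroup N"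
    and N_nucleus: "N \<subseteq> nucleus"
    and assoc_mod_N: "\<exists>\<gamma>\<in>N. (a \<cdot> b) \<cdot> c = \<gamma> \<cdot> (a \<cdot> (b \<cdot> c))"
    and right_coset_le: "\<gamma> \<in> N \<Longrightarrow> \<exists>\<delta>\<in>N. a \<cdot> \<gamma> = \<delta> \<cdot> a"
    and left_coset_le: "\<gamma> \<in> N \<Longrightarrow> \<exists>\<delta>\<in>N. \<gamma> \<cdot> a = a \<cdot> \<delta>"
begin

lemma N_assoc:
  assumes "\<gamma> \<in> N"
  shows "(\<gamma> \<cdot> b) \<cdot> c = \<gamma> \<cdot> (b \<cdot> c)" "(b \<cdot> \<gamma>) \<cdot> c = b \<cdot> (\<gamma> \<cdot> c)" "(b \<cdot> c) \<cdot> \<gamma> = b \<cdot> (c \<cdot> \<gamma>)"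
  using nucleusD[of \<gamma>] N_nucleus assms by blast+

lemma N_closed: "unit \<in> N" "\<gamma> \<in> N \<Longrightarrow> \<delta> \<in> N \<Longrightarrow> \<gamma> \<cdot> \<delta> \<in> N" "\<gamma> \<in> N \<Longrightarrow> linv \<gamma> \<in> N"
  using subgroup_N by (auto simp: is_subgroup_def linv_def)

lemma N_mult_linv: "\<gamma> \<in> N \<Longrightarrow> \<gamma> \<cdot> linv \<gamma> = unit"
proof -
  assume "\<gamma> \<in> N"
  then have "(\<gamma> \<cdot> linv \<gamma>) \<cdot> \<gamma> = unit \<cdot> \<gamma>" by (simp add: N_assoc(1))
  then show ?thesis by (simp only: right_cancel)
qed

lemma N_linv_cancel: "\<gamma> \<in> N \<Longrightarrow> linv \<gamma> \<cdot> (\<gamma> \<cdot> a) = a" "\<gamma> \<in> N \<Longrightarrow> \<gamma> \<cdot> (linv \<gamma> \<cdot> a) = a"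
  "\<gamma> \<in> N \<Longrightarrow> (a \<cdot> \<gamma>) \<cdot> linv \<gamma> = a"
  using N_closed(3) N_mult_linv by (simp_all add: N_assoc[symmetric] N_assoc(3))

sublocale N: compact_group N "(\<cdot>)" unit linv
proof
  show "continuous_on (N \<times> N) (\<lambda>(x, y). x \<cdot> y)"
    using continuous_mult continuous_on_subset by blast
qed (auto simp: compact_N N_closed N_assoc N_mult_linv)

text \<open>These are the functions on the group \<open>G/N\<close>; for them multiplication is associative.\<close>

definition C00_inv :: "('a \<Rightarrow> real) set"
  where "C00_inv = {f \<in> C00_plus. \<forall>a. \<forall>\<gamma>\<in>N. f (\<gamma> \<cdot> a) = f a}"

lemma C00_invD:
  assumes "f \<in> C00_inv"
  shows "f \<in> C00_plus" "\<gamma> \<in> N \<Longrightarrow> f (\<gamma> \<cdot> a) = f a" "\<gamma> \<in> N \<Longrightarrow> f (a \<cdot> \<gamma>) = f a"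
    "f ((a \<cdot> b) \<cdot> c) = f (a \<cdot> (b \<cdot> c))"
proof -
  show C: "f \<in> C00_plus" and L: "\<And>\<gamma> a. \<gamma> \<in> N \<Longrightarrow> f (\<gamma> \<cdot> a) = f a"
    using assms by (auto simp: C00_inv_def)
  show "\<gamma> \<in> N \<Longrightarrow> f (a \<cdot> \<gamma>) = f a" using L right_coset_le by metis
  show "f ((a \<cdot> b) \<cdot> c) = f (a \<cdot> (b \<cdot> c))" using L assoc_mod_N by metis
qed

lemma C00_inv_nonneg: "f \<in> C00_inv \<Longrightarrow> 0 \<le> f x"
  using C00_plus_nonneg[OF C00_invD(1)] .

lemma C00_inv_add: "f \<in> C00_inv \<Longrightarrow> g \<in> C00_inv \<Longrightarrow> (\<lambda>x. f x + g x) \<in> C00_inv"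
  by (simp add: C00_inv_def C00_plus_add)

lemma C00_inv_scale: "f \<in> C00_inv \<Longrightarrow> 0 \<le> \<alpha> \<Longrightarrow> (\<lambda>x. \<alpha> * f x) \<in> C00_inv"
  by (simp add: C00_inv_def C00_plus_scale)

lemma C00_inv_sum: "finite J \<Longrightarrow> (\<And>j. j \<in> J \<Longrightarrow> f j \<in> C00_inv) \<Longrightarrow> (\<lambda>x. \<Sum>j\<in>J. f j x) \<in> C00_inv"
  by (simp add: C00_inv_def C00_plus_sum)

lemma C00_inv_left_translate:
  assumes "f \<in> C00_inv"
  shows "(\<lambda>x. f (b \<cdot> x)) \<in> C00_inv"
proof -
  have "f (b \<cdot> (\<gamma> \<cdot> a)) = f (b \<cdot> a)" if \<gamma>: "\<gamma> \<in> N" for \<gamma> a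
  proof -
    obtain \<delta> where "\<delta> \<in> N" "b \<cdot> \<gamma> = \<delta> \<cdot> b" using right_coset_le[OF \<gamma>] by blast
    then have "b \<cdot> (\<gamma> \<cdot> a) = \<delta> \<cdot> (b \<cdot> a)" using \<gamma> by (metis N_assoc(1,2))
    then show ?thesis using C00_invD(2)[OF assms \<open>\<delta> \<in> N\<close>] by simp
  qed
  then show ?thesis using assms C00_plus_left_translate by (simp add: C00_inv_def)
qed

lemma mult_linv_in_N: "y \<cdot> linv y \<in> N"
proof -
  obtain \<delta> where "\<delta> \<in> N" "(y \<cdot> linv y) \<cdot> y = \<delta> \<cdot> (y \<cdot> (linv y \<cdot> y))" using assoc_mod_N by blast
  then show ?thesis by simp
qed

lemma C00_inv_linv_mult:
  assumes f: "f \<in> C00_inv" and "linv y \<cdot> x \<in> N"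
  shows "f x = f y"
proof -
  have "f x = f ((y \<cdot> linv y) \<cdot> x)" using C00_invD(2)[OF f mult_linv_in_N] by simp
  also have "\<dots> = f (y \<cdot> (linv y \<cdot> x))" by (rule C00_invD(4)[OF f])
  also have "\<dots> = f y" by (rule C00_invD(3)[OF assms])
  finally show ?thesis .
qed

text \<open>Both averages project onto \<open>N\<close>-invariant functions. The inverse in \<open>left_average\<close> makes the invariance of
the result follow from left invariance of the mean alone.\<close>

definition right_average :: "('a \<Rightarrow> real) \<Rightarrow> 'a \<Rightarrow> real"
  where "right_average f x = N.mean (\<lambda>\<gamma>. f (x \<cdot> \<gamma>))"

definition left_average :: "('a \<Rightarrow> real) \<Rightarrow> 'a \<Rightarrow> real"
  where "left_average f x = N.mean (\<lambda>\<gamma>. f (linv \<gamma> \<cdot> x))"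

lemma continuous_on_mean:
  fixes h :: "'a \<Rightarrow> 'a \<Rightarrow> real"
  assumes h: "continuous_on UNIV (\<lambda>(x, \<gamma>). h x \<gamma>)"
  shows "continuous_on UNIV (\<lambda>x. N.mean (h x))"
proof -
  have hx: "continuous_on N (h x)" for x
  proof -
    have "continuous_on N (\<lambda>\<gamma>. (\<lambda>(x, \<gamma>). h x \<gamma>) (x, \<gamma>))"
      by (rule continuous_on_compose2[OF h]) (auto intro!: continuous_on_Pair continuous_on_const continuous_on_id)
    then show ?thesis by simp
  qed
  have "((\<lambda>x. N.mean (h x)) \<longlongrightarrow> N.mean (h x0)) (at x0)" for x0
  proof (rule tendstoI)
    fix \<epsilon> :: real assume \<epsilon>: "0 < \<epsilon>"
    have "0 < \<epsilon> / 2" using \<epsilon> by simp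
    from uniform_on_compact_parameter[OF continuous_on_subset[OF h subset_UNIV] compact_N UNIV_I this, of x0] obtain X
      where X: "x0 \<in> X" "open X" "\<forall>x\<in>X \<inter> UNIV. \<forall>\<gamma>\<in>N. \<bar>h x \<gamma> - h x0 \<gamma>\<bar> \<le> \<epsilon> / 2"
      by (elim exE conjE)
    have "dist (N.mean (h x)) (N.mean (h x0)) < \<epsilon>" if x: "x \<in> X" for x
    proof -
      have "\<bar>N.mean (\<lambda>\<gamma>. h x \<gamma> + -1 * h x0 \<gamma>) - 0\<bar> \<le> \<epsilon> / 2"
        using X(3) x by (intro N.mean_close_const continuous_on_add continuous_on_mult continuous_on_const hx)
          simp_all
      moreover have "N.mean (\<lambda>\<gamma>. h x \<gamma> + -1 * h x0 \<gamma>) = N.mean (h x) - N.mean (h x0)"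
        using N.mean_add[of "h x" "\<lambda>\<gamma>. -1 * h x0 \<gamma>"] N.mean_scale[OF hx, of "-1" x0]
        by (simp add: continuous_on_minus hx)
      ultimately show ?thesis using \<epsilon> by (simp add: dist_real_def)
    qed
    with X(1,2) show "eventually (\<lambda>x. dist (N.mean (h x)) (N.mean (h x0)) < \<epsilon>) (at x0)"
      unfolding eventually_at_topological by blast
  qed
  then show ?thesis by (simp add: continuous_on_def)
qed

lemma continuous_on_fibre:
  assumes "f \<in> C00_plus"
  shows "continuous_on S (\<lambda>\<gamma>. f (x \<cdot> \<gamma>))" "continuous_on S (\<lambda>\<gamma>. f (linv \<gamma> \<cdot> x))"
  by (intro C00_plus_comp[OF assms] loop_continuous_intros)+

lemma mean_nonzero: "N.mean f \<noteq> 0 \<Longrightarrow> \<exists>\<gamma>\<in>N. f \<gamma> \<noteq> 0"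
  using N.mean_const[of f 0] by blast

lemma right_average_C00_plus:
  assumes f: "f \<in> C00_plus"
  shows "right_average f \<in> C00_plus"
proof -
  obtain K where K: "compact K" "\<And>x. f x \<noteq> 0 \<Longrightarrow> x \<in> K" using C00_plus_support f by blast
  have "compact ((\<lambda>z. rdiv (fst z) (snd z)) ` (K \<times> N))"
    by (intro compact_continuous_image compact_Times K compact_N loop_continuous_intros)
  moreover have "continuous_on UNIV (right_average f)"
    unfolding right_average_def case_prod_unfold
    by (intro continuous_on_mean) (unfold case_prod_unfold, intro C00_plus_comp[OF f] loop_continuous_intros)
  ultimately show ?thesis
  proof (rule_tac C00_plusI)
    show "0 \<le> right_average f x" for x
      unfolding right_average_def by (intro N.mean_nonneg continuous_on_fibre f C00_plus_nonneg)
    fix x assume "right_average f x \<noteq> 0"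
    then obtain \<gamma> where "\<gamma> \<in> N" "f (x \<cdot> \<gamma>) \<noteq> 0" unfolding right_average_def using mean_nonzero by blast
    then show "x \<in> (\<lambda>z. rdiv (fst z) (snd z)) ` (K \<times> N)"
      using K(2) by (intro image_eqI[of _ _ "(x \<cdot> \<gamma>, \<gamma>)"]) auto
  qed
qed

lemma right_average_inv:
  assumes f: "f \<in> C00_plus"
  shows "right_average f \<in> C00_inv"
proof -
  have R: "right_average f (x \<cdot> \<delta>) = right_average f x" if "\<delta> \<in> N" for x \<delta>
    unfolding right_average_def N_assoc(2)[OF that]
    by (rule N.mean_left_translate[OF continuous_on_fibre(1)[OF f] that])
  have "right_average f (\<delta> \<cdot> x) = right_average f x" if "\<delta> \<in> N" for x \<delta>
    using left_coset_le[OF that, of x] R by metis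
  then show ?thesis using right_average_C00_plus[OF f] by (simp add: C00_inv_def)
qed

lemma left_average_inv:
  assumes f: "f \<in> C00_plus"
  shows "left_average f \<in> C00_inv"
proof -
  obtain K where K: "compact K" "\<And>x. f x \<noteq> 0 \<Longrightarrow> x \<in> K" using C00_plus_support f by blast
  have "compact ((\<lambda>z. ldiv (linv (snd z)) (fst z)) ` (K \<times> N))"
    by (intro compact_continuous_image compact_Times K compact_N loop_continuous_intros)
  moreover have "continuous_on UNIV (left_average f)"
    unfolding left_average_def case_prod_unfold
    by (intro continuous_on_mean) (unfold case_prod_unfold, intro C00_plus_comp[OF f] loop_continuous_intros)
  ultimately have "left_average f \<in> C00_plus"
  proof (rule_tac C00_plusI)
    show "0 \<le> left_average f x" for x
      unfolding left_average_def by (intro N.mean_nonneg continuous_on_fibre f C00_plus_nonneg)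
    fix x assume "left_average f x \<noteq> 0"
    then obtain \<gamma> where "\<gamma> \<in> N" "f (linv \<gamma> \<cdot> x) \<noteq> 0" unfolding left_average_def using mean_nonzero by blast
    then show "x \<in> (\<lambda>z. ldiv (linv (snd z)) (fst z)) ` (K \<times> N)"
      using K(2) by (intro image_eqI[of _ _ "(linv \<gamma> \<cdot> x, \<gamma>)"]) auto
  qed
  moreover have "left_average f (\<delta> \<cdot> x) = left_average f x" if \<delta>: "\<delta> \<in> N" for x \<delta>
  proof -
    have linv: "linv \<gamma> \<cdot> (\<delta> \<cdot> x) = linv (linv \<delta> \<cdot> \<gamma>) \<cdot> x" if \<gamma>: "\<gamma> \<in> N" for \<gamma>
    proof -
      have "(linv \<gamma> \<cdot> \<delta>) \<cdot> (linv \<delta> \<cdot> \<gamma>) = linv (linv \<delta> \<cdot> \<gamma>) \<cdot> (linv \<delta> \<cdot> \<gamma>)"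
        using \<gamma> \<delta> by (simp add: N_assoc(1) N_closed N_linv_cancel)
      then have "linv \<gamma> \<cdot> \<delta> = linv (linv \<delta> \<cdot> \<gamma>)" by (simp only: right_cancel)
      then show ?thesis using \<gamma> by (metis N_assoc(1) N_closed(3))
    qed
    have "left_average f (\<delta> \<cdot> x) = N.mean (\<lambda>\<gamma>. f (linv (linv \<delta> \<cdot> \<gamma>) \<cdot> x))"
      unfolding left_average_def by (intro N.mean_cong continuous_on_fibre f) (simp add: linv)
    also have "\<dots> = left_average f x"
      unfolding left_average_def
      by (rule N.mean_left_translate[OF continuous_on_fibre(2)[OF f] N_closed(3)[OF \<delta>]])
    finally show ?thesis .
  qed
  ultimately show ?thesis by (simp add: C00_inv_def)
qed

lemma right_average_add:
  assumes "f \<in> C00_plus" "g \<in> C00_plus"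
  shows "right_average (\<lambda>x. f x + g x) = (\<lambda>x. right_average f x + right_average g x)"
  unfolding right_average_def by (intro ext N.mean_add continuous_on_fibre assms)

lemma right_average_scale:
  assumes "f \<in> C00_plus"
  shows "right_average (\<lambda>x. \<alpha> * f x) = (\<lambda>x. \<alpha> * right_average f x)"
  unfolding right_average_def by (intro ext N.mean_scale continuous_on_fibre assms)

lemma right_average_fixed: "f \<in> C00_inv \<Longrightarrow> right_average f = f"
  unfolding right_average_def by (intro ext N.mean_const C00_invD(3))

text \<open>Left multiplication commutes with the right action of \<open>N\<close> since \<open>N\<close> lies in the nucleus.\<close>

lemma right_average_left_translate:
  assumes "f \<in> C00_plus"
  shows "right_average (\<lambda>x. f (b \<cdot> x)) = (\<lambda>x. right_average f (b \<cdot> x))"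
  unfolding right_average_def
  by (intro ext N.mean_cong continuous_on_fibre C00_plus_left_translate assms) (simp add: N_assoc(3))

text \<open>The average of a bump function that equals 1 on \<open>N\<close> takes the value 1 at the unit. Its support grows by
a factor from \<open>N\<close>, hence the choice of a neighbourhood \<open>U\<close> of \<open>N\<close> with \<open>U N \<subseteq> W\<close>.\<close>

lemma C00_inv_small_support_exists:
  assumes W: "open W" "N \<subseteq> W"
  shows "\<exists>\<phi>\<in>C00_inv. \<phi> \<noteq> (\<lambda>x. 0) \<and> (\<forall>x. \<phi> x \<noteq> 0 \<longrightarrow> x \<in> W)"
proof -
  have "open ((\<lambda>z. fst z \<cdot> snd z) -` W)" by (intro open_vimage W loop_continuous_intros)
  moreover have "N \<times> N \<subseteq> (\<lambda>z. fst z \<cdot> snd z) -` W" using W(2) N_closed(2) by (auto simp: subset_iff)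
  ultimately have "\<exists>U V. open U \<and> open V \<and> N \<subseteq> U \<and> N \<subseteq> V \<and> U \<times> V \<subseteq> (\<lambda>z. fst z \<cdot> snd z) -` W"
    by (rule compact_rectangle_neighbourhood[OF compact_N compact_N])
  then obtain U V where U: "open U" "N \<subseteq> U" "N \<subseteq> V" "U \<times> V \<subseteq> (\<lambda>z. fst z \<cdot> snd z) -` W"
    by (elim exE conjE)
  have UW: "x \<cdot> \<gamma> \<in> W" if "x \<in> U" "\<gamma> \<in> N" for x \<gamma>
    using subsetD[OF U(4), of "(x, \<gamma>)"] subsetD[OF U(3), of \<gamma>] that by simp
  obtain \<psi> where \<psi>: "\<psi> \<in> C00_plus" "\<forall>x\<in>N. \<psi> x = 1" "\<forall>x. x \<notin> U \<longrightarrow> \<psi> x = 0"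
    using C00_plus_bump[OF compact_N U(1,2)] by (elim bexE conjE)
  have "right_average \<psi> unit = 1"
    unfolding right_average_def using \<psi>(2) by (intro N.mean_const) simp
  then have "right_average \<psi> \<noteq> (\<lambda>x. 0)" by auto
  moreover have "x \<in> W" if nz: "right_average \<psi> x \<noteq> 0" for x
  proof -
    obtain \<gamma> where \<gamma>: "\<gamma> \<in> N" "\<psi> (x \<cdot> \<gamma>) \<noteq> 0"
      using nz unfolding right_average_def by (blast dest: mean_nonzero)
    then have "x \<cdot> \<gamma> \<in> U" using \<psi>(3) by blast
    from UW[OF this N_closed(3)[OF \<gamma>(1)]] show ?thesis using \<gamma>(1) by (simp add: N_linv_cancel)
  qed
  ultimately show ?thesis using right_average_inv[OF \<psi>(1)] by (intro bexI[of _ "right_average \<psi>"]) auto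
qed

text \<open>Since \<open>\<phi>\<close> is \<open>N\<close>-invariant, a translate of a translate of \<open>\<phi>\<close> is again a translate of \<open>\<phi>\<close>.\<close>

lemma covering_number_left_translate:
  assumes f: "f \<in> C00_plus" and \<phi>: "\<phi> \<in> C00_inv" "\<phi> \<noteq> (\<lambda>x. 0)"
  shows "covering_number (\<lambda>x. f (b \<cdot> x)) \<phi> = covering_number f \<phi>"
proof (rule antisym; rule field_le_epsilon)
  fix \<epsilon> :: real assume \<epsilon>: "0 < \<epsilon>"
  obtain m :: nat and a c where 1: "\<forall>j\<in>{1..m}. 0 < c j" "\<forall>x. f x \<le> (\<Sum>j=1..m. c j * \<phi> (a j \<cdot> x))"
      "(\<Sum>j=1..m. c j) < covering_number f \<phi> + \<epsilon>"
    using covering_number_approx[OF f C00_invD(1)[OF \<phi>(1)] \<phi>(2) \<epsilon>] by blast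
  have "covering_number (\<lambda>x. f (b \<cdot> x)) \<phi> \<le> (\<Sum>j=1..m. c j)"
    by (rule covering_number_le[where b="\<lambda>j. a j \<cdot> b"])
       (use 1 in \<open>auto simp: C00_inv_nonneg[OF \<phi>(1)] C00_invD(4)[OF \<phi>(1)] intro: less_imp_le\<close>)
  with 1 show "covering_number (\<lambda>x. f (b \<cdot> x)) \<phi> \<le> covering_number f \<phi> + \<epsilon>" by linarith
next
  fix \<epsilon> :: real assume \<epsilon>: "0 < \<epsilon>"
  obtain m :: nat and a c where 1: "\<forall>j\<in>{1..m}. 0 < c j" "\<forall>x. f (b \<cdot> x) \<le> (\<Sum>j=1..m. c j * \<phi> (a j \<cdot> x))"
      "(\<Sum>j=1..m. c j) < covering_number (\<lambda>x. f (b \<cdot> x)) \<phi> + \<epsilon>"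
    using covering_number_approx[OF C00_plus_left_translate[OF f] C00_invD(1)[OF \<phi>(1)] \<phi>(2) \<epsilon>] by blast
  have "covering_number f \<phi> \<le> (\<Sum>j=1..m. c j)"
  proof (rule covering_number_le[where b="\<lambda>j. rdiv (a j) b"])
    fix x
    have "\<phi> (rdiv (a j) b \<cdot> x) = \<phi> (a j \<cdot> ldiv b x)" for j
      using C00_invD(4)[OF \<phi>(1), of "rdiv (a j) b" b "ldiv b x"] by simp
    with spec[OF 1(2), of "ldiv b x"] show "f x \<le> (\<Sum>j=1..m. c j * \<phi> (rdiv (a j) b \<cdot> x))" by simp
  qed (use 1 in \<open>auto simp: C00_inv_nonneg[OF \<phi>(1)] intro: less_imp_le\<close>)
  with 1 show "covering_number f \<phi> \<le> covering_number (\<lambda>x. f (b \<cdot> x)) \<phi> + \<epsilon>" by linarith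
qed

lemma covering_number_chain:
  assumes f: "f \<in> C00_plus" and h: "h \<in> C00_plus" "h \<noteq> (\<lambda>x. 0)" and \<phi>: "\<phi> \<in> C00_inv" "\<phi> \<noteq> (\<lambda>x. 0)"
  shows "covering_number f \<phi> \<le> covering_number f h * covering_number h \<phi>"
proof (rule field_le_epsilon)
  fix \<epsilon> :: real assume \<epsilon>: "0 < \<epsilon>"
  have pos: "0 < covering_number h \<phi>" using h \<phi> C00_invD(1) by (intro covering_number_pos) auto
  then have "0 < \<epsilon> / covering_number h \<phi>" using \<epsilon> by simp
  from covering_number_approx[OF f h this] obtain m :: nat and b c where
    1: "\<forall>j\<in>{1..m}. 0 < c j" "\<forall>x. f x \<le> (\<Sum>j=1..m. c j * h (b j \<cdot> x))"
      "(\<Sum>j=1..m. c j) < covering_number f h + \<epsilon> / covering_number h \<phi>"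
    by blast
  have "covering_number f \<phi> \<le> (\<Sum>j=1..m. c j * covering_number (\<lambda>x. h (b j \<cdot> x)) \<phi>)"
    by (rule covering_number_combination)
       (use 1 h \<phi> C00_invD(1) in \<open>auto intro: less_imp_le C00_plus_left_translate\<close>)
  also have "\<dots> = (\<Sum>j=1..m. c j) * covering_number h \<phi>"
    using h \<phi> by (simp add: covering_number_left_translate sum_distrib_right)
  also have "\<dots> \<le> (covering_number f h + \<epsilon> / covering_number h \<phi>) * covering_number h \<phi>"
    using 1(3) pos by (intro mult_right_mono) auto
  also have "\<dots> = covering_number f h * covering_number h \<phi> + \<epsilon>"
    using pos by (simp add: field_simps)
  finally show "covering_number f \<phi> \<le> covering_number f h * covering_number h \<phi> + \<epsilon>" .
qed

text \<open>A scaled sum of translates of \<open>f0\<close> is a plateau over the compact set.\<close>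

lemma C00_inv_dominating:
  assumes f0: "f0 \<in> C00_inv" "f0 \<noteq> (\<lambda>x. 0)" and K: "compact K"
  shows "\<exists>q\<in>C00_inv. \<forall>x\<in>K. 1 \<le> q x"
proof -
  obtain B c where B: "finite B" "0 < c" "\<forall>x\<in>K. 1 \<le> (\<Sum>b\<in>B. c * f0 (b \<cdot> x))"
    using compact_covering[OF C00_invD(1)[OF f0(1)] f0(2) K] by blast
  have "(\<lambda>x. \<Sum>b\<in>B. c * f0 (b \<cdot> x)) \<in> C00_inv"
    using B f0 by (intro C00_inv_sum C00_inv_scale C00_inv_left_translate) auto
  with B show ?thesis by (intro bexI[of _ "\<lambda>x. \<Sum>b\<in>B. c * f0 (b \<cdot> x)"]) auto
qed

end

section \<open>The invariant functional on the quotient group\<close>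

text \<open>Tychonoff's theorem for the topology of pointwise convergence.\<close>

lemma compact_box_of_functions:
  fixes B :: "'i \<Rightarrow> real"
  shows "compact {L. \<forall>i. L i \<in> {0..B i}}"
proof -
  have "compactin (product_topology (\<lambda>i::'i. euclidean) UNIV) (PiE UNIV (\<lambda>i. {0..B i}))"
    by (subst compactin_PiE) simp
  moreover have "PiE UNIV (\<lambda>i. {0..B i}) = {L. \<forall>i. L i \<in> {0..B i}}" by (auto simp: PiE_def Pi_def)
  ultimately show ?thesis by (simp add: euclidean_product_topology)
qed

context compact_by_group_loop
begin

text \<open>A covering of \<open>f1 + f2\<close> by translates of \<open>\<phi>\<close> splits into coverings of \<open>f1\<close> and \<open>f2\<close>: multiply it by the
fractions \<open>k f1\<close> and \<open>k f2\<close> that the two functions contribute to the sum. On the support of one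
translate these fractions are nearly constant, so up to \<open>\<delta>\<close> they may be moved into the coefficients.
To keep the fractions continuous a small multiple of a plateau \<open>q\<close> is added to the sum; the
constants \<open>\<eta>\<close> and \<open>\<delta>\<close> make the total error at most \<open>\<epsilon> (f0 : \<phi>)\<close>.\<close>

lemma covering_number_almost_additive:
  assumes f0: "f0 \<in> C00_inv" "f0 \<noteq> (\<lambda>x. 0)" and f1: "f1 \<in> C00_inv" and f2: "f2 \<in> C00_inv" and \<epsilon>: "0 < \<epsilon>"
  shows "\<exists>W. open W \<and> N \<subseteq> W \<and> (\<forall>\<phi>\<in>C00_inv. \<phi> \<noteq> (\<lambda>x. 0) \<longrightarrow> (\<forall>x. \<phi> x \<noteq> 0 \<longrightarrow> x \<in> W) \<longrightarrow>
    covering_number f1 \<phi> + covering_number f2 \<phi>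
      \<le> covering_number (\<lambda>x. f1 x + f2 x) \<phi> + \<epsilon> * covering_number f0 \<phi>)"
proof -
  define s where "s x = f1 x + f2 x" for x
  have s: "s \<in> C00_inv" unfolding s_def[abs_def] by (rule C00_inv_add[OF f1 f2])
  obtain K where K: "compact K" "\<And>x. s x \<noteq> 0 \<Longrightarrow> x \<in> K" using C00_plus_support[OF C00_invD(1)[OF s]] by blast
  obtain q where q: "q \<in> C00_inv" "\<And>x. x \<in> K \<Longrightarrow> 1 \<le> q x" using C00_inv_dominating[OF f0 K(1)] by blast
  define A where "A = covering_number s f0"
  define B where "B = covering_number q f0"
  have AB: "0 \<le> A" "0 \<le> B" using s q f0 C00_invD(1) by (auto simp: A_def B_def intro!: covering_number_nonneg)
  define \<eta> where "\<eta> = \<epsilon> / (2 * (B + 1))"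
  have \<eta>: "0 < \<eta>" using \<epsilon> AB by (simp add: \<eta>_def)
  have "\<eta> * B \<le> \<eta> * (B + 1)" using \<eta> by simp
  also have "\<dots> = \<epsilon> / 2" using AB by (simp add: \<eta>_def field_simps)
  finally have \<eta>B: "\<eta> * B \<le> \<epsilon> / 2" .
  define D where "D = A + \<eta> * B"
  have D: "0 \<le> D" using AB \<eta> by (simp add: D_def)
  define \<delta> where "\<delta> = \<epsilon> / (4 * (D + 1))"
  have \<delta>: "0 < \<delta>" using \<epsilon> D by (simp add: \<delta>_def)
  have "2 * \<delta> * D \<le> 2 * \<delta> * (D + 1)" using \<delta> by simp
  also have "\<dots> = \<epsilon> / 2" using D by (simp add: \<delta>_def field_simps)
  finally have \<delta>D: "2 * \<delta> * D \<le> \<epsilon> / 2" .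
  define h where "h x = s x + \<eta> * q x" for x
  have h: "h \<in> C00_inv" unfolding h_def[abs_def] using s q \<eta> by (intro C00_inv_add C00_inv_scale) auto
  \<comment> \<open>the maximum with \<open>\<eta>\<close> equals \<open>h\<close> wherever \<open>f1\<close> or \<open>f2\<close> is nonzero, and avoids division by zero\<close>
  define k where "k f x = f x * (1 / max (h x) \<eta>)" for f x
  have max_pos: "0 < max (h x) \<eta>" for x using \<eta> by simp
  have k: "k f \<in> C00_inv" if f: "f \<in> C00_inv" for f
  proof -
    have "continuous_on UNIV (\<lambda>x. 1 / max (h x) \<eta>)"
      using max_pos C00_plus_cont[OF C00_invD(1)[OF h]]
      by (intro continuous_on_divide continuous_on_max continuous_on_const) (auto simp: less_le)
    then have "k f \<in> C00_plus"
      unfolding k_def[abs_def] using max_pos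
      by (intro C00_plus_mult C00_invD(1)[OF f]) (auto simp: less_imp_le)
    then show ?thesis using C00_invD(2)[OF f] C00_invD(2)[OF h] by (simp add: C00_inv_def k_def)
  qed
  have uniform: "\<exists>W. open W \<and> N \<subseteq> W \<and> (\<forall>x y. linv y \<cdot> x \<in> W \<longrightarrow> \<bar>k f x - k f y\<bar> < \<delta>)"
    if "f \<in> C00_inv" for f
    using k[OF that] by (intro uniformly_continuous_loop compact_N \<delta> C00_inv_linv_mult[OF k[OF that]] C00_invD(1))
  obtain W1 where W1: "open W1" "N \<subseteq> W1" "\<And>x y. linv y \<cdot> x \<in> W1 \<Longrightarrow> \<bar>k f1 x - k f1 y\<bar> < \<delta>"
    using uniform[OF f1] by blast
  obtain W2 where W2: "open W2" "N \<subseteq> W2" "\<And>x y. linv y \<cdot> x \<in> W2 \<Longrightarrow> \<bar>k f2 x - k f2 y\<bar> < \<delta>"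
    using uniform[OF f2] by blast
  have main: "covering_number f1 \<phi> + covering_number f2 \<phi> \<le> covering_number s \<phi> + \<epsilon> * covering_number f0 \<phi>"
    if \<phi>: "\<phi> \<in> C00_inv" "\<phi> \<noteq> (\<lambda>x. 0)" and supp: "\<And>x. \<phi> x \<noteq> 0 \<Longrightarrow> x \<in> W1 \<inter> W2" for \<phi>
  proof -
    note \<phi>C = C00_invD(1)[OF \<phi>(1)]
    have fk: "f x = k f x * h x" if "\<And>y. 0 \<le> f y \<and> f y \<le> s y" for f x
    proof (cases "f x = 0")
      case False
      with that[of x] have sx: "0 < s x" by linarith
      then have "1 \<le> q x" using q(2) K(2) by (metis less_irrefl)
      then have "\<eta> \<le> h x" using sx \<eta> by (simp add: h_def add_increasing)
      then show ?thesis using \<eta> by (simp add: k_def)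
    qed (simp add: k_def)
    have part: "covering_number f \<phi> \<le> (\<Sum>j=1..m. c j * (k f (rinv (b j)) + \<delta>))"
      if f: "f \<in> C00_inv" "\<And>y. 0 \<le> f y \<and> f y \<le> s y"
        and near: "\<And>x y. linv y \<cdot> x \<in> W1 \<inter> W2 \<Longrightarrow> \<bar>k f x - k f y\<bar> < \<delta>"
        and cover: "\<forall>j\<in>{1..m}. 0 < c j" "\<forall>x. h x \<le> (\<Sum>j=1..m. c j * \<phi> (b j \<cdot> x))" for f b c and m :: nat
    proof (rule covering_number_le[where b=b])
      fix x
      have kx: "0 \<le> k f x" by (rule C00_inv_nonneg[OF k[OF f(1)]])
      have "f x = k f x * h x" using fk f(2) .
      also have "\<dots> \<le> k f x * (\<Sum>j=1..m. c j * \<phi> (b j \<cdot> x))"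
        using cover(2) kx by (intro mult_left_mono) auto
      also have "\<dots> = (\<Sum>j=1..m. c j * \<phi> (b j \<cdot> x) * k f x)"
        by (simp add: sum_distrib_left mult.commute)
      also have "\<dots> \<le> (\<Sum>j=1..m. c j * \<phi> (b j \<cdot> x) * (k f (rinv (b j)) + \<delta>))"
      proof (rule sum_mono)
        fix j assume j: "j \<in> {1..m}"
        show "c j * \<phi> (b j \<cdot> x) * k f x \<le> c j * \<phi> (b j \<cdot> x) * (k f (rinv (b j)) + \<delta>)"
        proof (cases "\<phi> (b j \<cdot> x) = 0")
          case False
          then have "\<bar>k f x - k f (rinv (b j))\<bar> < \<delta>" using supp by (intro near) simp
          then have le: "k f x \<le> k f (rinv (b j)) + \<delta>" by linarith
          show ?thesis
            by (intro mult_left_mono le mult_nonneg_nonneg C00_inv_nonneg[OF \<phi>(1)]) (use cover j in \<open>auto intro: less_imp_le\<close>)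
        qed simp
      qed
      finally show "f x \<le> (\<Sum>j=1..m. c j * (k f (rinv (b j)) + \<delta>) * \<phi> (b j \<cdot> x))"
        by (simp add: mult_ac)
    next
      fix j assume "j \<in> {1..m}"
      then show "0 \<le> c j * (k f (rinv (b j)) + \<delta>)"
        using cover(1) C00_inv_nonneg[OF k[OF f(1)], of "rinv (b j)"] \<delta> by (intro mult_nonneg_nonneg) (auto intro: less_imp_le)
    qed (simp_all add: C00_inv_nonneg[OF \<phi>(1)])
    have sum_k: "k f1 y + k f2 y \<le> 1" for y
    proof -
      have "s y \<le> max (h y) \<eta>" using C00_inv_nonneg[OF q(1), of y] \<eta> by (simp add: h_def le_max_iff_disj)
      then show ?thesis using max_pos[of y] by (simp add: k_def s_def add_divide_distrib[symmetric])
    qed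
    have "covering_number f1 \<phi> + covering_number f2 \<phi> \<le> (1 + 2 * \<delta>) * covering_number h \<phi>"
    proof (rule field_le_epsilon)
      fix \<epsilon>' :: real assume \<epsilon>': "0 < \<epsilon>'"
      then have "0 < \<epsilon>' / (1 + 2 * \<delta>)" using \<delta> by simp
      from covering_number_approx[OF C00_invD(1)[OF h] \<phi>C \<phi>(2) this] obtain m :: nat and b c where
        1: "\<forall>j\<in>{1..m}. 0 < c j" "\<forall>x. h x \<le> (\<Sum>j=1..m. c j * \<phi> (b j \<cdot> x))"
        "(\<Sum>j=1..m. c j) < covering_number h \<phi> + \<epsilon>' / (1 + 2 * \<delta>)"
        by blast
      have "covering_number f1 \<phi> \<le> (\<Sum>j=1..m. c j * (k f1 (rinv (b j)) + \<delta>))"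
        by (rule part[OF f1 _ _ 1(1,2)])
           (use W1(3) C00_inv_nonneg[OF f1] C00_inv_nonneg[OF f2] in \<open>auto simp: s_def\<close>)
      moreover have "covering_number f2 \<phi> \<le> (\<Sum>j=1..m. c j * (k f2 (rinv (b j)) + \<delta>))"
        by (rule part[OF f2 _ _ 1(1,2)])
           (use W2(3) C00_inv_nonneg[OF f1] C00_inv_nonneg[OF f2] in \<open>auto simp: s_def\<close>)
      ultimately have "covering_number f1 \<phi> + covering_number f2 \<phi>
          \<le> (\<Sum>j=1..m. c j * ((k f1 (rinv (b j)) + k f2 (rinv (b j))) + 2 * \<delta>))"
        by (simp add: sum.distrib distrib_left sum_distrib_right[symmetric])
      also have "\<dots> \<le> (\<Sum>j=1..m. c j * (1 + 2 * \<delta>))"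
        using sum_k 1(1) by (intro sum_mono mult_left_mono add_right_mono) (auto intro: less_imp_le)
      also have "\<dots> \<le> (covering_number h \<phi> + \<epsilon>' / (1 + 2 * \<delta>)) * (1 + 2 * \<delta>)"
        unfolding sum_distrib_right[symmetric] using 1(3) \<delta> by (intro mult_right_mono) auto
      also have "\<dots> = (1 + 2 * \<delta>) * covering_number h \<phi> + \<epsilon>'"
      proof -
        have "(x + y / z) * z = z * x + y" if "z \<noteq> 0" for x y z :: real
          using that by (simp add: field_simps)
        moreover have "1 + 2 * \<delta> \<noteq> 0" using \<delta> by simp
        ultimately show ?thesis by blast
      qed
      finally show "covering_number f1 \<phi> + covering_number f2 \<phi> \<le> (1 + 2 * \<delta>) * covering_number h \<phi> + \<epsilon>'" .
    qed
    moreover have "covering_number h \<phi> \<le> covering_number s \<phi> + \<eta> * covering_number q \<phi>"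
    proof -
      have "covering_number h \<phi> \<le> covering_number s \<phi> + covering_number (\<lambda>x. \<eta> * q x) \<phi>"
        unfolding h_def[abs_def] using s q \<eta> \<phi>C \<phi>(2)
        by (intro covering_number_add C00_plus_scale) (auto intro: C00_invD(1))
      then show ?thesis using \<eta> covering_number_scale[OF C00_invD(1)[OF q(1)] \<phi>C \<phi>(2), of \<eta>] by simp
    qed
    moreover have sA: "covering_number s \<phi> \<le> A * covering_number f0 \<phi>"
      unfolding A_def by (intro covering_number_chain \<phi> f0 C00_invD(1) s)
    moreover have "covering_number q \<phi> \<le> B * covering_number f0 \<phi>"
      unfolding B_def by (intro covering_number_chain \<phi> f0 C00_invD(1) q)
    ultimately show ?thesis
    proof -
      assume 1: "covering_number f1 \<phi> + covering_number f2 \<phi> \<le> (1 + 2 * \<delta>) * covering_number h \<phi>"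
        and 2: "covering_number h \<phi> \<le> covering_number s \<phi> + \<eta> * covering_number q \<phi>"
        and qB: "covering_number q \<phi> \<le> B * covering_number f0 \<phi>"
      let ?k = "covering_number f0 \<phi>"
      have k0: "0 \<le> ?k" using f0 \<phi> C00_invD(1) by (intro covering_number_nonneg) auto
      have "\<eta> * covering_number q \<phi> \<le> (\<eta> * B) * ?k"
        using mult_left_mono[OF qB, of \<eta>] \<eta> by (simp add: mult.assoc)
      then have 3: "covering_number h \<phi> \<le> covering_number s \<phi> + (\<eta> * B) * ?k" using 2 by linarith
      then have "covering_number h \<phi> \<le> D * ?k" using sA by (simp add: D_def distrib_right)
      then have "2 * \<delta> * covering_number h \<phi> \<le> (2 * \<delta> * D) * ?k"
        using mult_left_mono[of "covering_number h \<phi>" "D * ?k" "2 * \<delta>"] \<delta> by (simp add: mult.assoc)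
      also have "\<dots> \<le> (\<epsilon> / 2) * ?k" using \<delta>D k0 by (rule mult_right_mono)
      finally have 4: "2 * \<delta> * covering_number h \<phi> \<le> (\<epsilon> / 2) * ?k" .
      have "(\<eta> * B) * ?k \<le> (\<epsilon> / 2) * ?k" using \<eta>B k0 by (rule mult_right_mono)
      with 1 3 4 show ?thesis by (simp add: distrib_right)
    qed
  qed
  show ?thesis
    by (rule exI[of _ "W1 \<inter> W2"]) (use W1(1,2) W2(1,2) main in \<open>auto simp: s_def[abs_def]\<close>)
qed

end

locale invariant_functional = compact_by_group_loop mult N
  for mult :: "'a::t1_space \<Rightarrow> 'a \<Rightarrow> 'a"  (infixl "\<cdot>" 70) and N +
  fixes \<Lambda> :: "('a \<Rightarrow> real) \<Rightarrow> real" and f0 :: "'a \<Rightarrow> real"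
  assumes \<Lambda>_nonneg: "f \<in> C00_inv \<Longrightarrow> 0 \<le> \<Lambda> f"
    and \<Lambda>_add: "f \<in> C00_inv \<Longrightarrow> g \<in> C00_inv \<Longrightarrow> \<Lambda> (\<lambda>x. f x + g x) = \<Lambda> f + \<Lambda> g"
    and \<Lambda>_scale: "f \<in> C00_inv \<Longrightarrow> 0 \<le> \<alpha> \<Longrightarrow> \<Lambda> (\<lambda>x. \<alpha> * f x) = \<alpha> * \<Lambda> f"
    and \<Lambda>_left_translate: "f \<in> C00_inv \<Longrightarrow> \<Lambda> (\<lambda>x. f (b \<cdot> x)) = \<Lambda> f"
    and f0: "f0 \<in> C00_inv" and \<Lambda>_f0: "\<Lambda> f0 = 1"

context compact_by_group_loop
begin

text \<open>For \<open>N\<close>-invariant \<open>\<phi>\<close> supported near \<open>N\<close> the ratios \<open>(f : \<phi>) / (f0 : \<phi>)\<close> lie in a compact box, by the chain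
inequality, and satisfy the required identities exactly, except additivity, which holds up to an error
tending to \<open>0\<close>. A cluster point along shrinking neighbourhoods of \<open>N\<close> satisfies all of them.\<close>

lemma invariant_functional_exists:
  assumes f0: "f0 \<in> C00_inv" "f0 \<noteq> (\<lambda>x. 0)"
  shows "\<exists>\<Lambda>. invariant_functional (\<cdot>) N \<Lambda> f0"
proof -
  define \<Phi> where "\<Phi> W = {\<phi> \<in> C00_inv. \<phi> \<noteq> (\<lambda>x. 0) \<and> (\<forall>x. \<phi> x \<noteq> 0 \<longrightarrow> x \<in> W)}" for W
  \<comment> \<open>the value \<open>0\<close> outside \<open>C00_inv\<close> only serves to stay inside the box\<close>
  define I where "I \<phi> f = (if f \<in> C00_inv then covering_number f \<phi> / covering_number f0 \<phi> else 0)" for \<phi> f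
  define \<W> where "\<W> = {W. open W \<and> N \<subseteq> W}"
  let ?box = "{L. \<forall>f. L f \<in> {0..(if f \<in> C00_inv then covering_number f f0 else 0)}}"
  have \<Phi>D: "\<phi> \<in> C00_inv" "\<phi> \<in> C00_plus" "\<phi> \<noteq> (\<lambda>x. 0)" "0 < covering_number f0 \<phi>" if "\<phi> \<in> \<Phi> W" for \<phi> W
    using that f0 by (auto simp: \<Phi>_def C00_invD(1) intro!: covering_number_pos)
  have box: "I \<phi> \<in> ?box" if "\<phi> \<in> \<Phi> W" for \<phi> W
  proof -
    have "covering_number f \<phi> / covering_number f0 \<phi> \<le> covering_number f f0" if "f \<in> C00_inv" for f
      using covering_number_chain[OF C00_invD(1)[OF that] C00_invD(1)[OF f0(1)] f0(2) \<Phi>D(1,3)[OF \<open>\<phi> \<in> \<Phi> W\<close>]]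
        \<Phi>D(4)[OF \<open>\<phi> \<in> \<Phi> W\<close>] by (simp add: divide_le_eq)
    moreover have "0 \<le> covering_number f \<phi> / covering_number f0 \<phi>" if "f \<in> C00_inv" for f
      using covering_number_nonneg[OF C00_invD(1)[OF that] \<Phi>D(2,3)[OF \<open>\<phi> \<in> \<Phi> W\<close>]]
        \<Phi>D(4)[OF \<open>\<phi> \<in> \<Phi> W\<close>] by simp
    ultimately show ?thesis by (simp add: I_def)
  qed
  have "?box \<inter> (\<Inter>W\<in>\<W>. closure (I ` \<Phi> W)) \<noteq> {}"
  proof (rule compact_imp_fip_image[OF compact_box_of_functions])
    fix \<F> assume \<F>: "finite \<F>" "\<F> \<subseteq> \<W>"
    then have "open (\<Inter>\<F>)" "N \<subseteq> \<Inter>\<F>" by (auto simp: \<W>_def intro!: open_Inter)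
    then obtain \<phi> where \<phi>: "\<phi> \<in> \<Phi> (\<Inter>\<F>)" using C00_inv_small_support_exists unfolding \<Phi>_def by blast
    have "I \<phi> \<in> closure (I ` \<Phi> W)" if "W \<in> \<F>" for W
      using \<phi> that by (intro subsetD[OF closure_subset] imageI) (auto simp: \<Phi>_def)
    with box[OF \<phi>] show "?box \<inter> (\<Inter>W\<in>\<F>. closure (I ` \<Phi> W)) \<noteq> {}" by blast
  qed simp
  then obtain L where L: "L \<in> ?box" "\<And>W. W \<in> \<W> \<Longrightarrow> L \<in> closure (I ` \<Phi> W)" by blast
  \<comment> \<open>closed conditions that hold for all ratios with small support pass to \<open>L\<close>\<close>
  have limit: "L \<in> X" if "closed X" "W \<in> \<W>" "\<And>\<phi>. \<phi> \<in> \<Phi> W \<Longrightarrow> I \<phi> \<in> X" for X W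
    using L(2)[OF that(2)] closure_minimal[of "I ` \<Phi> W" X] that(1,3) by blast
  have UNIV_W: "UNIV \<in> \<W>" by (simp add: \<W>_def)
  have ev: "continuous_on UNIV (\<lambda>L::('a \<Rightarrow> real) \<Rightarrow> real. L f)" for f
    by (rule continuous_on_product_coordinates)
  have "L \<in> {L. L f0 = 1}"
  proof (rule limit[OF _ UNIV_W])
    show "closed {L. L f0 = (1::real)}" by (intro closed_Collect_eq ev continuous_on_const)
    show "I \<phi> \<in> {L. L f0 = 1}" if "\<phi> \<in> \<Phi> UNIV" for \<phi> using \<Phi>D(4)[OF that] f0 by (simp add: I_def)
  qed
  moreover have "0 \<le> L f" for f
  proof -
    have "L f \<in> {0..(if f \<in> C00_inv then covering_number f f0 else 0)}" using L(1) by blast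
    then show ?thesis by simp
  qed
  moreover have "L (\<lambda>x. f x + g x) = L f + L g" if f: "f \<in> C00_inv" and g: "g \<in> C00_inv" for f g
  proof -
    note fg = C00_inv_add[OF f g]
    have "L \<in> {L. L (\<lambda>x. f x + g x) \<le> L f + L g}"
    proof (rule limit[OF _ UNIV_W])
      show "closed {L. L (\<lambda>x. f x + g x) \<le> L f + (L g :: real)}" by (intro closed_Collect_le ev continuous_on_add)
      show "I \<phi> \<in> {L. L (\<lambda>x. f x + g x) \<le> L f + L g}" if "\<phi> \<in> \<Phi> UNIV" for \<phi>
        using covering_number_add[OF C00_invD(1)[OF f] C00_invD(1)[OF g] \<Phi>D(2,3)[OF that]] \<Phi>D(4)[OF that] f g fg
        by (simp add: I_def add_divide_distrib[symmetric] divide_right_mono)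
    qed
    moreover have "L f + L g \<le> L (\<lambda>x. f x + g x) + \<epsilon>" if \<epsilon>: "0 < \<epsilon>" for \<epsilon>
    proof -
      obtain W where W: "W \<in> \<W>" "\<And>\<phi>. \<phi> \<in> \<Phi> W \<Longrightarrow> covering_number f \<phi> + covering_number g \<phi>
          \<le> covering_number (\<lambda>x. f x + g x) \<phi> + \<epsilon> * covering_number f0 \<phi>"
        using covering_number_almost_additive[OF f0 f g \<epsilon>] unfolding \<W>_def \<Phi>_def by blast
      have "L \<in> {L. L f + L g \<le> L (\<lambda>x. f x + g x) + \<epsilon>}"
      proof (rule limit[OF _ W(1)])
        show "closed {L. L f + L g \<le> L (\<lambda>x. f x + g x) + \<epsilon>}"
          by (intro closed_Collect_le ev continuous_on_add continuous_on_const)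
        fix \<phi> assume \<phi>: "\<phi> \<in> \<Phi> W"
        have "(covering_number f \<phi> + covering_number g \<phi>) / covering_number f0 \<phi>
            \<le> (covering_number (\<lambda>x. f x + g x) \<phi> + \<epsilon> * covering_number f0 \<phi>) / covering_number f0 \<phi>"
          using W(2)[OF \<phi>] \<Phi>D(4)[OF \<phi>] by (intro divide_right_mono) auto
        also have "\<dots> = covering_number (\<lambda>x. f x + g x) \<phi> / covering_number f0 \<phi> + \<epsilon>"
          using \<Phi>D(4)[OF \<phi>] by (simp add: add_divide_distrib)
        finally show "I \<phi> \<in> {L. L f + L g \<le> L (\<lambda>x. f x + g x) + \<epsilon>}"
          using f g fg by (simp add: I_def add_divide_distrib)
      qed
      then show ?thesis by simp
    qed
    then have "L f + L g \<le> L (\<lambda>x. f x + g x)" by (rule field_le_epsilon)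
    ultimately show ?thesis by simp
  qed
  moreover have "L (\<lambda>x. \<alpha> * f x) = \<alpha> * L f" if f: "f \<in> C00_inv" and \<alpha>: "0 \<le> \<alpha>" for f \<alpha>
  proof -
    have "L \<in> {L. L (\<lambda>x. \<alpha> * f x) = \<alpha> * L f}"
    proof (rule limit[OF _ UNIV_W])
      show "closed {L. L (\<lambda>x. \<alpha> * f x) = \<alpha> * (L f :: real)}"
        by (intro closed_Collect_eq ev continuous_on_mult continuous_on_const)
      show "I \<phi> \<in> {L. L (\<lambda>x. \<alpha> * f x) = \<alpha> * L f}" if "\<phi> \<in> \<Phi> UNIV" for \<phi>
        using covering_number_scale[OF C00_invD(1)[OF f] \<Phi>D(2,3)[OF that] \<alpha>] f C00_inv_scale[OF f \<alpha>]
        by (simp add: I_def)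
    qed
    then show ?thesis by simp
  qed
  moreover have "L (\<lambda>x. f (b \<cdot> x)) = L f" if f: "f \<in> C00_inv" for f b
  proof -
    have "L \<in> {L. L (\<lambda>x. f (b \<cdot> x)) = L f}"
    proof (rule limit[OF _ UNIV_W])
      show "closed {L. L (\<lambda>x. f (b \<cdot> x)) = (L f :: real)}"
        by (intro closed_Collect_eq ev)
      show "I \<phi> \<in> {L. L (\<lambda>x. f (b \<cdot> x)) = L f}" if "\<phi> \<in> \<Phi> UNIV" for \<phi>
        using covering_number_left_translate[OF C00_invD(1)[OF f] \<Phi>D(1,3)[OF that]] f C00_inv_left_translate[OF f]
        by (simp add: I_def)
    qed
    then show ?thesis by simp
  qed
  ultimately show ?thesis
    using f0(1) by (intro exI[of _ L] invariant_functional.intro compact_by_group_loop_axioms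
        invariant_functional_axioms.intro) auto
qed

end

section \<open>The Haar functional of the loop\<close>

context invariant_functional
begin

text \<open>Integration over the cosets of \<open>N\<close> followed by integration over \<open>G/N\<close>.\<close>

definition haar :: "('a \<Rightarrow> real) \<Rightarrow> real"
  where "haar f = \<Lambda> (right_average f)"

lemma haar_nonneg: "f \<in> C00_plus \<Longrightarrow> 0 \<le> haar f"
  unfolding haar_def by (intro \<Lambda>_nonneg right_average_inv)

lemma haar_add: "f \<in> C00_plus \<Longrightarrow> g \<in> C00_plus \<Longrightarrow> haar (\<lambda>x. f x + g x) = haar f + haar g"
  by (simp add: haar_def right_average_add \<Lambda>_add right_average_inv)

lemma haar_scale: "f \<in> C00_plus \<Longrightarrow> 0 \<le> \<alpha> \<Longrightarrow> haar (\<lambda>x. \<alpha> * f x) = \<alpha> * haar f"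
  by (simp add: haar_def right_average_scale \<Lambda>_scale right_average_inv)

lemma haar_left_translate: "f \<in> C00_plus \<Longrightarrow> haar (\<lambda>x. f (b \<cdot> x)) = haar f"
  by (simp add: haar_def right_average_left_translate \<Lambda>_left_translate right_average_inv)

lemma haar_f0: "haar f0 = 1"
  by (simp add: haar_def right_average_fixed f0 \<Lambda>_f0)

lemma haar_zero: "haar (\<lambda>x. 0) = 0"
  using haar_scale[OF C00_plus_zero, of 0] by simp

lemma f0_nonzero: "f0 \<noteq> (\<lambda>x. 0)"
  using haar_f0 haar_zero by auto

lemma haar_sum:
  assumes "finite J" "\<And>j. j \<in> J \<Longrightarrow> f j \<in> C00_plus"
  shows "haar (\<lambda>x. \<Sum>j\<in>J. f j x) = (\<Sum>j\<in>J. haar (f j))"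
  using assms by induction (simp_all add: haar_zero haar_add C00_plus_sum)

lemma haar_mono:
  assumes f: "f \<in> C00_plus" and g: "g \<in> C00_plus" and le: "\<And>x. f x \<le> g x"
  shows "haar f \<le> haar g"
proof -
  obtain K where K: "compact K" "\<And>x. g x \<noteq> 0 \<Longrightarrow> x \<in> K" using C00_plus_support[OF g] by blast
  have d: "(\<lambda>x. g x - f x) \<in> C00_plus"
  proof (rule C00_plusI[OF _ _ K(1)])
    show "continuous_on UNIV (\<lambda>x. g x - f x)" by (intro continuous_on_diff C00_plus_cont f g)
    show "0 \<le> g x - f x" for x using le[of x] by simp
    show "x \<in> K" if "g x - f x \<noteq> 0" for x
      using K(2)[of x] that le[of x] C00_plus_nonneg[OF f, of x] by fastforce
  qed
  have "haar g = haar (\<lambda>x. f x + (g x - f x))" by simp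
  also have "\<dots> = haar f + haar (\<lambda>x. g x - f x)" by (rule haar_add[OF f d])
  finally show ?thesis using haar_nonneg[OF d] by simp
qed

text \<open>Integrate a nearly optimal covering; all translates of \<open>\<phi>\<close> have the same integral.\<close>

lemma haar_le_covering_number:
  assumes f: "f \<in> C00_plus" and \<phi>: "\<phi> \<in> C00_plus" "\<phi> \<noteq> (\<lambda>x. 0)"
  shows "haar f \<le> covering_number f \<phi> * haar \<phi>"
proof (rule field_le_epsilon)
  fix \<epsilon> :: real assume \<epsilon>: "0 < \<epsilon>"
  have pos: "0 < haar \<phi> + 1" using haar_nonneg[OF \<phi>(1)] by simp
  then have "0 < \<epsilon> / (haar \<phi> + 1)" using \<epsilon> by simp
  from covering_number_approx[OF f \<phi> this] obtain m :: nat and b c where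
    1: "\<forall>j\<in>{1..m}. 0 < c j" "\<forall>x. f x \<le> (\<Sum>j=1..m. c j * \<phi> (b j \<cdot> x))"
    "(\<Sum>j=1..m. c j) < covering_number f \<phi> + \<epsilon> / (haar \<phi> + 1)"
    by blast
  have \<phi>b: "(\<lambda>x. c j * \<phi> (b j \<cdot> x)) \<in> C00_plus" if "j \<in> {1..m}" for j
    using that 1(1) by (intro C00_plus_scale C00_plus_left_translate \<phi>) (auto intro: less_imp_le)
  have "haar f \<le> haar (\<lambda>x. \<Sum>j=1..m. c j * \<phi> (b j \<cdot> x))"
    using 1(2) by (intro haar_mono f C00_plus_sum \<phi>b) auto
  also have "\<dots> = (\<Sum>j=1..m. haar (\<lambda>x. c j * \<phi> (b j \<cdot> x)))"
    by (intro haar_sum \<phi>b) auto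
  also have "\<dots> = (\<Sum>j=1..m. c j * haar \<phi>)"
    using 1(1) \<phi>(1) by (intro sum.cong) (auto simp: haar_scale haar_left_translate C00_plus_left_translate less_imp_le)
  also have "\<dots> \<le> (covering_number f \<phi> + \<epsilon> / (haar \<phi> + 1)) * haar \<phi>"
    unfolding sum_distrib_right[symmetric] using 1(3) haar_nonneg[OF \<phi>(1)] by (intro mult_right_mono) auto
  also have "\<dots> \<le> covering_number f \<phi> * haar \<phi> + \<epsilon>"
  proof -
    have "\<epsilon> / (haar \<phi> + 1) * haar \<phi> \<le> \<epsilon> / (haar \<phi> + 1) * (haar \<phi> + 1)"
      using \<epsilon> pos by (intro mult_left_mono) auto
    also have "\<dots> = \<epsilon>" using pos by simp
    finally show ?thesis by (simp add: distrib_right)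
  qed
  finally show "haar f \<le> covering_number f \<phi> * haar \<phi> + \<epsilon>" .
qed

text \<open>A nonzero \<open>\<phi>\<close> covers \<open>f0\<close>, whose integral is 1.\<close>

lemma haar_pos:
  assumes \<phi>: "\<phi> \<in> C00_plus" "\<phi> \<noteq> (\<lambda>x. 0)"
  shows "0 < haar \<phi>"
proof -
  have "1 \<le> covering_number f0 \<phi> * haar \<phi>"
    using haar_le_covering_number[OF C00_invD(1)[OF f0] \<phi>] by (simp add: haar_f0)
  then have "haar \<phi> \<noteq> 0" by auto
  with haar_nonneg[OF \<phi>(1)] show ?thesis by simp
qed

lemma linv_mult_N: "\<gamma> \<in> N \<Longrightarrow> linv (y \<cdot> \<gamma>) = linv \<gamma> \<cdot> linv y"
proof -
  assume \<gamma>: "\<gamma> \<in> N"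
  have "(linv \<gamma> \<cdot> linv y) \<cdot> (y \<cdot> \<gamma>) = linv \<gamma> \<cdot> (linv y \<cdot> (y \<cdot> \<gamma>))"
    by (rule N_assoc(1)[OF N_closed(3)[OF \<gamma>]])
  also have "linv y \<cdot> (y \<cdot> \<gamma>) = \<gamma>" using N_assoc(3)[OF \<gamma>, of "linv y" y] by simp
  finally have "(linv \<gamma> \<cdot> linv y) \<cdot> (y \<cdot> \<gamma>) = linv (y \<cdot> \<gamma>) \<cdot> (y \<cdot> \<gamma>)" by simp
  then show ?thesis by (simp only: right_cancel)
qed

lemma linv_N_mult: "\<gamma> \<in> N \<Longrightarrow> linv (linv \<gamma> \<cdot> b) = linv b \<cdot> \<gamma>"
proof -
  assume \<gamma>: "\<gamma> \<in> N"
  have "(linv b \<cdot> \<gamma>) \<cdot> (linv \<gamma> \<cdot> b) = linv (linv \<gamma> \<cdot> b) \<cdot> (linv \<gamma> \<cdot> b)"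
    by (simp add: N_assoc(2)[OF \<gamma>] N_linv_cancel[OF \<gamma>])
  then show ?thesis by (simp only: right_cancel)
qed

lemma C00_plus_linv:
  assumes "F \<in> C00_plus"
  shows "(\<lambda>y. F (linv y)) \<in> C00_plus" "(\<lambda>y. F (linv y \<cdot> x)) \<in> C00_plus"
proof -
  show "(\<lambda>y. F (linv y)) \<in> C00_plus"
    by (rule C00_plus_pullback[OF assms, of _ rinv]) (intro loop_continuous_intros | simp)+
  show "(\<lambda>y. F (linv y \<cdot> x)) \<in> C00_plus"
    by (rule C00_plus_pullback[OF assms, of _ "\<lambda>s. rinv (rdiv s x)"]) (intro loop_continuous_intros | simp)+
qed

text \<open>Composition with \<open>linv\<close> turns left invariance into right invariance. Passing to coset averages
replaces \<open>F\<close> by the \<open>N\<close>-invariant function \<open>left_average F\<close>, for which \<open>linv (x \<cdot> z) \<cdot> x\<close> may be replaced by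
\<open>linv z\<close>; the substitution \<open>y = x \<cdot> z\<close> then removes \<open>x\<close>.\<close>

lemma haar_linv_right_translate:
  assumes F: "F \<in> C00_plus"
  shows "haar (\<lambda>y. F (linv y \<cdot> x)) = haar (\<lambda>y. F (linv y))"
proof -
  have avg: "right_average (\<lambda>y. F (linv y \<cdot> x)) = (\<lambda>y. left_average F (linv y \<cdot> x))" for x
  proof
    fix y
    have "linv (y \<cdot> \<gamma>) \<cdot> x = linv \<gamma> \<cdot> (linv y \<cdot> x)" if "\<gamma> \<in> N" for \<gamma>
      by (simp add: linv_mult_N that N_assoc(1) N_closed(3))
    then show "right_average (\<lambda>y. F (linv y \<cdot> x)) y = left_average F (linv y \<cdot> x)"
      unfolding right_average_def left_average_def
      by (intro N.mean_cong continuous_on_fibre(1)[OF C00_plus_linv(2)[OF F]]) simp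
  qed
  have avg1: "right_average (\<lambda>y. F (linv y)) = (\<lambda>y. left_average F (linv y))"
    using avg[of unit] by simp
  let ?G = "\<lambda>y. left_average F (linv y \<cdot> x)"
  have G: "?G \<in> C00_inv" unfolding avg[symmetric] by (rule right_average_inv[OF C00_plus_linv(2)[OF F]])
  have "?G (x \<cdot> z) = left_average F (linv z)" for z
  proof -
    obtain \<gamma> where \<gamma>: "\<gamma> \<in> N" "(linv (x \<cdot> z) \<cdot> x) \<cdot> z = \<gamma> \<cdot> (linv (x \<cdot> z) \<cdot> (x \<cdot> z))"
      using assoc_mod_N by blast
    then have "(linv (x \<cdot> z) \<cdot> x) \<cdot> z = (\<gamma> \<cdot> linv z) \<cdot> z" by (simp add: N_assoc(1))
    then have "linv (x \<cdot> z) \<cdot> x = \<gamma> \<cdot> linv z" by (simp only: right_cancel)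
    then show ?thesis using C00_invD(2)[OF left_average_inv[OF F] \<gamma>(1)] by simp
  qed
  then have "\<Lambda> ?G = \<Lambda> (\<lambda>z. left_average F (linv z))"
    using \<Lambda>_left_translate[OF G, of x] by simp
  then show ?thesis by (simp add: haar_def avg avg1)
qed

text \<open>In a loop \<open>linv\<close> need not be an involution, but \<open>linv (linv y)\<close> lies in the coset of \<open>y\<close> and
\<open>linv \<circ> linv\<close> commutes with the right action of \<open>N\<close>.\<close>

lemma haar_linv_linv:
  assumes F: "F \<in> C00_plus"
  shows "haar (\<lambda>y. F (linv (linv y))) = haar F"
proof -
  have "right_average (\<lambda>y. F (linv (linv y))) y = right_average F (linv (linv y))" for y
    unfolding right_average_def
    by (intro N.mean_cong continuous_on_fibre(1) C00_plus_linv(1)[of "\<lambda>y. F (linv y)"] C00_plus_linv(1) F)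
       (simp add: linv_mult_N linv_N_mult)
  moreover have "right_average F (linv (linv y)) = right_average F y" for y
    by (rule C00_inv_linv_mult[OF right_average_inv[OF F] mult_linv_in_N])
  ultimately have "right_average (\<lambda>y. F (linv (linv y))) = right_average F" by auto
  then show ?thesis by (simp add: haar_def)
qed

section \<open>Asymptotics of covering numbers\<close>

text \<open>A Riemann sum for the convolution of \<open>w\<close> and \<open>\<phi>\<close>, uniform for \<open>x\<close> in a compact set: on each piece of a
fine partition of unity the kernel is replaced by its value at one point, and the weight of that point is
the integral of the piece of \<open>w\<close>.\<close>

lemma kernel_discretization:
  assumes w: "w \<in> C00_plus" and \<phi>: "\<phi> \<in> C00_plus" and S: "compact S" and \<delta>: "0 < \<delta>"
  shows "\<exists>Y a. finite Y \<and> (\<forall>y\<in>Y. 0 \<le> a y) \<and> (\<Sum>y\<in>Y. a y) = haar w \<and>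
    (\<forall>x\<in>S. haar (\<lambda>y. w y * \<phi> (linv y \<cdot> x)) \<le> (\<Sum>y\<in>Y. a y * \<phi> (linv y \<cdot> x)) + \<delta> * haar w)"
proof -
  have kernel: "continuous_on UNIV (\<lambda>(y, x). \<phi> (linv y \<cdot> x))"
    unfolding case_prod_unfold by (intro C00_plus_comp[OF \<phi>] loop_continuous_intros)
  have "\<exists>X. open X \<and> z \<in> X \<and> (\<forall>y\<in>X \<inter> UNIV. \<forall>x\<in>S. \<bar>\<phi> (linv y \<cdot> x) - \<phi> (linv z \<cdot> x)\<bar> \<le> \<delta>)" for z
    by (rule uniform_on_compact_parameter[OF continuous_on_subset[OF kernel subset_UNIV] S UNIV_I \<delta>])
  then obtain X where X: "\<And>z. open (X z)" "\<And>z. z \<in> X z"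
      "\<And>z y x. y \<in> X z \<Longrightarrow> x \<in> S \<Longrightarrow> \<bar>\<phi> (linv y \<cdot> x) - \<phi> (linv z \<cdot> x)\<bar> \<le> \<delta>"
    by (metis Int_UNIV_right)
  have "\<exists>\<psi>\<in>C00_plus. (\<forall>x\<in>{z}. \<psi> x = 1) \<and> (\<forall>x. x \<notin> X z \<longrightarrow> \<psi> x = 0)" for z
    by (rule C00_plus_bump) (use X in auto)
  then obtain g where g: "\<And>z. g z \<in> C00_plus" "\<And>z. g z z = 1" "\<And>z x. x \<notin> X z \<Longrightarrow> g z x = 0"
    by (metis singletonI)
  obtain K where K: "compact K" "\<And>x. w x \<noteq> 0 \<Longrightarrow> x \<in> K" using C00_plus_support[OF w] by blast
  have "\<exists>Y. finite Y \<and> Y \<subseteq> UNIV \<and> (\<forall>x\<in>K. \<exists>z\<in>Y. x \<in> {y. 1 < 2 * g z y})"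
  proof (rule compact_finite_subcover[OF K(1)])
    show "open {y. 1 < 2 * g z y}" for z
      by (intro open_Collect_less continuous_on_const continuous_on_mult C00_plus_cont g)
    show "\<exists>z\<in>UNIV. x \<in> {y. 1 < 2 * g z y}" for x using g(2) by (intro bexI[of _ x]) auto
  qed
  then obtain Y where Y: "finite Y" "\<forall>x\<in>K. \<exists>z\<in>Y. 1 < 2 * g z x" by auto
  \<comment> \<open>on the support of \<open>w\<close> the sum of the bumps exceeds 1, so dividing by \<open>P\<close> gives a partition of unity there\<close>
  define P where "P y = max 1 (\<Sum>z\<in>Y. 2 * g z y)" for y
  define v where "v z y = w y * (2 * g z y / P y)" for z y
  have P1: "1 \<le> P y" for y by (simp add: P_def)
  have P0: "0 < P y" for y using P1[of y] by simp
  have v: "v z \<in> C00_plus" for z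
    unfolding v_def[abs_def]
  proof (rule C00_plus_mult[OF w])
    show "continuous_on UNIV (\<lambda>y. 2 * g z y / P y)"
      unfolding P_def using P0 unfolding P_def
      by (intro continuous_on_divide continuous_on_max continuous_on_sum continuous_on_mult continuous_on_const
          C00_plus_cont g) (auto simp: less_le)
    show "0 \<le> 2 * g z x / P x" for x
      using C00_plus_nonneg[OF g(1)] P0[of x] by (simp add: less_imp_le)
  qed
  have v_sum: "(\<Sum>z\<in>Y. v z y) = w y" for y
  proof (cases "w y = 0")
    case False
    then obtain z where z: "z \<in> Y" "1 < 2 * g z y" using K(2) Y(2) by blast
    have "2 * g z y \<le> (\<Sum>z\<in>Y. 2 * g z y)"
      using Y(1) z(1) C00_plus_nonneg[OF g(1)] by (intro member_le_sum) auto
    with z have "P y = (\<Sum>z\<in>Y. 2 * g z y)" by (simp add: P_def)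
    then have "(\<Sum>z\<in>Y. 2 * g z y / P y) = 1"
      using P0[of y] by (simp add: sum_divide_distrib[symmetric])
    then show ?thesis unfolding v_def sum_distrib_left[symmetric] by simp
  qed (simp add: v_def)
  have haar_w: "(\<Sum>z\<in>Y. haar (v z)) = haar w"
    using haar_sum[OF Y(1), of v] v by (simp add: v_sum)
  have "haar (\<lambda>y. w y * \<phi> (linv y \<cdot> x)) \<le> (\<Sum>z\<in>Y. haar (v z) * \<phi> (linv z \<cdot> x)) + \<delta> * haar w"
    if x: "x \<in> S" for x
  proof -
    have k: "continuous_on UNIV (\<lambda>y. \<phi> (linv y \<cdot> x))" by (rule C00_plus_cont[OF C00_plus_linv(2)[OF \<phi>]])
    have vk: "(\<lambda>y. v z y * \<phi> (linv y \<cdot> x)) \<in> C00_plus" for z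
      by (intro C00_plus_mult v k C00_plus_nonneg[OF \<phi>])
    have "haar (\<lambda>y. w y * \<phi> (linv y \<cdot> x)) = haar (\<lambda>y. \<Sum>z\<in>Y. v z y * \<phi> (linv y \<cdot> x))"
      by (simp add: sum_distrib_right[symmetric] v_sum)
    also have "\<dots> = (\<Sum>z\<in>Y. haar (\<lambda>y. v z y * \<phi> (linv y \<cdot> x)))"
      by (intro haar_sum Y vk)
    also have "\<dots> \<le> (\<Sum>z\<in>Y. haar (\<lambda>y. (\<phi> (linv z \<cdot> x) + \<delta>) * v z y))"
    proof (intro sum_mono haar_mono vk C00_plus_scale v)
      fix z y
      show "0 \<le> \<phi> (linv z \<cdot> x) + \<delta>" using C00_plus_nonneg[OF \<phi>, of "linv z \<cdot> x"] \<delta> by simp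
      show "v z y * \<phi> (linv y \<cdot> x) \<le> (\<phi> (linv z \<cdot> x) + \<delta>) * v z y"
      proof (cases "y \<in> X z")
        case True
        from X(3)[OF True x] have "\<phi> (linv y \<cdot> x) \<le> \<phi> (linv z \<cdot> x) + \<delta>" by linarith
        from mult_right_mono[OF this C00_plus_nonneg[OF v]] show ?thesis by (simp add: mult.commute)
      qed (simp add: v_def g(3))
    qed
    also have "\<dots> = (\<Sum>z\<in>Y. (\<phi> (linv z \<cdot> x) + \<delta>) * haar (v z))"
      using C00_plus_nonneg[OF \<phi>] \<delta> by (intro sum.cong haar_scale v) (auto simp: add_nonneg_nonneg less_imp_le)
    also have "\<dots> = (\<Sum>z\<in>Y. haar (v z) * \<phi> (linv z \<cdot> x)) + \<delta> * haar w"
      unfolding haar_w[symmetric] by (simp add: distrib_right distrib_left sum.distrib sum_distrib_left mult.commute)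
    finally show ?thesis .
  qed
  then show ?thesis using Y(1) haar_w haar_nonneg[OF v] by (intro exI[of _ Y] exI[of _ "\<lambda>z. haar (v z)"]) auto
qed

text \<open>If \<open>\<phi> (linv y \<cdot> x)\<close> is nonzero, then \<open>f x\<close> exceeds \<open>f y\<close> by little; adding a small multiple of a plateau
\<open>h\<close> to \<open>f\<close> absorbs the difference, and \<open>w\<close> is the result. Hence \<open>f x * haar (\<lambda>y. \<phi> (linv y))\<close> is at
most the convolution of \<open>w\<close> and \<open>\<phi>\<close> at \<open>x\<close>, and the Riemann sum of the previous lemma is a
covering of cost \<open>haar w\<close>, up to an error \<open>\<delta>\<close> that is arbitrarily small once \<open>\<phi>\<close> is fixed.\<close>

lemma covering_number_upper:
  assumes f: "f \<in> C00_plus" and \<epsilon>: "0 < \<epsilon>"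
  shows "\<exists>U. open U \<and> unit \<in> U \<and> (\<forall>\<phi>\<in>C00_plus. \<phi> \<noteq> (\<lambda>x. 0) \<longrightarrow> (\<forall>x. \<phi> x \<noteq> 0 \<longrightarrow> x \<in> U) \<longrightarrow>
    haar (\<lambda>y. \<phi> (linv y)) * covering_number f \<phi> \<le> haar f + \<epsilon>)"
proof -
  obtain S where S: "compact S" "\<And>x. f x \<noteq> 0 \<Longrightarrow> x \<in> S" using C00_plus_support[OF f] by blast
  obtain U0 K0 where U0: "open U0" "compact K0" "unit \<in> U0" "U0 \<subseteq> (K0 :: 'a set)"
    using locally_compact[unfolded locally_compact_space_def, rule_format, of unit] by auto
  \<comment> \<open>all \<open>y\<close> with \<open>linv y \<cdot> x \<in> K0\<close> for some \<open>x \<in> S\<close> lie in this compact set\<close>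
  let ?C = "S \<union> (\<lambda>z. rinv (rdiv (snd z) (fst z))) ` (S \<times> K0)"
  have "compact ?C"
    by (intro compact_Un S compact_continuous_image compact_Times U0 loop_continuous_intros)
  from C00_inv_dominating[OF f0 f0_nonzero this] obtain h
    where h: "h \<in> C00_inv" "\<And>x. x \<in> ?C \<Longrightarrow> 1 \<le> h x" by blast
  note hC = C00_invD(1)[OF h(1)]
  define \<epsilon>1 where "\<epsilon>1 = \<epsilon> / (haar h + 1)"
  have \<epsilon>1: "0 < \<epsilon>1" using \<epsilon> haar_nonneg[OF hC] by (simp add: \<epsilon>1_def)
  have \<epsilon>1h: "\<epsilon>1 * haar h \<le> \<epsilon>"
  proof -
    have "\<epsilon>1 * haar h \<le> \<epsilon>1 * (haar h + 1)" using \<epsilon>1 by simp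
    also have "\<dots> = \<epsilon>" using haar_nonneg[OF hC] by (simp add: \<epsilon>1_def)
    finally show ?thesis .
  qed
  have "\<exists>W. open W \<and> {unit} \<subseteq> W \<and> (\<forall>x y. linv y \<cdot> x \<in> W \<longrightarrow> \<bar>f x - f y\<bar> < \<epsilon>1)"
  proof (rule uniformly_continuous_loop[OF f _ _ \<epsilon>1])
    fix x y assume "linv y \<cdot> x \<in> {unit}"
    then have "linv y \<cdot> x = linv y \<cdot> y" by simp
    then have "x = y" by (simp only: left_cancel)
    then show "f x = f y" by simp
  qed simp
  then obtain U1 where U1: "open U1" "unit \<in> U1" "\<And>x y. linv y \<cdot> x \<in> U1 \<Longrightarrow> \<bar>f x - f y\<bar> < \<epsilon>1" by blast
  define w where "w y = f y + \<epsilon>1 * h y" for y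
  have w: "w \<in> C00_plus" unfolding w_def[abs_def] using \<epsilon>1 by (intro C00_plus_add C00_plus_scale f hC) auto
  have "haar w = haar f + \<epsilon>1 * haar h"
    unfolding w_def[abs_def] using \<epsilon>1 by (simp add: haar_add haar_scale f hC C00_plus_scale)
  then have haar_w: "haar w \<le> haar f + \<epsilon>" using \<epsilon>1h by simp
  have main: "haar (\<lambda>y. \<phi> (linv y)) * covering_number f \<phi> \<le> haar f + \<epsilon>"
    if \<phi>: "\<phi> \<in> C00_plus" "\<phi> \<noteq> (\<lambda>x. 0)" and supp: "\<And>x. \<phi> x \<noteq> 0 \<Longrightarrow> x \<in> U0 \<inter> U1" for \<phi>
  proof -
    define r where "r = haar (\<lambda>y. \<phi> (linv y))"
    have r: "0 \<le> r" unfolding r_def by (rule haar_nonneg[OF C00_plus_linv(1)[OF \<phi>(1)]])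
    have pointwise: "f x * r \<le> haar (\<lambda>y. w y * \<phi> (linv y \<cdot> x))" for x
    proof -
      have "f x * r = haar (\<lambda>y. f x * \<phi> (linv y \<cdot> x))"
        unfolding r_def haar_linv_right_translate[OF \<phi>(1), of x, symmetric]
        by (rule haar_scale[symmetric]) (intro C00_plus_linv(2) \<phi> C00_plus_nonneg[OF f])+
      also have "\<dots> \<le> haar (\<lambda>y. w y * \<phi> (linv y \<cdot> x))"
      proof (intro haar_mono C00_plus_scale C00_plus_mult w C00_plus_linv(2) \<phi> C00_plus_nonneg[OF f]
            C00_plus_nonneg[OF \<phi>(1)] C00_plus_cont[OF C00_plus_linv(2)[OF \<phi>(1)]])
        fix y
        have wy: "0 \<le> w y" by (rule C00_plus_nonneg[OF w])
        show "f x * \<phi> (linv y \<cdot> x) \<le> w y * \<phi> (linv y \<cdot> x)"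
        proof (cases "\<phi> (linv y \<cdot> x) = 0 \<or> f x = 0")
          case True
          then show ?thesis using wy C00_plus_nonneg[OF \<phi>(1)] by auto
        next
          case False
          then have u: "linv y \<cdot> x \<in> U0" "linv y \<cdot> x \<in> U1" "x \<in> S" using supp S(2) by auto
          have "y \<in> (\<lambda>z. rinv (rdiv (snd z) (fst z))) ` (S \<times> K0)"
            using u U0(4) by (intro image_eqI[of _ _ "(x, linv y \<cdot> x)"]) auto
          then have "1 \<le> h y" using h(2) by blast
          then have "\<epsilon>1 \<le> \<epsilon>1 * h y" using \<epsilon>1 by simp
          then have "f x \<le> w y" using U1(3)[OF u(2)] by (simp add: w_def)
          then show ?thesis using C00_plus_nonneg[OF \<phi>(1)] by (rule mult_right_mono)
        qed
      qed
      finally show ?thesis .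
    qed
    define D where "D = haar w * covering_number h \<phi>"
    have D: "0 \<le> D" unfolding D_def using haar_nonneg[OF w] covering_number_nonneg[OF hC \<phi>] by simp
    have "r * covering_number f \<phi> \<le> haar w + \<epsilon>'" if \<epsilon>': "0 < \<epsilon>'" for \<epsilon>'
    proof -
      define \<delta> where "\<delta> = \<epsilon>' / (D + 1)"
      have \<delta>: "0 < \<delta>" using \<epsilon>' D by (simp add: \<delta>_def)
      obtain Y a where Y: "finite Y" "\<forall>y\<in>Y. 0 \<le> a y" "(\<Sum>y\<in>Y. a y) = haar w"
        and Ya: "\<forall>x\<in>S. haar (\<lambda>y. w y * \<phi> (linv y \<cdot> x)) \<le> (\<Sum>y\<in>Y. a y * \<phi> (linv y \<cdot> x)) + \<delta> * haar w"
        using kernel_discretization[OF w \<phi>(1) S(1) \<delta>] by blast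
      let ?s = "\<lambda>x. \<Sum>y\<in>Y. a y * \<phi> (linv y \<cdot> x)"
      have s: "?s \<in> C00_plus"
        using Y by (intro C00_plus_sum C00_plus_scale C00_plus_left_translate \<phi>) auto
      have \<delta>w: "0 \<le> \<delta> * haar w" using \<delta> haar_nonneg[OF w] by simp
      have "r * f x \<le> ?s x + (\<delta> * haar w) * h x" for x
      proof (cases "f x = 0")
        case True
        then show ?thesis using C00_plus_nonneg[OF s, of x] \<delta>w C00_plus_nonneg[OF hC, of x] by simp
      next
        case False
        then have x: "x \<in> S" by (rule S(2))
        have "\<delta> * haar w \<le> (\<delta> * haar w) * h x" using h(2)[of x] x \<delta>w by (simp add: mult_le_cancel_left1)
        then show ?thesis using pointwise[of x] bspec[OF Ya x] by (simp add: mult.commute)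
      qed
      then have "covering_number (\<lambda>x. r * f x) \<phi> \<le> covering_number (\<lambda>x. ?s x + (\<delta> * haar w) * h x) \<phi>"
        using \<delta>w by (intro covering_number_mono \<phi> C00_plus_add C00_plus_scale s hC)
      also have "\<dots> \<le> covering_number ?s \<phi> + covering_number (\<lambda>x. (\<delta> * haar w) * h x) \<phi>"
        using \<delta>w by (intro covering_number_add \<phi> C00_plus_scale s hC)
      also have "covering_number ?s \<phi> \<le> (\<Sum>y\<in>Y. a y)"
        using Y by (intro covering_number_le[where b=linv]) (auto simp: C00_plus_nonneg[OF \<phi>(1)])
      also have "covering_number (\<lambda>x. (\<delta> * haar w) * h x) \<phi> = \<delta> * D"
        using covering_number_scale[OF hC \<phi> \<delta>w] by (simp add: D_def)
      also have "\<delta> * D \<le> \<delta> * (D + 1)" using \<delta> by simp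
      also have "\<delta> * (D + 1) = \<epsilon>'" using D by (simp add: \<delta>_def)
      finally show ?thesis using covering_number_scale[OF f \<phi> r] Y(3) by simp
    qed
    then have "r * covering_number f \<phi> \<le> haar w" by (rule field_le_epsilon)
    then show ?thesis using haar_w by (simp add: r_def)
  qed
  show ?thesis
    by (rule exI[of _ "U0 \<inter> U1"]) (use U0 U1 main in auto)
qed

lemma rinv_unit: "rinv unit = unit"
  using mult_rinv[of unit] by (simp only: unit_mult)

text \<open>Compare the upper and the lower bound for the covering number of \<open>f0\<close> by \<open>\<psi> = \<phi> \<circ> linv\<close>, using that
\<open>\<psi> \<circ> linv\<close> and \<open>\<phi>\<close> have the same integral.\<close>

lemma haar_le_haar_linv:
  assumes \<epsilon>: "0 < \<epsilon>"
  shows "\<exists>U. open U \<and> unit \<in> U \<and> (\<forall>\<phi>\<in>C00_plus. \<phi> \<noteq> (\<lambda>x. 0) \<longrightarrow> (\<forall>x. \<phi> x \<noteq> 0 \<longrightarrow> x \<in> U) \<longrightarrow>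
    haar \<phi> \<le> (1 + \<epsilon>) * haar (\<lambda>y. \<phi> (linv y)))"
proof -
  obtain V where V: "open V" "unit \<in> V" and upper: "\<And>\<psi>. \<psi> \<in> C00_plus \<Longrightarrow> \<psi> \<noteq> (\<lambda>x. 0) \<Longrightarrow>
      (\<forall>x. \<psi> x \<noteq> 0 \<longrightarrow> x \<in> V) \<Longrightarrow> haar (\<lambda>y. \<psi> (linv y)) * covering_number f0 \<psi> \<le> haar f0 + \<epsilon>"
    using covering_number_upper[OF C00_invD(1)[OF f0] \<epsilon>] by blast
  have "open (rinv -` V)" by (intro open_vimage V loop_continuous_intros)
  moreover have "unit \<in> rinv -` V" using V(2) rinv_unit by simp
  moreover have "haar \<phi> \<le> (1 + \<epsilon>) * haar (\<lambda>y. \<phi> (linv y))"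
    if \<phi>: "\<phi> \<in> C00_plus" "\<phi> \<noteq> (\<lambda>x. 0)" and supp: "\<forall>x. \<phi> x \<noteq> 0 \<longrightarrow> x \<in> rinv -` V" for \<phi>
  proof -
    let ?\<psi> = "\<lambda>y. \<phi> (linv y)"
    have \<psi>: "?\<psi> \<in> C00_plus" by (rule C00_plus_linv(1)[OF \<phi>(1)])
    obtain z where "\<phi> z \<noteq> 0" using \<phi>(2) by auto
    then have "?\<psi> (rinv z) \<noteq> 0" by simp
    then have \<psi>0: "?\<psi> \<noteq> (\<lambda>x. 0)" by (metis (full_types))
    have "\<forall>x. ?\<psi> x \<noteq> 0 \<longrightarrow> x \<in> V"
      using supp by (metis rinv_linv vimageD)
    from upper[OF \<psi> \<psi>0 this] have "haar \<phi> * covering_number f0 ?\<psi> \<le> 1 + \<epsilon>"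
      by (simp add: haar_linv_linv[OF \<phi>(1)] haar_f0)
    then have "haar \<phi> * covering_number f0 ?\<psi> * haar ?\<psi> \<le> (1 + \<epsilon>) * haar ?\<psi>"
      using haar_nonneg[OF \<psi>] by (rule mult_right_mono)
    moreover have "haar \<phi> * 1 \<le> haar \<phi> * (covering_number f0 ?\<psi> * haar ?\<psi>)"
      using haar_le_covering_number[OF C00_invD(1)[OF f0] \<psi> \<psi>0] haar_nonneg[OF \<phi>(1)]
      by (intro mult_left_mono) (simp_all add: haar_f0)
    ultimately show ?thesis by (simp add: mult.assoc)
  qed
  ultimately show ?thesis by (intro exI[of _ "rinv -` V"]) auto
qed

lemma eventually_small_support:
  assumes "open U" "unit \<in> U"
    and "\<And>\<phi>. \<phi> \<in> C00_plus \<Longrightarrow> \<phi> \<noteq> (\<lambda>x. 0) \<Longrightarrow> (\<And>x. \<phi> x \<noteq> 0 \<Longrightarrow> x \<in> U) \<Longrightarrow> P \<phi>"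
  shows "eventually (\<lambda>(V, \<phi>). P \<phi>) small_support_filter"
  unfolding small_support_filter_def
  by (rule eventually_INF1[of U]) (use assms in \<open>auto simp: eventually_principal\<close>)

lemma small_support_filter_nontrivial: "small_support_filter \<noteq> bot"
proof
  define S where "S U = {(V, \<phi>). open V \<and> unit \<in> V \<and> V \<subseteq> U \<and> \<phi> \<in> C00_plus \<and> \<phi> \<noteq> (\<lambda>x. 0) \<and>
    (\<forall>x. x \<notin> V \<longrightarrow> \<phi> x = 0)}" for U
  have filter: "small_support_filter = (INF U\<in>{U. open U \<and> unit \<in> U}. principal (S U))"
    by (simp add: small_support_filter_def S_def)
  have directed: "\<exists>U\<in>{U. open U \<and> unit \<in> U}. principal (S U) \<le> inf (principal (S A)) (principal (S B))"
    if "A \<in> {U. open U \<and> unit \<in> U}" "B \<in> {U. open U \<and> unit \<in> U}" for A B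
    using that by (intro bexI[of _ "A \<inter> B"]) (auto simp: S_def)
  assume "small_support_filter = bot"
  then have "eventually (\<lambda>_. False) (INF U\<in>{U. open U \<and> unit \<in> U}. principal (S U))" by (simp add: filter[symmetric])
  moreover have "{U. open U \<and> unit \<in> U} \<noteq> {}" using open_UNIV by blast
  ultimately have "\<exists>U\<in>{U. open U \<and> unit \<in> U}. eventually (\<lambda>_. False) (principal (S U))"
    using directed by (subst (asm) eventually_INF_base)
  then obtain U where U: "open U" "unit \<in> U" "\<forall>z\<in>S U. False"
    unfolding eventually_principal by blast
  have "\<exists>\<psi>\<in>C00_plus. (\<forall>x\<in>{unit}. \<psi> x = 1) \<and> (\<forall>x. x \<notin> U \<longrightarrow> \<psi> x = 0)"
    by (rule C00_plus_bump) (use U in simp_all)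
  then obtain \<psi> where "\<psi> \<in> C00_plus" "\<forall>x\<in>{unit}. \<psi> x = 1" "\<forall>x. x \<notin> U \<longrightarrow> \<psi> x = 0"
    by (elim bexE conjE)
  then have "(U, \<psi>) \<in> S U" using U(1,2) by (auto simp: S_def)
  with U(3) show False by (rule bspec)
qed

text \<open>The lower bound holds for every \<open>\<phi>\<close>. For small supports \<open>haar \<phi>\<close> exceeds \<open>haar (\<lambda>y. \<phi> (linv y))\<close> by a
factor of at most \<open>1 + \<epsilon>\<close>, which turns \<open>covering_number_upper\<close> into a matching upper bound.\<close>

lemma tendsto_covering_number_haar:
  assumes f: "f \<in> C00_plus"
  shows "((\<lambda>(U, \<phi>). covering_number f \<phi> * haar \<phi>) \<longlongrightarrow> haar f) small_support_filter"
proof (rule tendstoI)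
  fix \<eta> :: real assume \<eta>: "0 < \<eta>"
  let ?H = "haar f"
  have H: "0 \<le> ?H" by (rule haar_nonneg[OF f])
  define \<epsilon> where "\<epsilon> = min 1 (\<eta> / (2 * (?H + 2)))"
  have \<epsilon>: "0 < \<epsilon>" "\<epsilon> \<le> 1" using \<eta> H by (auto simp: \<epsilon>_def)
  have "(1 + \<epsilon>) * (?H + \<epsilon>) = ?H + \<epsilon> * (?H + 1 + \<epsilon>)" by (simp add: algebra_simps)
  also have "\<dots> \<le> ?H + \<epsilon> * (?H + 2)" using \<epsilon> by (intro add_left_mono mult_left_mono) auto
  also have "\<epsilon> * (?H + 2) \<le> \<eta> / (2 * (?H + 2)) * (?H + 2)" using H by (intro mult_right_mono) (auto simp: \<epsilon>_def)
  also have "\<dots> = \<eta> / 2" using H by (simp add: field_simps)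
  finally have bound: "(1 + \<epsilon>) * (?H + \<epsilon>) < ?H + \<eta>" using \<eta> by simp
  obtain U1 where U1: "open U1" "unit \<in> U1" and 1: "\<And>\<phi>. \<phi> \<in> C00_plus \<Longrightarrow> \<phi> \<noteq> (\<lambda>x. 0) \<Longrightarrow>
      \<forall>x. \<phi> x \<noteq> 0 \<longrightarrow> x \<in> U1 \<Longrightarrow> haar (\<lambda>y. \<phi> (linv y)) * covering_number f \<phi> \<le> ?H + \<epsilon>"
    using covering_number_upper[OF f \<epsilon>(1)] by blast
  obtain U2 where U2: "open U2" "unit \<in> U2" and 2: "\<And>\<phi>. \<phi> \<in> C00_plus \<Longrightarrow> \<phi> \<noteq> (\<lambda>x. 0) \<Longrightarrow>
      \<forall>x. \<phi> x \<noteq> 0 \<longrightarrow> x \<in> U2 \<Longrightarrow> haar \<phi> \<le> (1 + \<epsilon>) * haar (\<lambda>y. \<phi> (linv y))"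
    using haar_le_haar_linv[OF \<epsilon>(1)] by blast
  have "dist (covering_number f \<phi> * haar \<phi>) ?H < \<eta>"
    if \<phi>: "\<phi> \<in> C00_plus" "\<phi> \<noteq> (\<lambda>x. 0)" and supp: "\<And>x. \<phi> x \<noteq> 0 \<Longrightarrow> x \<in> U1 \<inter> U2" for \<phi>
  proof -
    have "covering_number f \<phi> * haar \<phi> \<le> covering_number f \<phi> * ((1 + \<epsilon>) * haar (\<lambda>y. \<phi> (linv y)))"
      using 2[OF \<phi>] supp covering_number_nonneg[OF f \<phi>] by (intro mult_left_mono) auto
    also have "\<dots> = (1 + \<epsilon>) * (haar (\<lambda>y. \<phi> (linv y)) * covering_number f \<phi>)" by simp
    also have "\<dots> \<le> (1 + \<epsilon>) * (?H + \<epsilon>)" using 1[OF \<phi>] supp \<epsilon> by (intro mult_left_mono) auto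
    finally have "covering_number f \<phi> * haar \<phi> < ?H + \<eta>" using bound by linarith
    with haar_le_covering_number[OF f \<phi>] \<eta> show ?thesis by (simp add: dist_real_def)
  qed
  then have "eventually (\<lambda>(V, \<phi>). dist (covering_number f \<phi> * haar \<phi>) ?H < \<eta>) small_support_filter"
    using U1 U2 by (intro eventually_small_support[of "U1 \<inter> U2"]) auto
  then show "eventually (\<lambda>z. dist (case z of (U, \<phi>) \<Rightarrow> covering_number f \<phi> * haar \<phi>) ?H < \<eta>) small_support_filter"
    by (simp add: case_prod_unfold)
qed

lemma J_lim_eq_haar:
  assumes f: "f \<in> C00_plus"
  shows "J_lim f0 f = haar f"
proof -
  have "((\<lambda>z. (case z of (U, \<phi>) \<Rightarrow> covering_number f \<phi> * haar \<phi>) / (case z of (U, \<phi>) \<Rightarrow> covering_number f0 \<phi> * haar \<phi>))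
      \<longlongrightarrow> haar f / haar f0) small_support_filter"
    by (intro tendsto_divide tendsto_covering_number_haar f C00_invD(1)[OF f0]) (simp add: haar_f0)
  moreover have "eventually (\<lambda>(V, \<phi>). 0 < haar \<phi>) small_support_filter"
    by (rule eventually_small_support[of UNIV]) (auto intro: haar_pos)
  then have "eventually (\<lambda>z. (case z of (U, \<phi>) \<Rightarrow> covering_number f \<phi> * haar \<phi>) / (case z of (U, \<phi>) \<Rightarrow> covering_number f0 \<phi> * haar \<phi>)
      = (case z of (U, \<phi>) \<Rightarrow> J_quot \<phi> f0 f)) small_support_filter"
    by eventually_elim (auto simp: J_quot_def)
  ultimately have "((\<lambda>(U, \<phi>). J_quot \<phi> f0 f) \<longlongrightarrow> haar f) small_support_filter"
    by (simp add: haar_f0 tendsto_cong)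
  then show ?thesis unfolding J_lim_def by (rule tendsto_Lim[OF small_support_filter_nontrivial])
qed

end

section \<open>Normality of the fan\<close>

context lc_topological_fan_loop
begin

lemma t_equation: "(a \<cdot> b) \<cdot> c = t a b c \<cdot> (a \<cdot> (b \<cdot> c))"
proof -
  have "\<exists>!s. s \<in> nucleus \<and> (a \<cdot> b) \<cdot> c = s \<cdot> (a \<cdot> (b \<cdot> c))"
    using ex_fan[of a b c] by (metis right_cancel)
  from theI'[OF this] show ?thesis unfolding t_def by blast
qed

lemma p_equation: "(a \<cdot> b) \<cdot> c = (a \<cdot> (b \<cdot> c)) \<cdot> p a b c"
proof -
  have "\<exists>!s. s \<in> nucleus \<and> (a \<cdot> b) \<cdot> c = (a \<cdot> (b \<cdot> c)) \<cdot> s"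
    using ex_fan[of a b c] by (metis left_cancel)
  from theI'[OF this] show ?thesis unfolding p_def by blast
qed

text \<open>The elements \<open>n\<close> of the fan with \<open>d n \<in> fan d\<close> for all \<open>d\<close> form a closed subgroup \<open>L\<close>, so by minimality it
suffices that \<open>L\<close> contains every \<open>t\<close> and \<open>p\<close>. Put \<open>x = a(bc)\<close>. For \<open>\<tau> = t(a,b,c)\<close> the product
\<open>(d\<tau>)x = d((ab)c)\<close> can be rebracketed into \<open>dx\<close> at the cost of left factors from the fan, and \<open>x\<close> may be
cancelled on the right. For \<open>\<pi> = p(a,b,c)\<close> one has \<open>x\<pi> = \<tau>x\<close>, and every \<open>d\<close> is of the form \<open>yx\<close>.
The second claim follows from the first one, applied to the left inverse of \<open>d\<close>.\<close>

lemma fan_normal: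
  assumes compact: "compact fan" and sub: "is_subgroup fan" and nuc: "fan \<subseteq> nucleus"
    and t: "\<And>a b c. t a b c \<in> fan" and p: "\<And>a b c. p a b c \<in> fan" and \<gamma>: "\<gamma> \<in> fan"
  shows "\<exists>\<delta>\<in>fan. d \<cdot> \<gamma> = \<delta> \<cdot> d" "\<exists>\<delta>\<in>fan. \<gamma> \<cdot> d = d \<cdot> \<delta>"
proof -
  have closed_fan: "unit \<in> fan" "\<And>a b. a \<in> fan \<Longrightarrow> b \<in> fan \<Longrightarrow> a \<cdot> b \<in> fan" "\<And>a. a \<in> fan \<Longrightarrow> linv a \<in> fan"
    using sub by (auto simp: is_subgroup_def linv_def)
  have assoc: "(\<gamma> \<cdot> b) \<cdot> c = \<gamma> \<cdot> (b \<cdot> c)" "(b \<cdot> \<gamma>) \<cdot> c = b \<cdot> (\<gamma> \<cdot> c)" "(b \<cdot> c) \<cdot> \<gamma> = b \<cdot> (c \<cdot> \<gamma>)"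
    if "\<gamma> \<in> fan" for \<gamma> b c using nucleusD[of \<gamma>] nuc that by blast+
  have mult_linv: "\<gamma> \<cdot> linv \<gamma> = unit" if "\<gamma> \<in> fan" for \<gamma>
  proof -
    have "(\<gamma> \<cdot> linv \<gamma>) \<cdot> \<gamma> = unit \<cdot> \<gamma>" using that by (simp add: assoc(1))
    then show ?thesis by (simp only: right_cancel)
  qed
  \<comment> \<open>equality of the cosets \<open>fan u\<close> and \<open>fan v\<close>, under which all bracketings of a product agree\<close>
  define eqv where "eqv u v \<longleftrightarrow> (\<exists>\<gamma>\<in>fan. u = \<gamma> \<cdot> v)" for u v
  have eqv_trans: "eqv u w" if "eqv u v" "eqv v w" for u v w
    using that closed_fan(2) assoc(1) unfolding eqv_def by metis
  have eqv_sym: "eqv v u" if uv: "eqv u v" for u v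
  proof -
    obtain \<gamma> where \<gamma>: "\<gamma> \<in> fan" "u = \<gamma> \<cdot> v" using uv unfolding eqv_def by blast
    then have "linv \<gamma> \<cdot> u = v" using assoc(1)[OF closed_fan(3)[OF \<gamma>(1)], of \<gamma> v] by simp
    then show ?thesis using closed_fan(3)[OF \<gamma>(1)] unfolding eqv_def by metis
  qed
  have eqv_mult: "eqv (u \<cdot> c) (v \<cdot> c)" if "eqv u v" for u v c
    using that assoc(1) unfolding eqv_def by metis
  have eqv_cancel: "eqv u v" if uv: "eqv (u \<cdot> c) (v \<cdot> c)" for u v c
  proof -
    obtain \<gamma> where \<gamma>: "\<gamma> \<in> fan" "u \<cdot> c = \<gamma> \<cdot> (v \<cdot> c)" using uv unfolding eqv_def by blast
    then have "u \<cdot> c = (\<gamma> \<cdot> v) \<cdot> c" by (simp add: assoc(1))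
    then have "u = \<gamma> \<cdot> v" by (simp only: right_cancel)
    with \<gamma>(1) show ?thesis unfolding eqv_def by blast
  qed
  have eqv_assoc: "eqv ((a \<cdot> b) \<cdot> c) (a \<cdot> (b \<cdot> c))" for a b c
    using t t_equation unfolding eqv_def by blast
  define L where "L = {n \<in> fan. \<forall>d. eqv (d \<cdot> n) d}"
  have L_closed: "closed L"
  proof -
    have "L = fan \<inter> (\<Inter>d. (\<lambda>n. rdiv (d \<cdot> n) d) -` fan)"
      unfolding L_def eqv_def by (auto, metis rdiv_mult, metis mult_rdiv)
    moreover have "closed ((\<lambda>n. rdiv (d \<cdot> n) d) -` fan)" for d
      by (intro closed_vimage compact_closed compact loop_continuous_intros)
    ultimately show ?thesis using compact_closed[OF compact] by (auto intro!: closed_INT closed_Int)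
  qed
  have L_mult: "m \<cdot> n \<in> L" if "m \<in> L" "n \<in> L" for m n
  proof -
    have mn: "m \<in> fan" "n \<in> fan" using that by (auto simp: L_def)
    have "eqv ((d \<cdot> m) \<cdot> n) d" for d
      using that by (intro eqv_trans[of "(d \<cdot> m) \<cdot> n" "d \<cdot> m" d]) (auto simp: L_def)
    then show ?thesis using mn by (simp add: L_def closed_fan(2) assoc(3))
  qed
  have L_linv: "linv n \<in> L" if n: "n \<in> L" for n
  proof -
    have nf: "n \<in> fan" using n by (simp add: L_def)
    have "eqv (d \<cdot> linv n) d" for d
    proof -
      have "eqv ((d \<cdot> linv n) \<cdot> n) (d \<cdot> linv n)" using n by (simp add: L_def)
      moreover have "(d \<cdot> linv n) \<cdot> n = d" using nf by (simp add: assoc(3))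
      ultimately show ?thesis using eqv_sym by simp
    qed
    then show ?thesis using closed_fan(3)[OF nf] by (simp add: L_def)
  qed
  have "is_subgroup L"
    unfolding is_subgroup_def
  proof (intro conjI ballI)
    show "unit \<in> L" using closed_fan(1) unit_mult by (auto simp: L_def eqv_def intro: bexI[of _ unit])
    fix a b assume ab: "a \<in> L" "b \<in> L"
    then have f: "a \<in> fan" "b \<in> fan" by (auto simp: L_def)
    show "a \<cdot> b \<in> L" by (rule L_mult[OF ab])
    have "a \<cdot> (linv a \<cdot> b) = b" using f by (simp add: assoc(1)[symmetric] mult_linv)
    then have "ldiv a b = linv a \<cdot> b" using ldiv_mult[of a "linv a \<cdot> b"] by simp
    then show "ldiv a b \<in> L" using L_mult L_linv ab by simp
    have "(b \<cdot> linv a) \<cdot> a = b" using f by (simp add: assoc(3))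
    then have "rdiv b a = b \<cdot> linv a" using rdiv_mult[of "b \<cdot> linv a" a] by simp
    then show "rdiv b a \<in> L" using L_mult L_linv ab by simp
    show "(a \<cdot> b) \<cdot> c = a \<cdot> (b \<cdot> c)" for c by (rule assoc(1)[OF f(1)])
  qed
  moreover have t_L: "t a b c \<in> L" for a b c
  proof -
    have "eqv (d \<cdot> t a b c) d" for d
    proof (rule eqv_cancel)
      let ?x = "a \<cdot> (b \<cdot> c)"
      have "(d \<cdot> t a b c) \<cdot> ?x = d \<cdot> ((a \<cdot> b) \<cdot> c)"
        by (simp add: assoc(2)[OF t] t_equation[symmetric])
      moreover have "eqv (d \<cdot> ((a \<cdot> b) \<cdot> c)) (d \<cdot> ?x)"
      proof -
        note eqv_sym[OF eqv_assoc, of d "a \<cdot> b" c]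
        also have "eqv ((d \<cdot> (a \<cdot> b)) \<cdot> c) (((d \<cdot> a) \<cdot> b) \<cdot> c)"
          by (rule eqv_mult[OF eqv_sym[OF eqv_assoc]])
        also (eqv_trans) note eqv_assoc[of "d \<cdot> a" b c]
        also (eqv_trans) note eqv_assoc[of d a "b \<cdot> c"]
        finally (eqv_trans) show ?thesis .
      qed
      ultimately show "eqv ((d \<cdot> t a b c) \<cdot> ?x) (d \<cdot> ?x)" by simp
    qed
    then show ?thesis using t by (simp add: L_def)
  qed
  moreover have "p a b c \<in> L" for a b c
  proof -
    let ?x = "a \<cdot> (b \<cdot> c)"
    have "eqv (d \<cdot> p a b c) d" for d
    proof -
      let ?y = "rdiv d ?x"
      have "d \<cdot> p a b c = (?y \<cdot> ?x) \<cdot> p a b c" by simp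
      also have "\<dots> = ?y \<cdot> (t a b c \<cdot> ?x)"
        unfolding assoc(3)[OF p, of ?y ?x] p_equation[symmetric] t_equation[symmetric] ..
      also have "\<dots> = (?y \<cdot> t a b c) \<cdot> ?x" by (rule assoc(2)[OF t, symmetric])
      finally have "d \<cdot> p a b c = (?y \<cdot> t a b c) \<cdot> ?x" .
      moreover have "eqv ((?y \<cdot> t a b c) \<cdot> ?x) (?y \<cdot> ?x)" using t_L by (intro eqv_mult) (simp add: L_def)
      ultimately show ?thesis by simp
    qed
    then show ?thesis using p by (simp add: L_def)
  qed
  ultimately have "fan \<subseteq> L" unfolding fan_def using L_closed by (intro Inter_lower) auto
  then have right: "\<exists>\<delta>\<in>fan. d \<cdot> \<gamma> = \<delta> \<cdot> d" if "\<gamma> \<in> fan" for d \<gamma>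
    using that unfolding L_def eqv_def by blast
  from right[OF \<gamma>] show "\<exists>\<delta>\<in>fan. d \<cdot> \<gamma> = \<delta> \<cdot> d" .
  obtain \<sigma> where \<sigma>: "\<sigma> \<in> fan" "linv d \<cdot> \<gamma> = \<sigma> \<cdot> linv d" using right[OF \<gamma>] by blast
  let ?\<delta> = "ldiv d (\<gamma> \<cdot> d)"
  have "linv d \<cdot> (d \<cdot> ?\<delta>) = (\<sigma> \<cdot> linv d) \<cdot> d" using assoc(2)[OF \<gamma>, of "linv d" d] \<sigma>(2) by simp
  also have "\<dots> = \<sigma>" using assoc(1)[OF \<sigma>(1)] by simp
  finally have "?\<delta> = t (linv d) d ?\<delta> \<cdot> \<sigma>" using t_equation[of "linv d" d ?\<delta>] by simp
  then have "?\<delta> \<in> fan" using closed_fan(2)[OF t \<sigma>(1)] by metis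
  then show "\<exists>\<delta>\<in>fan. \<gamma> \<cdot> d = d \<cdot> \<delta>" by (intro bexI[of _ ?\<delta>]) simp_all
qed

end

theorem theorem3p15:
  fixes mult :: "'a::t1_space \<Rightarrow> 'a \<Rightarrow> 'a"
    and N\<^sub>0 :: "'a set" and f\<^sub>0 g :: "'a \<Rightarrow> real" and J :: "('a \<Rightarrow> real) \<Rightarrow> real"
  assumes "topological_fan_loop mult"
    and "locally_compact_space (euclidean :: 'a topology)"
    and "N\<^sub>0 = topological_fan_loop.fan mult"
    and "compact N\<^sub>0"
    and "loop.is_subgroup mult N\<^sub>0"
    and "N\<^sub>0 \<subseteq> loop.nucleus mult"
    and "\<And>a b c. fan_loop.t mult a b c \<in> N\<^sub>0"
    and "\<And>a b c. fan_loop.p mult a b c \<in> N\<^sub>0"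
    and "f\<^sub>0 \<in> topological_fan_loop.Upsilon mult N\<^sub>0"
    and "g \<in> C00_plus" and "g \<noteq> (\<lambda>x. 0)"
    and "J = topological_fan_loop.J_normalized mult f\<^sub>0 g"
  shows "(\<forall>f\<in>C00_plus. 0 \<le> J f \<and> (f \<noteq> (\<lambda>x. 0) \<longrightarrow> 0 < J f)) \<and>
    (\<forall>n\<ge>1. \<forall>(f :: nat \<Rightarrow> 'a \<Rightarrow> real) (\<alpha> :: nat \<Rightarrow> real).
       (\<forall>i\<in>{1..n}. f i \<in> C00_plus \<and> 0 \<le> \<alpha> i) \<longrightarrow>
         J (\<lambda>x. \<Sum>i=1..n. \<alpha> i * f i x) = (\<Sum>i=1..n. \<alpha> i * J (f i))) \<and>
    (\<forall>b. \<forall>f\<in>C00_plus. J (loop.left_translate mult b f) = J f)"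
proof -
  interpret topological_fan_loop mult by fact
  interpret lc_topological_fan_loop mult by unfold_locales fact
  note N = assms(3-8)
  have normal: "\<exists>\<delta>\<in>N\<^sub>0. mult d \<gamma> = mult \<delta> d" "\<exists>\<delta>\<in>N\<^sub>0. mult \<gamma> d = mult d \<delta>" if "\<gamma> \<in> N\<^sub>0" for d \<gamma>
    using fan_normal[of \<gamma> d] N that by auto
  interpret compact_by_group_loop mult N\<^sub>0
  proof
    show "\<exists>\<gamma>\<in>N\<^sub>0. mult (mult a b) c = mult \<gamma> (mult a (mult b c))" for a b c
      using N(5) t_equation by blast
  qed (use N normal in auto)
  have f0: "f\<^sub>0 \<in> C00_inv" "f\<^sub>0 \<noteq> (\<lambda>x. 0)" using assms(9) by (auto simp: Upsilon_def C00_inv_def)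
  obtain \<Lambda> where "invariant_functional mult N\<^sub>0 \<Lambda> f\<^sub>0"
    using invariant_functional_exists[OF f0] by blast
  then interpret invariant_functional mult N\<^sub>0 \<Lambda> f\<^sub>0 .
  have J: "J f = haar f / haar g" if "f \<in> C00_plus" for f
    using that assms(10) by (simp add: assms(12) J_normalized_def J_lim_eq_haar)
  have g: "0 < haar g" by (rule haar_pos[OF assms(10,11)])
  show ?thesis
  proof (intro conjI ballI allI impI)
    fix f :: "'a \<Rightarrow> real" assume f: "f \<in> C00_plus"
    show "0 \<le> J f" using haar_nonneg[OF f] g by (simp add: J[OF f])
    show "0 < J f" if "f \<noteq> (\<lambda>x. 0)" using haar_pos[OF f that] g by (simp add: J[OF f])
    show "J (left_translate b f) = J f" for b
      unfolding left_translate_def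
      by (simp add: J[OF f] J[OF C00_plus_left_translate[OF f]] haar_left_translate[OF f])
  next
    fix n :: nat and f :: "nat \<Rightarrow> 'a \<Rightarrow> real" and \<alpha> :: "nat \<Rightarrow> real"
    assume "\<forall>i\<in>{1..n}. f i \<in> C00_plus \<and> 0 \<le> \<alpha> i"
    then have f: "f i \<in> C00_plus" "0 \<le> \<alpha> i" if "i \<in> {1..n}" for i using that by blast+
    have "J (\<lambda>x. \<Sum>i=1..n. \<alpha> i * f i x) = haar (\<lambda>x. \<Sum>i=1..n. \<alpha> i * f i x) / haar g"
      using f by (intro J C00_plus_sum C00_plus_scale) auto
    also have "haar (\<lambda>x. \<Sum>i=1..n. \<alpha> i * f i x) = (\<Sum>i=1..n. haar (\<lambda>x. \<alpha> i * f i x))"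
      using f by (intro haar_sum C00_plus_scale) auto
    also have "\<dots> = (\<Sum>i=1..n. \<alpha> i * haar (f i))"
      using f by (intro sum.cong haar_scale) auto
    also have "\<dots> / haar g = (\<Sum>i=1..n. \<alpha> i * J (f i))"
      using f J by (simp add: sum_divide_distrib)
    finally show "J (\<lambda>x. \<Sum>i=1..n. \<alpha> i * f i x) = (\<Sum>i=1..n. \<alpha> i * J (f i))" .
  qed
qed

end
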